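(* Let $R\in\mathrm M(\Omega)$ be reciprocal, let $\mathcal T\subset[0,1]$, $\mu_t\in\mathrm P(\mathcal X)$ for $t\in\mathcal T$, and $\pi\in\mathrm P(\mathcal X^2)$. Suppose that the Brödinger problem $$H(P|R)\to\min;\qquad P\in\mathrm P(\Omega):\ P_t=\mu_t\ \ \forall t\in\mathcal T,\quad P_{0,1}=\pi$$ admits a (unique) solution $P$. Then $P$ is reciprocal. In addition, if $R$ is irreducible in the sense that $R_s\otimes R_u\otimes R_t\ll R_{s,u,t}\ll R_s\otimes R_u\otimes R_t$ for all $0\le s<u<t\le1$, and if $\mathcal T=\{t_1,\dots,t_K\}$ is finite, then there exist measurable functions $\eta:\mathcal X^2\to[-\infty,+\infty)$ and $f_1,\dots,f_K:\mathcal X\to[-\infty,+\infty)$ such that $$\frac{dP}{dR}=\exp\Big(\eta(X_0,X_1)+\sum_{i=1}^K f_i(X_{t_i})\Big),\qquad R\text{-a.e.}$$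
   Context: $\mathcal X$ is a Polish space, $\Omega=C([0,1];\mathcal X)$ is the set of continuous paths with the topology of uniform convergence and its Borel $\sigma$-field, and $X_t(\omega)=\omega(t)$ is the canonical process; for $\mathcal T\subset[0,1]$, $X_{\mathcal T}=(X_t)_{t\in\mathcal T}$. $\mathrm M(\Omega)$ and $\mathrm P(\Omega)$ are the sets of (nonnegative) Borel measures and Borel probability measures on $\Omega$; $Q_{t_1,\dots,t_k}$ is the image of $Q$ by $(X_{t_1},\dots,X_{t_k})$. A path measure $Q\in \mathrm M(\Omega)$ is conditionable if $Q_t$ is $\sigma$-finite for every $t\in[0,1]$. $Q$ is reciprocal if it is conditionable and for all $0<s<u<1$, $A\in\sigma(X_{[0,s]},X_{[u,1]})$, $B\in\sigma(X_{[s,u]})$: $Q(A\cap B\mid X_s,X_u)=Q(A\mid X_s,X_u)\,Q(B\mid X_s,X_u)$, $Q$-a.e. Relative entropy: $H(P|R)=E_P[\log \frac{dP}{dR}]$ ; precisely, for $R$ conditionable (possibly unbounded) and $P\in\mathrm P(\Omega)$, if $W:\Omega\to[0,\infty)$ is measurable with $z_W=\int e^{-W}dR<\infty$ and $\int W\,dP<\infty$, put $R_W=z_W^{-1}e^{-W}R$ and $H(P|R)=H(P|R_W)-\int W\,dP-\log z_W\in(-\infty,\infty]$, where $H(P|R_W)$ is the usual relative entropy between probability measures; the value does not depend on $W$, and $H(P|R)$ is defined whenever such a $W$ exists. A solution of the minimization problem is a minimizer with $H(P|R)<\infty$. Convention: $\exp(-\infty)=0$. *)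

theory Defs
  imports "HOL-Probability.Probability"
begin

section \<open>Path space\<close>

text \<open>Paths are functions on \<open>real\<close> that are \<open>undefined\<close> outside \<open>{0..1}\<close>; \<open>cfunspace\<close> equips them
  with the uniform metric, and the canonical process is evaluation, \<open>X\<^sub>t \<omega> = \<omega> t\<close>.\<close>

definition path_metric :: "(real \<Rightarrow> 'a::polish_space) metric" where
  "path_metric = cfunspace (top_of_set {0..1}) euclidean_metric"

abbreviation paths :: "(real \<Rightarrow> 'a::polish_space) set" where
  "paths \<equiv> mspace path_metric"

definition path_borel :: "(real \<Rightarrow> 'a::polish_space) measure" where
  "path_borel = sigma paths {U. openin (mtopology_of path_metric) U}"

definition path_measures :: "(real \<Rightarrow> 'a::polish_space) measure set" where
  "path_measures = {Q. sets Q = sets path_borel}"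

definition path_probs :: "(real \<Rightarrow> 'a::polish_space) measure set" where
  "path_probs = {Q. sets Q = sets path_borel \<and> prob_space Q}"

text \<open>\<open>path_sigma T\<close> is the \<open>\<sigma>\<close>-field generated by \<open>X\<^sub>T = (X\<^sub>t)\<^sub>t\<close>, \<open>t \<in> T\<close>, viewed as a map into the
  product space.\<close>

definition path_sigma :: "real set \<Rightarrow> (real \<Rightarrow> 'a::polish_space) measure" where
  "path_sigma T = vimage_algebra paths (\<lambda>\<omega>. restrict \<omega> T) (Pi\<^sub>M T (\<lambda>_. borel))"

definition marg1 :: "(real \<Rightarrow> 'a::polish_space) measure \<Rightarrow> real \<Rightarrow> 'a measure" where
  "marg1 Q t = distr Q borel (\<lambda>\<omega>. \<omega> t)"

definition marg2 :: "(real \<Rightarrow> 'a::polish_space) measure \<Rightarrow> real \<Rightarrow> real \<Rightarrow> ('a \<times> 'a) measure" where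
  "marg2 Q s t = distr Q borel (\<lambda>\<omega>. (\<omega> s, \<omega> t))"

definition marg3 ::
  "(real \<Rightarrow> 'a::polish_space) measure \<Rightarrow> real \<Rightarrow> real \<Rightarrow> real \<Rightarrow> ('a \<times> 'a \<times> 'a) measure" where
  "marg3 Q s u t = distr Q borel (\<lambda>\<omega>. (\<omega> s, \<omega> u, \<omega> t))"

lemma paths_iff:
  "\<omega> \<in> (paths :: (real \<Rightarrow> 'a::polish_space) set) \<longleftrightarrow>
     \<omega> \<in> extensional {0..1} \<and> continuous_on {0..1} \<omega>"
proof -
  have "bounded (\<omega> ` {0..1})" if "continuous_on {0..1} \<omega>"
    using that by (intro compact_imp_bounded compact_continuous_image) auto
  then show ?thesis
    by (auto simp: path_metric_def)
qed

lemma space_path_borel: "space path_borel = paths"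
  unfolding path_borel_def
  by (rule space_measure_of) (auto dest!: openin_subset)

lemma measurable_path_eval:
  assumes "t \<in> {0..1}"
  shows "(\<lambda>\<omega>. \<omega> t) \<in> measurable path_borel (borel :: 'a::polish_space measure)"
proof (rule borel_measurableI)
  fix S :: "'a set" assume S: "open S"
  have "openin (mtopology_of path_metric) ((\<lambda>\<omega>. \<omega> t) -` S \<inter> paths)"
  proof -
    interpret M: Metric_space "paths :: (real \<Rightarrow> 'a) set" "mdist path_metric"
      by simp
    show ?thesis
      unfolding mtopology_of_def M.openin_mtopology
    proof (intro conjI allI impI)
      fix w :: "real \<Rightarrow> 'a" assume w: "w \<in> (\<lambda>\<omega>. \<omega> t) -` S \<inter> paths"
      then obtain r where r: "r > 0" "\<And>y. dist (w t) y \<le> r \<Longrightarrow> y \<in> S"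
        using S by (auto simp: open_contains_cball subset_iff)
      have "dist (w t) (v t) \<le> r" if "v \<in> M.mball w r" for v
      proof -
        have "mdist euclidean_metric (w t) (v t) \<le> r"
          using that w assms
          by (intro mdist_cfunspace_imp_mdist_le[of w "top_of_set {0..1}" euclidean_metric v])
             (auto simp: path_metric_def[symmetric] M.in_mball)
        then show ?thesis by simp
      qed
      then show "\<exists>r>0. M.mball w r \<subseteq> (\<lambda>\<omega>. \<omega> t) -` S \<inter> paths"
        using r by (intro exI[of _ r]) (auto simp: M.in_mball)
    qed auto
  qed
  moreover have "{U. openin (mtopology_of path_metric) U} \<subseteq> Pow (paths :: (real \<Rightarrow> 'a) set)"
    by (auto dest!: openin_subset)
  ultimately show "(\<lambda>\<omega>. \<omega> t) -` S \<inter> space path_borel \<in> sets path_borel"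
    unfolding space_path_borel by (simp add: path_borel_def in_measure_of)
qed

section \<open>Conditionable, reciprocal and irreducible path measures\<close>

definition conditionable :: "(real \<Rightarrow> 'a::polish_space) measure \<Rightarrow> bool" where
  "conditionable Q \<longleftrightarrow> Q \<in> path_measures \<and> (\<forall>t\<in>{0..1}. sigma_finite_measure (marg1 Q t))"

text \<open>\<open>Q(A | X\<^sub>T)\<close>; for conditionable \<open>Q\<close> and nonempty \<open>T\<close> the restriction of \<open>Q\<close> to \<open>path_sigma T\<close> is
  \<open>\<sigma>\<close>-finite, so this is meaningful even if \<open>Q\<close> is unbounded.\<close>

definition cond_path ::
  "(real \<Rightarrow> 'a::polish_space) measure \<Rightarrow> real set \<Rightarrow> (real \<Rightarrow> 'a) set \<Rightarrow> (real \<Rightarrow> 'a) \<Rightarrow> ennreal" where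
  "cond_path Q T A = nn_cond_exp Q (path_sigma T) (indicator A)"

definition reciprocal :: "(real \<Rightarrow> 'a::polish_space) measure \<Rightarrow> bool" where
  "reciprocal Q \<longleftrightarrow> conditionable Q \<and>
     (\<forall>s u A B. 0 < s \<and> s < u \<and> u < 1 \<longrightarrow>
        A \<in> sets (path_sigma ({0..s} \<union> {u..1})) \<longrightarrow> B \<in> sets (path_sigma {s..u}) \<longrightarrow>
        (AE \<omega> in Q. cond_path Q {s, u} (A \<inter> B) \<omega> =
                    cond_path Q {s, u} A \<omega> * cond_path Q {s, u} B \<omega>))"

definition irreducible_path :: "(real \<Rightarrow> 'a::polish_space) measure \<Rightarrow> bool" where
  "irreducible_path R \<longleftrightarrow>
     (\<forall>s u t. 0 \<le> s \<and> s < u \<and> u < t \<and> t \<le> 1 \<longrightarrow>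
        absolutely_continuous (marg3 R s u t) (marg1 R s \<Otimes>\<^sub>M marg1 R u \<Otimes>\<^sub>M marg1 R t) \<and>
        absolutely_continuous (marg1 R s \<Otimes>\<^sub>M marg1 R u \<Otimes>\<^sub>M marg1 R t) (marg3 R s u t))"

section \<open>Relative entropy\<close>

text \<open>\<open>H(P|Q)\<close> for probability measures. The negative part of \<open>log (dP/dQ)\<close> is always
  \<open>P\<close>-integrable, so non-integrability means that the integral is \<open>+\<infinity>\<close>.\<close>

definition rel_entropy_prob :: "'b measure \<Rightarrow> 'b measure \<Rightarrow> ereal" where
  "rel_entropy_prob P Q =
     (if absolutely_continuous Q P \<and> integrable P (entropy_density (exp 1) Q P)
      then ereal (KL_divergence (exp 1) Q P) else \<infinity>)"

definition z_weight :: "'b measure \<Rightarrow> ('b \<Rightarrow> real) \<Rightarrow> ennreal" where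
  "z_weight R W = (\<integral>\<^sup>+\<omega>. ennreal (exp (- W \<omega>)) \<partial>R)"

definition weighted :: "'b measure \<Rightarrow> ('b \<Rightarrow> real) \<Rightarrow> 'b measure" where
  "weighted R W = density R (\<lambda>\<omega>. ennreal (exp (- W \<omega>)) / z_weight R W)"

text \<open>\<open>0 < z_weight R W\<close> only excludes \<open>R = 0\<close>, for which \<open>weighted R W\<close> is no probability measure.\<close>

definition entropy_weight :: "'b measure \<Rightarrow> 'b measure \<Rightarrow> ('b \<Rightarrow> real) \<Rightarrow> bool" where
  "entropy_weight P R W \<longleftrightarrow>
     W \<in> borel_measurable R \<and> (\<forall>\<omega>\<in>space R. 0 \<le> W \<omega>) \<and>
     0 < z_weight R W \<and> z_weight R W < \<infinity> \<and> integrable P W"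

definition rel_entropy_via :: "'b measure \<Rightarrow> 'b measure \<Rightarrow> ('b \<Rightarrow> real) \<Rightarrow> ereal" where
  "rel_entropy_via P R W =
     rel_entropy_prob P (weighted R W) - ereal (\<integral>\<omega>. W \<omega> \<partial>P) - ereal (ln (enn2real (z_weight R W)))"

definition rel_entropy_defined :: "'b measure \<Rightarrow> 'b measure \<Rightarrow> bool" where
  "rel_entropy_defined P R \<longleftrightarrow> (\<exists>W. entropy_weight P R W)"

text \<open>Only meaningful under \<open>rel_entropy_defined P R\<close>; then, for a probability measure \<open>P\<close>, the
  choice of \<open>W\<close> is irrelevant by \<open>rel_entropy_eq\<close> below.\<close>

definition rel_entropy :: "'b measure \<Rightarrow> 'b measure \<Rightarrow> ereal" where
  "rel_entropy P R = rel_entropy_via P R (SOME W. entropy_weight P R W)"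

lemma weighted_facts:
  assumes W: "entropy_weight P R W"
  obtains z where "z > 0" "z_weight R W = ennreal z"
    "weighted R W = density R (\<lambda>\<omega>. ennreal (exp (- W \<omega>) / z))"
    "prob_space (weighted R W)"
proof -
  obtain z where z: "z > 0" "z_weight R W = ennreal z"
    using W by (cases "z_weight R W") (auto simp: entropy_weight_def)
  have m[measurable]: "W \<in> borel_measurable R"
    using W by (simp add: entropy_weight_def)
  have eq: "weighted R W = density R (\<lambda>\<omega>. ennreal (exp (- W \<omega>) / z))"
    using z by (simp add: weighted_def divide_ennreal)
  have "emeasure (weighted R W) (space (weighted R W)) = (\<integral>\<^sup>+\<omega>. ennreal (exp (- W \<omega>)) / ennreal z \<partial>R)"
    using z by (simp add: eq emeasure_density divide_ennreal cong: nn_integral_cong)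
  also have "\<dots> = z_weight R W / ennreal z"
    by (simp add: nn_integral_divide z_weight_def)
  also have "\<dots> = 1"
    using z by (simp add: divide_ennreal)
  finally show ?thesis
    using z eq by (intro that) (auto intro: prob_spaceI)
qed

lemma rel_entropy_via_le:
  assumes P: "prob_space P" and sets: "sets P = sets R"
    and W: "entropy_weight P R W" and V: "entropy_weight P R V"
  shows "rel_entropy_via P R V \<le> rel_entropy_via P R W"
proof (cases "rel_entropy_prob P (weighted R W) = \<infinity>")
  case True
  then show ?thesis by (simp add: rel_entropy_via_def)
next
  case False
  let ?RW = "weighted R W" and ?RV = "weighted R V"
  obtain z where z: "z > 0" "z_weight R W = ennreal z"
    "?RW = density R (\<lambda>\<omega>. ennreal (exp (- W \<omega>) / z))" "prob_space ?RW"
    by (rule weighted_facts[OF W])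
  obtain y where y: "y > 0" "z_weight R V = ennreal y"
    "?RV = density R (\<lambda>\<omega>. ennreal (exp (- V \<omega>) / y))" "prob_space ?RV"
    by (rule weighted_facts[OF V])
  interpret P: prob_space P by fact
  interpret RW: prob_space ?RW by fact
  interpret RV: prob_space ?RV by fact
  have [measurable]: "W \<in> borel_measurable R" "V \<in> borel_measurable R"
    and int: "integrable P W" "integrable P V"
    using W V by (simp_all add: entropy_weight_def)
  have ac: "absolutely_continuous ?RW P"
    and intg: "integrable P (entropy_density (exp 1) ?RW P)"
    using False by (auto simp: rel_entropy_prob_def split: if_splits)
  define g where "g = RN_deriv ?RW P"
  have sW: "sets ?RW = sets R" and sV: "sets ?RV = sets R"
    by (simp_all add: z y)
  have g[measurable]: "g \<in> borel_measurable R"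
    unfolding g_def using borel_measurable_RN_deriv[of ?RW P] measurable_cong_sets[OF sW refl]
    by blast
  have Pg: "density ?RW g = P"
    unfolding g_def by (rule RW.density_RN_deriv[OF ac]) (simp add: sets sW)
  define h where "h = (\<lambda>\<omega>. ennreal (exp (V \<omega> - W \<omega>) * y / z) * g \<omega>)"
  have h[measurable]: "h \<in> borel_measurable R"
    unfolding h_def by measurable
  have Ph: "density ?RV h = P"
  proof -
    have "density ?RV h = density R (\<lambda>\<omega>. ennreal (exp (- V \<omega>) / y) * h \<omega>)"
      by (simp add: y density_density_eq)
    also have "\<dots> = density R (\<lambda>\<omega>. ennreal (exp (- W \<omega>) / z) * g \<omega>)"
    proof -
      have "ennreal (exp (- V \<omega>) / y) * h \<omega> = ennreal (exp (- W \<omega>) / z) * g \<omega>" for \<omega>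
      proof -
        have "exp (- V \<omega>) / y * (exp (V \<omega> - W \<omega>) * y / z) = exp (- W \<omega>) / z"
          using y(1) z(1) by (simp add: field_simps flip: exp_add)
        then show ?thesis
          using y(1) z(1)
          by (simp add: h_def mult.assoc[symmetric] ennreal_mult[symmetric])
      qed
      then show ?thesis by simp
    qed
    also have "\<dots> = P"
      using Pg by (simp add: z density_density_eq)
    finally show ?thesis .
  qed
  have "AE \<omega> in ?RV. h \<omega> = RN_deriv ?RV P \<omega>"
    by (rule RV.RN_deriv_unique) (use Ph h measurable_cong_sets[OF sV refl] in blast)+
  moreover have acV: "absolutely_continuous ?RV P"
    by (subst Ph[symmetric], rule absolutely_continuousI_density)
       (use h measurable_cong_sets[OF sV refl] in blast)
  ultimately have AEh: "AE \<omega> in P. RN_deriv ?RV P \<omega> = h \<omega>"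
    using absolutely_continuous_AE[of P ?RV] by (force simp: sets sV)
  have gRW: "g \<in> borel_measurable ?RW"
    using g measurable_cong_sets[OF sW refl] by blast
  have "AE \<omega> in ?RW. g \<omega> \<noteq> \<infinity>"
    unfolding g_def by (rule RW.RN_deriv_finite) (auto simp: sets sW ac P.sigma_finite_measure_axioms)
  then have "AE \<omega> in P. g \<omega> \<noteq> \<infinity>"
    using absolutely_continuous_AE[of P ?RW] ac by (simp add: sets sW)
  moreover have "AE \<omega> in P. g \<omega> \<noteq> 0"
    by (subst Pg[symmetric]) (auto simp: AE_density gRW zero_less_iff_neq_zero)
  ultimately have logs: "AE \<omega> in P. entropy_density (exp 1) ?RV P \<omega> =
      entropy_density (exp 1) ?RW P \<omega> + (V \<omega> - W \<omega>) + (ln y - ln z)"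
    using AEh
  proof eventually_elim
    case (elim \<omega>)
    then obtain r where r: "g \<omega> = ennreal r" "r > 0"
      by (cases "g \<omega>") (auto simp: less_le)
    have "enn2real (h \<omega>) = exp (V \<omega> - W \<omega>) * y / z * r"
      using y(1) z(1) r by (simp add: h_def enn2real_mult)
    then show ?case
      using elim r y(1) z(1)
      by (simp add: entropy_density_def g_def[symmetric] log_def ln_mult ln_div)
  qed
  have [measurable]: "entropy_density (exp 1) ?RV P \<in> borel_measurable P"
    "entropy_density (exp 1) ?RW P \<in> borel_measurable P"
    using measurable_entropy_density[of "exp 1" ?RV P] measurable_entropy_density[of "exp 1" ?RW P]
      measurable_cong_sets[OF sV refl] measurable_cong_sets[OF sW refl]
      measurable_cong_sets[OF sets refl] by blast+
  have rhs: "integrable P (\<lambda>\<omega>. entropy_density (exp 1) ?RW P \<omega> + (V \<omega> - W \<omega>) + (ln y - ln z))"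
    using intg int by auto
  have intV: "integrable P (entropy_density (exp 1) ?RV P)"
    using integrable_cong_AE[THEN iffD2, OF _ _ logs rhs] intg int by auto
  have "KL_divergence (exp 1) ?RV P =
      (\<integral>\<omega>. entropy_density (exp 1) ?RW P \<omega> + (V \<omega> - W \<omega>) + (ln y - ln z) \<partial>P)"
    unfolding KL_divergence_def by (rule integral_cong_AE) (use logs intg int in auto)
  also have "\<dots> = KL_divergence (exp 1) ?RW P + ((\<integral>\<omega>. V \<omega> \<partial>P) - (\<integral>\<omega>. W \<omega> \<partial>P)) + (ln y - ln z)"
    using intg int by (simp add: KL_divergence_def P.prob_space)
  finally show ?thesis
    using ac acV intg intV y(1,2) z(1,2)
    by (simp add: rel_entropy_via_def rel_entropy_prob_def)
qed

lemma rel_entropy_eq: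
  assumes "prob_space P" "sets P = sets R" "entropy_weight P R W"
  shows "rel_entropy P R = rel_entropy_via P R W"
  unfolding rel_entropy_def
  using assms someI[of "entropy_weight P R" W] by (intro order.antisym[of "_ :: ereal"] rel_entropy_via_le) auto

section \<open>The minimization problem\<close>

definition admissible ::
  "real set \<Rightarrow> (real \<Rightarrow> 'a measure) \<Rightarrow> ('a \<times> 'a) measure \<Rightarrow>
   (real \<Rightarrow> 'a::polish_space) measure \<Rightarrow> bool" where
  "admissible T \<mu> \<pi> P \<longleftrightarrow>
     P \<in> path_probs \<and> (\<forall>t\<in>T. marg1 P t = \<mu> t) \<and> marg2 P 0 1 = \<pi>"

definition is_solution ::
  "(real \<Rightarrow> 'a::polish_space) measure \<Rightarrow> real set \<Rightarrow> (real \<Rightarrow> 'a measure) \<Rightarrow> ('a \<times> 'a) measure \<Rightarrow>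
   (real \<Rightarrow> 'a) measure \<Rightarrow> bool" where
  "is_solution R T \<mu> \<pi> P \<longleftrightarrow>
     admissible T \<mu> \<pi> P \<and> rel_entropy_defined P R \<and> rel_entropy P R < \<infinity> \<and>
     (\<forall>P'. admissible T \<mu> \<pi> P' \<and> rel_entropy_defined P' R \<longrightarrow> rel_entropy P R \<le> rel_entropy P' R)"

text \<open>The exponential with \<open>exp (-\<infinity>) = 0\<close>.\<close>

definition exp_ereal :: "ereal \<Rightarrow> ennreal" where
  "exp_ereal x = (if x = -\<infinity> then 0 else if x = \<infinity> then \<infinity> else ennreal (exp (real_of_ereal x)))"

end

theory Submission
  imports Defs
begin

text \<open>
  A measure \<open>P\<close> of finite entropy has a density \<open>p\<close> with respect to \<open>R\<close>, and \<open>H(P|R)\<close> is the integral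
  of \<open>p ln p\<close>, even if \<open>R\<close> is unbounded (\<open>rel_entropy_density\<close>). Both claims compare the minimizer with
  competitors whose densities differ from \<open>p\<close> only on a set of finite \<open>R\<close>-measure, where every
  integral is under control (\<open>entropy_minimizer_le\<close>, \<open>entropy_minimizer_eq\<close>).

  Reciprocity. Fix \<open>s < u\<close> in \<open>(0,1)\<close>. Let \<open>f\<close>, \<open>g\<close>, \<open>h\<close> be the conditional expectations of \<open>p\<close> under \<open>R\<close>
  given the path outside \<open>(s,u)\<close>, the path on \<open>[s,u]\<close>, and \<open>(X\<^sub>s, X\<^sub>u)\<close>. As \<open>R\<close> is reciprocal, \<open>f g / h\<close>
  is the density of the measure that coincides with \<open>P\<close> outside and inside but makes the two parts
  conditionally independent given \<open>(X\<^sub>s, X\<^sub>u)\<close>. Every constraint concerns only one of the two parts, so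
  this measure is admissible. Its logarithmic density \<open>ln f + ln g - ln h\<close> has the same mean under both
  measures, hence its entropy is at most that of \<open>P\<close>, and by strict convexity the two measures
  coincide: \<open>p = f g / h\<close>. This is the conditional independence required of \<open>P\<close>
  (\<open>entropy_minimizer_glue_eq\<close>, \<open>cond_indep_density_glue\<close>).

  Form of the density. Let \<open>Z = (Z\<^sub>0, \<dots>, Z\<^sub>m)\<close> consist of the pair \<open>(X\<^sub>0, X\<^sub>1)\<close> and of the positions at
  the constraint times in \<open>(0,1)\<close>. Conditioning on \<open>Z\<close> keeps the constraints, so the same convexity
  argument shows that \<open>p\<close> is a function of \<open>Z\<close> (\<open>entropy_minimizer_factor\<close>). Reciprocity and
  irreducibility of \<open>R\<close> imply that the law of \<open>Z\<close> under \<open>R\<close> has the null sets of a product measure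
  (\<open>reciprocal_irreducible_AE_PiM\<close>), so coordinates of independent points can be exchanged freely.
  With \<open>n = m + 1\<close>, shifting mass between \<open>z\<close> and \<open>n - 1\<close> copies of \<open>x\<close> on one side and the points
  \<open>x(j := z j)\<close> on the other leaves all coordinate marginals unchanged, and minimality turns this into
  \<open>p z * p x ^ (n - 1) = \<Prod>j. p (x(j := z j))\<close> for almost all \<open>x\<close>, \<open>z\<close>, including those where \<open>p\<close> vanishes
  (\<open>swap_inequality\<close>, \<open>minimizer_product_form\<close>). For a fixed \<open>x\<close> with \<open>p x > 0\<close> the right-hand side is a
  product of functions of one coordinate each; their logarithms, with \<open>ln 0 = -\<infinity>\<close>, are \<open>\<eta>\<close> and the
  \<open>f\<^sub>i\<close>, and the constant \<open>p x ^ (n - 1)\<close> is absorbed by \<open>\<eta>\<close>.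
\<close>

section \<open>Entropy as an integral against an unbounded reference measure\<close>

text \<open>This is \<open>ln t \<le> t - 1\<close> at \<open>t = b / a\<close>, the tangent inequality that expresses convexity of
\<open>a ln a\<close>. The last hypothesis excludes the case in which the default value \<open>ln 0 = 0\<close> would
stand for \<open>-\<infinity>\<close>.\<close>

lemma gibbs_le:
  fixes a b :: real
  assumes "0 \<le> a" "0 \<le> b" "b = 0 \<Longrightarrow> a = 0"
  shows "a * ln b \<le> a * ln a + b - a"
proof (cases "a = 0")
  case False
  then have ab: "0 < a" "0 < b"
    using assms(1-3) by (metis less_eq_real_def)+
  have "ln (b / a) \<le> b / a - 1"
    using ab by (intro ln_le_minus_one) auto
  then have "a * ln (b / a) \<le> a * (b / a - 1)"
    using ab by (intro mult_left_mono) auto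
  then show ?thesis
    using ab by (simp add: ln_div algebra_simps)
qed (use assms in auto)

lemma gibbs_eq_iff:
  fixes a b :: real
  assumes "0 \<le> a" "0 \<le> b" "b = 0 \<Longrightarrow> a = 0" "a * ln b = a * ln a + b - a"
  shows "a = b"
proof (cases "a = 0")
  case False
  then have ab: "0 < a" "0 < b"
    using assms(1-3) by (metis less_eq_real_def)+
  then have "a * ln (b / a) = a * (b / a - 1)"
    using assms(4) by (simp add: ln_div algebra_simps)
  then have "ln (b / a) = b / a - 1"
    using ab by simp
  then have "b / a = 1"
    using ab by (intro ln_eq_minus_one) auto
  then show ?thesis
    using ab by simp
qed (use assms in auto)

lemma rel_entropy_finite_imp_ac:
  assumes P: "prob_space P" "sets P = sets R"
    and W: "entropy_weight P R W" and fin: "rel_entropy P R < \<infinity>"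
  shows "absolutely_continuous R P"
proof -
  obtain z where z: "weighted R W = density R (\<lambda>\<omega>. ennreal (exp (- W \<omega>) / z))"
    by (rule weighted_facts[OF W])
  have W': "W \<in> borel_measurable R"
    using W by (simp add: entropy_weight_def)
  have "absolutely_continuous (weighted R W) P"
    using fin unfolding rel_entropy_eq[OF P W] rel_entropy_via_def rel_entropy_prob_def
    by (auto split: if_splits)
  moreover have "absolutely_continuous R (weighted R W)"
    unfolding z by (rule absolutely_continuousI_density) (use W' in measurable)
  ultimately show ?thesis
    by (auto simp: absolutely_continuous_def)
qed

lemma prob_space_density_real:
  fixes p :: "'b \<Rightarrow> real"
  assumes p[measurable]: "p \<in> borel_measurable M" and p0: "\<And>x. 0 \<le> p x" and P: "prob_space (density M p)"
  shows "integrable M p" "(\<integral>x. p x \<partial>M) = 1" "(\<integral>\<^sup>+x. ennreal (p x) \<partial>M) < \<infinity>"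
proof -
  interpret P: prob_space "density M p" by fact
  have "integrable (density M p) (\<lambda>_. 1::real)"
    by simp
  then show int: "integrable M p"
    by (subst (asm) integrable_density) (auto simp: p0)
  show "(\<integral>x. p x \<partial>M) = 1"
    using P.prob_space integral_density[of "\<lambda>_. 1::real" M p] by (simp add: p0)
  show "(\<integral>\<^sup>+x. ennreal (p x) \<partial>M) < \<infinity>"
    using int p0 by (simp add: integrable_iff_bounded)
qed

text \<open>The weight cancels: \<open>log (dP/dR\<^sub>W) = ln p + W + ln z\<close> holds \<open>P\<close>-a.e., and \<open>W\<close> is \<open>P\<close>-integrable.
So for a reference measure of any mass the entropy is the integral of \<open>p ln p\<close>, provided that some
weight exists.\<close>

lemma rel_entropy_density:
  fixes p :: "'b \<Rightarrow> real"
  assumes p[measurable]: "p \<in> borel_measurable R" and p0: "\<And>\<omega>. 0 \<le> p \<omega>"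
    and P: "prob_space (density R p)" and W: "entropy_weight (density R p) R W"
  shows "rel_entropy (density R p) R =
    (if integrable R (\<lambda>\<omega>. p \<omega> * ln (p \<omega>)) then ereal (\<integral>\<omega>. p \<omega> * ln (p \<omega>) \<partial>R) else \<infinity>)"
proof -
  let ?P = "density R p" and ?Q = "weighted R W"
  obtain z where z: "z > 0" "z_weight R W = ennreal z"
    "?Q = density R (\<lambda>\<omega>. ennreal (exp (- W \<omega>) / z))" "prob_space ?Q"
    by (rule weighted_facts[OF W])
  interpret P: prob_space ?P by fact
  interpret Q: prob_space ?Q by fact
  have W'[measurable]: "W \<in> borel_measurable R" and WP: "integrable ?P W"
    using W by (simp_all add: entropy_weight_def)
  have WR: "integrable R (\<lambda>\<omega>. p \<omega> * W \<omega>)"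
    using WP by (subst (asm) integrable_density) (auto simp: p0)
  note pR = prob_space_density_real(1)[OF p p0 P] and intp = prob_space_density_real(2)[OF p p0 P]
  define h where "h = (\<lambda>\<omega>. p \<omega> * (exp (W \<omega>) * z))"
  have h[measurable]: "h \<in> borel_measurable R" and h0: "\<And>\<omega>. 0 \<le> h \<omega>"
    using p0 z(1) by (auto simp: h_def)
  have sQ: "sets ?Q = sets R"
    by (simp add: z)
  have PQ: "?P = density ?Q h"
  proof -
    have "ennreal (exp (- W \<omega>) / z) * ennreal (h \<omega>) = ennreal (p \<omega>)" for \<omega>
    proof -
      have "exp (- W \<omega>) / z * h \<omega> = p \<omega>"
        using z(1) by (simp add: h_def exp_minus field_simps)
      then show ?thesis
        using z(1) h0 by (simp flip: ennreal_mult)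
    qed
    then show ?thesis
      by (simp add: z(3) density_density_eq)
  qed
  have hQ: "h \<in> borel_measurable ?Q"
    using h measurable_cong_sets[OF sQ refl] by blast
  have ac: "absolutely_continuous ?Q ?P"
    unfolding PQ by (rule absolutely_continuousI_density) (use hQ in measurable)
  have KL: "KL_divergence (exp 1) ?Q ?P = (\<integral>\<omega>. h \<omega> * ln (h \<omega>) \<partial>?Q)"
    unfolding PQ using Q.KL_density[of "exp 1" h] hQ h0 by (simp add: log_def)
  have eq: "integrable ?P (entropy_density (exp 1) ?Q ?P) \<longleftrightarrow> integrable R (\<lambda>\<omega>. p \<omega> * ln (p \<omega>))"
    (is "?A \<longleftrightarrow> ?B")
   and val: "(\<integral>\<omega>. entropy_density (exp 1) ?Q ?P \<omega> \<partial>?P) = (\<integral>\<omega>. p \<omega> * ln (p \<omega>) + (p \<omega> * W \<omega> + ln z * p \<omega>) \<partial>R)"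
  proof -
    have "AE \<omega> in ?Q. ennreal (h \<omega>) = RN_deriv ?Q ?P \<omega>"
      by (rule Q.RN_deriv_unique[OF _ PQ[symmetric]]) (use hQ in measurable)
    then have "AE \<omega> in R. ennreal (h \<omega>) = RN_deriv ?Q ?P \<omega>"
      unfolding z(3) using z(1) by (subst (asm) AE_density) auto
    then have "AE \<omega> in ?P. ennreal (h \<omega>) = RN_deriv ?Q ?P \<omega> \<and> p \<omega> > 0"
      by (subst AE_density) auto
    then have 1: "AE \<omega> in ?P. entropy_density (exp 1) ?Q ?P \<omega> = ln (p \<omega>) + (W \<omega> + ln z)"
    proof eventually_elim
      case (elim \<omega>)
      then have "enn2real (RN_deriv ?Q ?P \<omega>) = h \<omega>"
        using h0[of \<omega>] by (metis enn2real_ennreal)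
      then show ?case
        using elim z(1) by (simp add: entropy_density_def log_def h_def ln_mult)
    qed
    have m: "entropy_density (exp 1) ?Q ?P \<in> borel_measurable R"
      using measurable_entropy_density[of "exp 1" ?Q ?P] measurable_cong_sets[OF sQ refl] by blast
    have "?A \<longleftrightarrow> integrable ?P (\<lambda>\<omega>. ln (p \<omega>) + (W \<omega> + ln z))"
      by (rule integrable_cong_AE) (use 1 m in auto)
    also have "\<dots> \<longleftrightarrow> integrable R (\<lambda>\<omega>. p \<omega> * ln (p \<omega>) + (p \<omega> * W \<omega> + ln z * p \<omega>))"
      by (subst integrable_density) (auto simp: p0 algebra_simps)
    also have "\<dots> \<longleftrightarrow> ?B"
    proof
      assume "integrable R (\<lambda>\<omega>. p \<omega> * ln (p \<omega>) + (p \<omega> * W \<omega> + ln z * p \<omega>))"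
      from Bochner_Integration.integrable_diff[OF this, of "\<lambda>\<omega>. p \<omega> * W \<omega> + ln z * p \<omega>"]
      show ?B
        using WR pR by simp
    qed (use WR pR in auto)
    finally show "?A \<longleftrightarrow> ?B" .
    have "(\<integral>\<omega>. entropy_density (exp 1) ?Q ?P \<omega> \<partial>?P) = (\<integral>\<omega>. ln (p \<omega>) + (W \<omega> + ln z) \<partial>?P)"
      by (rule integral_cong_AE) (use 1 m in auto)
    also have "\<dots> = (\<integral>\<omega>. p \<omega> * ln (p \<omega>) + (p \<omega> * W \<omega> + ln z * p \<omega>) \<partial>R)"
      by (subst integral_density) (auto simp: p0 algebra_simps)
    finally show "(\<integral>\<omega>. entropy_density (exp 1) ?Q ?P \<omega> \<partial>?P) = \<dots>" .
  qed
  have "(\<integral>\<omega>. W \<omega> \<partial>?P) = (\<integral>\<omega>. p \<omega> * W \<omega> \<partial>R)"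
    by (subst integral_density) (auto simp: p0)
  moreover have "(\<integral>\<omega>. p \<omega> * ln (p \<omega>) + (p \<omega> * W \<omega> + ln z * p \<omega>) \<partial>R) =
      (\<integral>\<omega>. p \<omega> * ln (p \<omega>) \<partial>R) + ((\<integral>\<omega>. p \<omega> * W \<omega> \<partial>R) + ln z)" if ?B
    using that WR pR intp by (simp del: integral_mult_right_zero)
  ultimately show ?thesis
    using ac eq val z(1,2) rel_entropy_eq[OF P _ W]
    by (auto simp: rel_entropy_via_def rel_entropy_prob_def KL_divergence_def)
qed

text \<open>Minimality compares \<open>P\<close> only with measures for which a weight exists, and the weight of \<open>P\<close> need not
be integrable under a competitor. It is if the weight is replaced by 0 on the set \<open>C\<close> where the two
densities differ; the new weight still has finite mass because \<open>C\<close> has finite \<open>R\<close>-measure. This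
is why all competitors below change the density on a set of finite measure only.\<close>

lemma entropy_minimizer_le:
  fixes p q :: "(real \<Rightarrow> 'a::polish_space) \<Rightarrow> real"
  assumes sol: "is_solution R T \<mu> \<pi> (density R p)"
    and p[measurable]: "p \<in> borel_measurable R" and p0: "\<And>\<omega>. 0 \<le> p \<omega>"
    and q[measurable]: "q \<in> borel_measurable R" and q0: "\<And>\<omega>. 0 \<le> q \<omega>"
    and C[measurable]: "C \<in> sets R" and finC: "emeasure R C < \<infinity>"
    and pq: "\<And>\<omega>. \<omega> \<in> space R \<Longrightarrow> \<omega> \<notin> C \<Longrightarrow> q \<omega> = p \<omega>"
    and adm: "admissible T \<mu> \<pi> (density R q)"
    and qln: "integrable R (\<lambda>\<omega>. q \<omega> * ln (q \<omega>))"
  shows "(\<integral>\<omega>. p \<omega> * ln (p \<omega>) \<partial>R) \<le> (\<integral>\<omega>. q \<omega> * ln (q \<omega>) \<partial>R)"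
proof -
  obtain W where W: "entropy_weight (density R p) R W"
    using sol by (auto simp: is_solution_def rel_entropy_defined_def)
  have pr: "prob_space (density R p)" "prob_space (density R q)"
    using sol adm by (auto simp: is_solution_def admissible_def path_probs_def)
  have W'[measurable]: "W \<in> borel_measurable R" and WP: "integrable (density R p) W"
    and W0: "\<And>\<omega>. \<omega> \<in> space R \<Longrightarrow> 0 \<le> W \<omega>" and zW: "0 < z_weight R W" "z_weight R W < \<infinity>"
    using W by (auto simp: entropy_weight_def)
  (* V is a weight for both densities, since they coincide off C *)
  define V where "V = (\<lambda>\<omega>. if \<omega> \<in> C then 0 else W \<omega>)"
  have V[measurable]: "V \<in> borel_measurable R"
    unfolding V_def by measurable
  have V0: "0 \<le> V \<omega>" and VW: "V \<omega> \<le> W \<omega>" if "\<omega> \<in> space R" for \<omega>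
    using W0[OF that] by (auto simp: V_def)
  have "z_weight R W \<le> z_weight R V"
    unfolding z_weight_def by (intro nn_integral_mono) (auto simp: VW ennreal_leI)
  then have zV0: "0 < z_weight R V"
    using zW(1) by (rule less_le_trans[rotated])
  have "z_weight R V \<le> (\<integral>\<^sup>+\<omega>. ennreal (exp (- W \<omega>)) + indicator C \<omega> \<partial>R)"
    unfolding z_weight_def by (intro nn_integral_mono) (auto simp: V_def indicator_def)
  also have "\<dots> = z_weight R W + emeasure R C"
    by (subst nn_integral_add) (auto simp: z_weight_def)
  also have "\<dots> < \<infinity>"
    using zW finC by simp
  finally have zV: "z_weight R V < \<infinity>" .
  have WR: "integrable R (\<lambda>\<omega>. p \<omega> * W \<omega>)"
    using WP by (subst (asm) integrable_density) (auto simp: p0)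
  have VpR: "integrable R (\<lambda>\<omega>. p \<omega> * V \<omega>)"
    by (rule Bochner_Integration.integrable_bound[OF WR])
       (auto intro!: AE_I2 mult_left_mono simp: abs_mult p0 VW V0 W0)
  have "integrable R (\<lambda>\<omega>. q \<omega> * V \<omega>)"
    by (rule Bochner_Integration.integrable_cong[THEN iffD2, OF refl _ VpR])
       (auto simp: V_def pq)
  then have Vp: "entropy_weight (density R p) R V" and Vq: "entropy_weight (density R q) R V"
    using VpR V0 zV0 zV p0 q0
    by (auto simp: entropy_weight_def integrable_density)
  note ep = rel_entropy_density[OF p p0 pr(1) Vp] and eq = rel_entropy_density[OF q q0 pr(2) Vq]
  have le: "rel_entropy (density R p) R \<le> rel_entropy (density R q) R"
    and fin: "rel_entropy (density R p) R < \<infinity>"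
    using sol adm Vq unfolding is_solution_def rel_entropy_defined_def by blast+
  have i: "integrable R (\<lambda>\<omega>. p \<omega> * ln (p \<omega>))"
    using fin unfolding ep by (auto split: if_splits)
  show "(\<integral>\<omega>. p \<omega> * ln (p \<omega>) \<partial>R) \<le> (\<integral>\<omega>. q \<omega> * ln (q \<omega>) \<partial>R)"
    using le i qln unfolding ep eq by auto
qed

lemma entropy_minimizer_integrable:
  fixes p :: "(real \<Rightarrow> 'a::polish_space) \<Rightarrow> real"
  assumes sol: "is_solution R T \<mu> \<pi> (density R p)"
    and p: "p \<in> borel_measurable R" and p0: "\<And>\<omega>. 0 \<le> p \<omega>"
  shows "integrable R (\<lambda>\<omega>. p \<omega> * ln (p \<omega>))"
proof -
  obtain W where W: "entropy_weight (density R p) R W"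
    using sol by (auto simp: is_solution_def rel_entropy_defined_def)
  have "prob_space (density R p)"
    using sol by (auto simp: is_solution_def admissible_def path_probs_def)
  from rel_entropy_density[OF p p0 this W] show ?thesis
    using sol by (auto simp: is_solution_def split: if_splits)
qed

text \<open>Strict convexity of the entropy. By \<open>eq\<close>, minimality says that the integral over \<open>C\<close> of
\<open>p ln p - p ln q + q - p\<close> is at most 0; the integrand is nonnegative and vanishes only where
\<open>p = q\<close>. So a competitor whose logarithm has the same mean under both measures is the minimizer
itself.\<close>

lemma entropy_minimizer_eq:
  fixes p q :: "(real \<Rightarrow> 'a::polish_space) \<Rightarrow> real"
  assumes sol: "is_solution R T \<mu> \<pi> (density R p)"
    and p[measurable]: "p \<in> borel_measurable R" and p0: "\<And>\<omega>. 0 \<le> p \<omega>"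
    and q[measurable]: "q \<in> borel_measurable R" and q0: "\<And>\<omega>. 0 \<le> q \<omega>"
    and C[measurable]: "C \<in> sets R" and finC: "emeasure R C < \<infinity>"
    and pq: "\<And>\<omega>. \<omega> \<in> space R \<Longrightarrow> \<omega> \<notin> C \<Longrightarrow> q \<omega> = p \<omega>"
    and adm: "admissible T \<mu> \<pi> (density R q)"
    and ac: "AE \<omega> in R. \<omega> \<in> C \<longrightarrow> q \<omega> = 0 \<longrightarrow> p \<omega> = 0"
    and pl: "integrable R (\<lambda>\<omega>. indicator C \<omega> * (p \<omega> * ln (q \<omega>)))"
    and ql: "integrable R (\<lambda>\<omega>. indicator C \<omega> * (q \<omega> * ln (q \<omega>)))"
    and eq: "(\<integral>\<omega>. indicator C \<omega> * (p \<omega> * ln (q \<omega>)) \<partial>R) = (\<integral>\<omega>. indicator C \<omega> * (q \<omega> * ln (q \<omega>)) \<partial>R)"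
  shows "AE \<omega> in R. q \<omega> = p \<omega>"
proof -
  have pr: "prob_space (density R p)" "prob_space (density R q)"
    using sol adm by (auto simp: is_solution_def admissible_def path_probs_def)
  have pi: "integrable R p" "(\<integral>\<omega>. p \<omega> \<partial>R) = 1" and qi: "integrable R q" "(\<integral>\<omega>. q \<omega> \<partial>R) = 1"
    using prob_space_density_real[OF p p0 pr(1)] prob_space_density_real[OF q q0 pr(2)] by auto
  note pp = entropy_minimizer_integrable[OF sol p p0]
  have pC: "integrable R (\<lambda>\<omega>. indicator C \<omega> * (p \<omega> * ln (p \<omega>)))"
    using integrable_mult_indicator[OF C pp] by simp
  have pD: "integrable R (\<lambda>\<omega>. indicator (space R - C) \<omega> * (p \<omega> * ln (p \<omega>)))"
    using integrable_mult_indicator[OF _ pp, of "space R - C"] by simp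
  have split_q: "q \<omega> * ln (q \<omega>) = indicator C \<omega> * (q \<omega> * ln (q \<omega>)) + indicator (space R - C) \<omega> * (p \<omega> * ln (p \<omega>))"
    if "\<omega> \<in> space R" for \<omega>
    using that pq by (auto simp: indicator_def)
  have qq: "integrable R (\<lambda>\<omega>. q \<omega> * ln (q \<omega>))"
    by (rule Bochner_Integration.integrable_cong[THEN iffD2, OF refl split_q]) (use ql pD in auto)
  have "(\<integral>\<omega>. p \<omega> * ln (p \<omega>) \<partial>R) \<le> (\<integral>\<omega>. q \<omega> * ln (q \<omega>) \<partial>R)"
    by (rule entropy_minimizer_le[OF sol p p0 q q0 C finC pq adm qq])
  also have "\<dots> = (\<integral>\<omega>. indicator C \<omega> * (q \<omega> * ln (q \<omega>)) + indicator (space R - C) \<omega> * (p \<omega> * ln (p \<omega>)) \<partial>R)"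
    by (rule Bochner_Integration.integral_cong[OF refl split_q])
  also have "\<dots> = (\<integral>\<omega>. indicator C \<omega> * (p \<omega> * ln (q \<omega>)) + indicator (space R - C) \<omega> * (p \<omega> * ln (p \<omega>)) \<partial>R)"
    using ql pl pD eq by simp
  finally have le: "(\<integral>\<omega>. p \<omega> * ln (p \<omega>) \<partial>R) \<le> \<dots>" .
  define d where "d = (\<lambda>\<omega>. p \<omega> * ln (p \<omega>) + q \<omega> - p \<omega>
    - (indicator C \<omega> * (p \<omega> * ln (q \<omega>)) + indicator (space R - C) \<omega> * (p \<omega> * ln (p \<omega>))))"
  have d_eq: "d \<omega> = (if \<omega> \<in> C then p \<omega> * ln (p \<omega>) + q \<omega> - p \<omega> - p \<omega> * ln (q \<omega>) else 0)"
    if "\<omega> \<in> space R" for \<omega>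
    using that pq by (auto simp: d_def indicator_def)
  have d_int: "integrable R d"
    unfolding d_def using pp pi qi pl pD by auto
  have "(\<integral>\<omega>. d \<omega> \<partial>R) \<le> 0"
    unfolding d_def using pp pi qi pl pD le by simp
  moreover have d0: "AE \<omega> in R. 0 \<le> d \<omega>"
    using ac AE_space
  proof eventually_elim
    case (elim \<omega>)
    then show ?case
      using gibbs_le[of "p \<omega>" "q \<omega>"] p0[of \<omega>] q0[of \<omega>] by (auto simp: d_eq)
  qed
  ultimately have "(\<integral>\<omega>. d \<omega> \<partial>R) = 0"
    using integral_nonneg_AE[OF d0] by simp
  then have "AE \<omega> in R. d \<omega> = 0"
    using integral_nonneg_eq_0_iff_AE[OF d_int d0] by simp
  then show ?thesis
    using ac AE_space
  proof eventually_elim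
    case (elim \<omega>)
    then show ?case
      using gibbs_eq_iff[of "p \<omega>" "q \<omega>"] p0[of \<omega>] q0[of \<omega>] pq[of \<omega>] by (auto simp: d_eq split: if_splits)
  qed
qed

section \<open>Conditional independence and gluing\<close>

text \<open>Two densities with equal integrals over the sets of \<open>G\<close> define the same measure on \<open>G\<close>.\<close>

lemma nn_integral_eq_on_subalgebra:
  assumes sub: "subalgebra M G" and [measurable]: "f \<in> borel_measurable M" "g \<in> borel_measurable M"
    and eq: "\<And>B. B \<in> sets G \<Longrightarrow> (\<integral>\<^sup>+x. f x * indicator B x \<partial>M) = (\<integral>\<^sup>+x. g x * indicator B x \<partial>M)"
    and \<psi>: "\<psi> \<in> borel_measurable G"
  shows "(\<integral>\<^sup>+x. f x * \<psi> x \<partial>M) = (\<integral>\<^sup>+x. g x * \<psi> x \<partial>M)"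
proof -
  have subf: "subalgebra (density M f) G" and subg: "subalgebra (density M g) G"
    using sub by (auto simp: subalgebra_def)
  have [measurable]: "\<psi> \<in> borel_measurable M"
    using measurable_from_subalg[OF sub \<psi>] .
  have "restr_to_subalg (density M f) G = restr_to_subalg (density M g) G"
  proof (rule measure_eqI)
    fix B assume "B \<in> sets (restr_to_subalg (density M f) G)"
    then have B: "B \<in> sets G"
      by (simp add: sets_restr_to_subalg[OF subf])
    then have "B \<in> sets M"
      using sub by (auto simp: subalgebra_def)
    then show "emeasure (restr_to_subalg (density M f) G) B = emeasure (restr_to_subalg (density M g) G) B"
      using eq[OF B] B by (simp add: emeasure_restr_to_subalg[OF subf] emeasure_restr_to_subalg[OF subg] emeasure_density)
  qed (simp add: sets_restr_to_subalg[OF subf] sets_restr_to_subalg[OF subg])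
  then have "(\<integral>\<^sup>+x. \<psi> x \<partial>density M f) = (\<integral>\<^sup>+x. \<psi> x \<partial>density M g)"
    using nn_integral_subalgebra2[OF subf \<psi>] nn_integral_subalgebra2[OF subg \<psi>] by simp
  then show ?thesis
    by (simp add: nn_integral_density)
qed

lemma integral_eq_on_subalgebra:
  fixes p q :: "'b \<Rightarrow> real"
  assumes sub: "subalgebra M G" and [measurable]: "p \<in> borel_measurable M" "q \<in> borel_measurable M"
    and p0: "\<And>x. 0 \<le> p x" and q0: "\<And>x. 0 \<le> q x"
    and eq: "\<And>B. B \<in> sets G \<Longrightarrow> (\<integral>\<^sup>+x. ennreal (p x) * indicator B x \<partial>M) = (\<integral>\<^sup>+x. ennreal (q x) * indicator B x \<partial>M)"
    and L: "L \<in> borel_measurable G" and int: "integrable M (\<lambda>x. p x * L x)"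
  shows "integrable M (\<lambda>x. q x * L x)" "(\<integral>x. q x * L x \<partial>M) = (\<integral>x. p x * (L x :: real) \<partial>M)"
proof -
  have [measurable]: "L \<in> borel_measurable M"
    using measurable_from_subalg[OF sub L] .
  have *: "(\<integral>\<^sup>+x. ennreal (q x * l x) \<partial>M) = (\<integral>\<^sup>+x. ennreal (p x * l x) \<partial>M)"
    if l: "l \<in> borel_measurable G" for l :: "'b \<Rightarrow> real"
  proof -
    have "(\<integral>\<^sup>+x. ennreal (p x) * ennreal (l x) \<partial>M) = (\<integral>\<^sup>+x. ennreal (q x) * ennreal (l x) \<partial>M)"
      using l by (intro nn_integral_eq_on_subalgebra[OF sub _ _ eq]) auto
    then show ?thesis
      by (simp add: ennreal_mult' p0 q0)
  qed
  have "(\<integral>\<^sup>+x. ennreal (q x * \<bar>L x\<bar>) \<partial>M) = (\<integral>\<^sup>+x. ennreal (p x * \<bar>L x\<bar>) \<partial>M)"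
    using L by (intro *) auto
  also have "\<dots> < \<infinity>"
    using int by (auto simp: integrable_iff_bounded abs_mult p0)
  finally show iq: "integrable M (\<lambda>x. q x * L x)"
    by (auto simp: integrable_iff_bounded abs_mult q0)
  have "(\<integral>\<^sup>+x. ennreal (- (q x * L x)) \<partial>M) = (\<integral>\<^sup>+x. ennreal (- (p x * L x)) \<partial>M)"
    using *[of "\<lambda>x. - L x"] L by simp
  then show "(\<integral>x. q x * L x \<partial>M) = (\<integral>x. p x * L x \<partial>M)"
    using *[OF L] iq int by (simp add: real_lebesgue_integral_def)
qed

lemma sigma_finite_subalgebraI_distr:
  assumes sub: "subalgebra M F" and Z: "Z \<in> measurable F N" and s: "sigma_finite_measure (distr M N Z)"
  shows "sigma_finite_subalgebra M F"
proof -
  note ZM = measurable_from_subalg[OF sub Z] and ZF = measurable_in_subalg[OF sub Z]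
  have "distr (restr_to_subalg M F) N Z = distr M N Z"
  proof (rule measure_eqI)
    fix A assume "A \<in> sets (distr (restr_to_subalg M F) N Z)"
    then have A: "A \<in> sets N"
      by simp
    have "Z -` A \<inter> space M \<in> sets F"
      using measurable_sets[OF Z A] sub by (simp add: subalgebra_def)
    then show "emeasure (distr (restr_to_subalg M F) N Z) A = emeasure (distr M N Z) A"
      using A ZM ZF by (simp add: emeasure_distr space_restr_to_subalg emeasure_restr_to_subalg[OF sub])
  qed simp
  then have "sigma_finite_measure (restr_to_subalg M F)"
    using s ZF by (intro sigma_finite_measure_distr[of _ N Z]) auto
  then show ?thesis
    using sub by (simp add: sigma_finite_subalgebra_def)
qed

definition cond_indep :: "'b measure \<Rightarrow> 'b measure \<Rightarrow> 'b measure \<Rightarrow> 'b measure \<Rightarrow> bool" where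
  "cond_indep M F G H \<longleftrightarrow> (\<forall>A\<in>sets F. \<forall>B\<in>sets G. AE x in M.
     nn_cond_exp M H (indicator (A \<inter> B)) x =
     nn_cond_exp M H (indicator A) x * nn_cond_exp M H (indicator B) x)"

lemma cond_indep_commute:
  assumes "cond_indep M F G H"
  shows "cond_indep M G F H"
  unfolding cond_indep_def
proof (intro ballI)
  fix A B assume "A \<in> sets G" "B \<in> sets F"
  with assms show "AE x in M. nn_cond_exp M H (indicator (A \<inter> B)) x =
      nn_cond_exp M H (indicator A) x * nn_cond_exp M H (indicator B) x"
    unfolding cond_indep_def Int_commute[of A B] mult.commute[of "nn_cond_exp M H (indicator A) _"] by blast
qed

text \<open>The product formula for indicators is extended to functions one factor at a time. Moving the
conditional expectation from one factor to the other keeps each step an identity between two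
measures on a single sub-\<open>\<sigma>\<close>-field.\<close>

lemma cond_indep_nn_integral:
  assumes H: "sigma_finite_subalgebra M H"
    and F: "subalgebra M F" and G: "subalgebra M G" and FH: "subalgebra F H" and GH: "subalgebra G H"
    and ci: "cond_indep M F G H"
    and \<phi>[measurable]: "\<phi> \<in> borel_measurable F" and \<psi>[measurable]: "\<psi> \<in> borel_measurable G"
  shows "(\<integral>\<^sup>+x. \<phi> x * \<psi> x \<partial>M) = (\<integral>\<^sup>+x. \<phi> x * nn_cond_exp M H \<psi> x \<partial>M)"
proof -
  interpret H: sigma_finite_subalgebra M H by fact
  let ?E = "nn_cond_exp M H"
  have \<phi>M[measurable]: "\<phi> \<in> borel_measurable M"
    using measurable_from_subalg[OF F \<phi>] .
  have \<psi>M[measurable]: "\<psi> \<in> borel_measurable M"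
    using measurable_from_subalg[OF G \<psi>] .
  have 1: "(\<integral>\<^sup>+x. \<phi> x * indicator B x \<partial>M) = (\<integral>\<^sup>+x. ?E \<phi> x * indicator B x \<partial>M)"
    if B: "B \<in> sets G" for B
  proof -
    have BM[measurable]: "B \<in> sets M"
      using B G by (auto simp: subalgebra_def)
    have "(\<integral>\<^sup>+x. indicator B x * \<phi> x \<partial>M) = (\<integral>\<^sup>+x. ?E (indicator B) x * \<phi> x \<partial>M)"
    proof (rule nn_integral_eq_on_subalgebra[OF F _ _ _ \<phi>])
      fix A assume A: "A \<in> sets F"
      then have [measurable]: "A \<in> sets M"
        using F by (auto simp: subalgebra_def)
      have "(\<integral>\<^sup>+x. indicator B x * indicator A x \<partial>M) = (\<integral>\<^sup>+x. 1 * indicator (A \<inter> B) x \<partial>M)"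
        by (auto intro!: nn_integral_cong simp: indicator_def)
      also have "\<dots> = (\<integral>\<^sup>+x. 1 * ?E (indicator (A \<inter> B)) x \<partial>M)"
        by (rule H.nn_cond_exp_intg[symmetric]) auto
      also have "\<dots> = (\<integral>\<^sup>+x. ?E (indicator B) x * ?E (indicator A) x \<partial>M)"
        using ci A B unfolding cond_indep_def
        by (intro nn_integral_cong_AE) (auto simp: mult.commute)
      also have "\<dots> = (\<integral>\<^sup>+x. ?E (indicator B) x * indicator A x \<partial>M)"
        by (rule H.nn_cond_exp_intg) auto
      finally show "(\<integral>\<^sup>+x. indicator B x * indicator A x \<partial>M) = (\<integral>\<^sup>+x. ?E (indicator B) x * indicator A x \<partial>M)" .
    qed auto
    also have "\<dots> = (\<integral>\<^sup>+x. ?E (indicator B) x * ?E \<phi> x \<partial>M)"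
      by (rule H.nn_cond_exp_intg[symmetric]) auto
    also have "\<dots> = (\<integral>\<^sup>+x. ?E \<phi> x * ?E (indicator B) x \<partial>M)"
      by (simp add: mult.commute)
    also have "\<dots> = (\<integral>\<^sup>+x. ?E \<phi> x * indicator B x \<partial>M)"
      by (rule H.nn_cond_exp_intg) auto
    finally show ?thesis
      by (simp add: mult.commute)
  qed
  have "(\<integral>\<^sup>+x. \<phi> x * \<psi> x \<partial>M) = (\<integral>\<^sup>+x. ?E \<phi> x * \<psi> x \<partial>M)"
    by (rule nn_integral_eq_on_subalgebra[OF G _ _ 1 \<psi>]) auto
  also have "\<dots> = (\<integral>\<^sup>+x. ?E \<phi> x * ?E \<psi> x \<partial>M)"
    by (rule H.nn_cond_exp_intg[symmetric]) auto
  also have "\<dots> = (\<integral>\<^sup>+x. ?E \<psi> x * ?E \<phi> x \<partial>M)"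
    by (simp add: mult.commute)
  also have "\<dots> = (\<integral>\<^sup>+x. ?E \<psi> x * \<phi> x \<partial>M)"
    by (rule H.nn_cond_exp_intg) auto
  finally show ?thesis
    by (simp add: mult.commute)
qed

text \<open>The set where the conditional expectation vanishes belongs to \<open>F\<close>, so \<open>p\<close> integrates to 0 over
it.\<close>

lemma nn_cond_exp_eq_0_AE:
  assumes F: "sigma_finite_subalgebra M F" and p[measurable]: "p \<in> borel_measurable M"
  shows "AE x in M. nn_cond_exp M F p x = 0 \<longrightarrow> p x = 0"
proof -
  interpret F: sigma_finite_subalgebra M F by fact
  let ?Z = "{x \<in> space F. nn_cond_exp M F p x = 0}"
  have ZF[measurable]: "?Z \<in> sets F"
    by measurable
  then have [measurable]: "?Z \<in> sets M"
    by (rule subsetD[OF F.subalg[unfolded subalgebra_def, THEN conjunct2]])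
  have "(\<integral>\<^sup>+x. indicator ?Z x * p x \<partial>M) = (\<integral>\<^sup>+x. indicator ?Z x * nn_cond_exp M F p x \<partial>M)"
    by (rule F.nn_cond_exp_intg[symmetric]) auto
  also have "\<dots> = (\<integral>\<^sup>+x. 0 \<partial>M)"
    by (intro nn_integral_cong) (auto simp: indicator_def)
  also have "\<dots> = 0"
    by simp
  finally have "AE x in M. indicator ?Z x * p x = 0"
    by (subst (asm) nn_integral_0_iff_AE) auto
  then show ?thesis
    using AE_space
  proof eventually_elim
    case (elim x)
    then show ?case
      using F.subalg by (auto simp: subalgebra_def indicator_def split: if_splits)
  qed
qed

lemma nn_cond_exp_finite_AE:
  assumes F: "sigma_finite_subalgebra M F" and p[measurable]: "p \<in> borel_measurable M"
    and fin: "(\<integral>\<^sup>+x. p x \<partial>M) < \<infinity>"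
  shows "AE x in M. nn_cond_exp M F p x < \<infinity>"
proof -
  interpret F: sigma_finite_subalgebra M F by fact
  have "(\<integral>\<^sup>+x. nn_cond_exp M F p x \<partial>M) = (\<integral>\<^sup>+x. p x \<partial>M)"
    using F.nn_cond_exp_intg[of "\<lambda>_. 1" p] by simp
  then have "AE x in M. nn_cond_exp M F p x \<noteq> \<infinity>"
    using fin by (intro nn_integral_PInf_AE) auto
  then show ?thesis
    by (simp add: less_top)
qed

lemma nn_cond_exp_tower:
  assumes F: "sigma_finite_subalgebra M F" and H: "sigma_finite_subalgebra M H" and FH: "subalgebra F H"
    and p[measurable]: "p \<in> borel_measurable M"
  shows "AE x in M. nn_cond_exp M H (nn_cond_exp M F p) x = nn_cond_exp M H p x"
proof -
  interpret F: sigma_finite_subalgebra M F by fact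
  interpret H: sigma_finite_subalgebra M H by fact
  have "AE x in M. nn_cond_exp M H p x = nn_cond_exp M H (nn_cond_exp M F p) x"
  proof (rule H.nn_cond_exp_charact)
    fix A assume A[measurable]: "A \<in> sets H"
    then have [measurable]: "A \<in> sets F"
      using FH by (auto simp: subalgebra_def)
    have "(\<integral>\<^sup>+x. indicator A x * nn_cond_exp M F p x \<partial>M) = (\<integral>\<^sup>+x. indicator A x * p x \<partial>M)"
      by (rule F.nn_cond_exp_intg) auto
    also have "\<dots> = (\<integral>\<^sup>+x. indicator A x * nn_cond_exp M H p x \<partial>M)"
      by (rule H.nn_cond_exp_intg[symmetric]) auto
    finally show "(\<integral>\<^sup>+x\<in>A. nn_cond_exp M F p x \<partial>M) = (\<integral>\<^sup>+x\<in>A. nn_cond_exp M H p x \<partial>M)"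
      by (simp add: mult.commute)
  qed auto
  then show ?thesis
    by auto
qed

text \<open>With respect to \<open>M\<close>, this is the density of the measure that agrees with \<open>p M\<close> on \<open>F\<close> and on \<open>G\<close>
and makes them conditionally independent given \<open>H\<close>, provided that they are so under \<open>M\<close>: the
density on \<open>H\<close> is counted in both factors of the numerator and is divided out once.\<close>

definition glue :: "'b measure \<Rightarrow> 'b measure \<Rightarrow> 'b measure \<Rightarrow> 'b measure \<Rightarrow> ('b \<Rightarrow> ennreal) \<Rightarrow> 'b \<Rightarrow> ennreal" where
  "glue M F G H p x = nn_cond_exp M F p x * nn_cond_exp M G p x / nn_cond_exp M H p x"

lemma glue_commute: "glue M F G H p = glue M G F H p"
  by (simp add: glue_def fun_eq_iff mult.commute)

context
  fixes M F G H :: "'b measure" and p :: "'b \<Rightarrow> ennreal"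
  assumes sF: "sigma_finite_subalgebra M F" and sG: "sigma_finite_subalgebra M G"
    and sH: "sigma_finite_subalgebra M H" and FH: "subalgebra F H" and GH: "subalgebra G H"
    and ci: "cond_indep M F G H"
    and p[measurable]: "p \<in> borel_measurable M" and fin: "(\<integral>\<^sup>+x. p x \<partial>M) < \<infinity>"
begin

interpretation F: sigma_finite_subalgebra M F by (fact sF)
interpretation G: sigma_finite_subalgebra M G by (fact sG)
interpretation H: sigma_finite_subalgebra M H by (fact sH)

lemma borel_measurable_glue [measurable]: "glue M F G H p \<in> borel_measurable M"
  unfolding glue_def by measurable

text \<open>Where the denominator vanishes, so does the numerator.\<close>

lemma cond_exp_divide_times_AE:
  "AE x in M. nn_cond_exp M F p x / nn_cond_exp M H p x * nn_cond_exp M H p x = nn_cond_exp M F p x"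
  using nn_cond_exp_eq_0_AE[OF sH borel_measurable_nn_cond_exp2[of M F p]] nn_cond_exp_tower[OF sF sH FH p]
    nn_cond_exp_finite_AE[OF sH p fin]
proof eventually_elim
  case (elim x)
  show ?case
  proof (cases "nn_cond_exp M H p x = 0")
    case False
    then show ?thesis
      using elim(3) by (simp add: ennreal_divide_times ennreal_divide_self)
  qed (use elim in simp)
qed

text \<open>Given \<open>H\<close>, the factor \<open>E[p | G]\<close> may be replaced by its conditional expectation \<open>E[p | H]\<close>, which
cancels the denominator. By symmetry the same holds for functions that are measurable with
respect to \<open>G\<close>.\<close>

lemma nn_integral_glue:
  assumes \<phi>[measurable]: "\<phi> \<in> borel_measurable F"
  shows "(\<integral>\<^sup>+x. \<phi> x * glue M F G H p x \<partial>M) = (\<integral>\<^sup>+x. \<phi> x * p x \<partial>M)"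
proof -
  have [measurable]: "nn_cond_exp M H p \<in> borel_measurable F"
    by (rule measurable_from_subalg[OF FH]) simp
  have "(\<integral>\<^sup>+x. \<phi> x * glue M F G H p x \<partial>M) =
      (\<integral>\<^sup>+x. (\<phi> x * (nn_cond_exp M F p x / nn_cond_exp M H p x)) * nn_cond_exp M G p x \<partial>M)"
    by (auto intro!: nn_integral_cong simp: glue_def divide_ennreal_def ac_simps)
  also have "\<dots> = (\<integral>\<^sup>+x. (\<phi> x * (nn_cond_exp M F p x / nn_cond_exp M H p x)) * nn_cond_exp M H (nn_cond_exp M G p) x \<partial>M)"
    by (rule cond_indep_nn_integral[OF sH F.subalg G.subalg FH GH ci]) measurable
  also have "\<dots> = (\<integral>\<^sup>+x. \<phi> x * nn_cond_exp M F p x \<partial>M)"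
    by (rule nn_integral_cong_AE)
       (use nn_cond_exp_tower[OF sG sH GH p] cond_exp_divide_times_AE in eventually_elim, simp add: mult.assoc)
  also have "\<dots> = (\<integral>\<^sup>+x. \<phi> x * p x \<partial>M)"
    by (rule F.nn_cond_exp_intg) auto
  finally show ?thesis .
qed

end

text \<open>Bayes' formula for conditional probabilities under \<open>p M\<close>.\<close>

lemma nn_cond_exp_density:
  assumes sF: "sigma_finite_subalgebra M F" and sH: "sigma_finite_subalgebra M H" and FH: "subalgebra F H"
    and p[measurable]: "p \<in> borel_measurable M" and fin: "(\<integral>\<^sup>+x. p x \<partial>M) < \<infinity>"
    and A: "A \<in> sets F"
  shows "AE x in M. nn_cond_exp (density M p) H (indicator A) x * nn_cond_exp M H p x =
    nn_cond_exp M H (\<lambda>x. indicator A x * nn_cond_exp M F p x) x"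
proof -
  interpret F: sigma_finite_subalgebra M F by fact
  interpret H: sigma_finite_subalgebra M H by fact
  let ?P = "density M p"
  have "finite_measure ?P"
    using fin by (intro finite_measureI) (simp add: emeasure_density cong: nn_integral_cong)
  then interpret P: finite_measure_subalgebra ?P H
    using H.subalg by (intro finite_measure_subalgebra.intro) (auto simp: finite_measure_subalgebra_axioms_def subalgebra_def)
  let ?a = "nn_cond_exp ?P H (indicator A)"
  have AF[measurable]: "A \<in> sets F" by fact
  have AM[measurable]: "A \<in> sets M"
    using A F.subalg by (auto simp: subalgebra_def)
  have aH[measurable]: "?a \<in> borel_measurable H"
    by simp
  have aM[measurable]: "?a \<in> borel_measurable M"
    by (rule measurable_from_subalg[OF H.subalg aH])
  have "AE x in M. ?a x * nn_cond_exp M H p x = nn_cond_exp M H (\<lambda>x. indicator A x * nn_cond_exp M F p x) x"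
  proof (rule H.nn_cond_exp_charact)
    fix D assume D[measurable]: "D \<in> sets H"
    then have [measurable]: "D \<in> sets F"
      using FH by (auto simp: subalgebra_def)
    then have [measurable]: "D \<in> sets M"
      using F.subalg by (auto simp: subalgebra_def)
    have "(\<integral>\<^sup>+x. (indicator D x * indicator A x) * nn_cond_exp M F p x \<partial>M) =
        (\<integral>\<^sup>+x. (indicator D x * indicator A x) * p x \<partial>M)"
      by (rule F.nn_cond_exp_intg) auto
    also have "\<dots> = (\<integral>\<^sup>+x. indicator D x * indicator A x \<partial>?P)"
      by (subst nn_integral_density) (auto simp: mult.commute)
    also have "\<dots> = (\<integral>\<^sup>+x. indicator D x * ?a x \<partial>?P)"
      by (rule P.nn_cond_exp_intg[symmetric]) auto
    also have "\<dots> = (\<integral>\<^sup>+x. (indicator D x * ?a x) * p x \<partial>M)"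
      by (subst nn_integral_density) (auto simp: mult.commute)
    also have "\<dots> = (\<integral>\<^sup>+x. (indicator D x * ?a x) * nn_cond_exp M H p x \<partial>M)"
      by (rule H.nn_cond_exp_intg[symmetric]) auto
    finally show "(\<integral>\<^sup>+x\<in>D. indicator A x * nn_cond_exp M F p x \<partial>M) = (\<integral>\<^sup>+x\<in>D. ?a x * nn_cond_exp M H p x \<partial>M)"
      by (simp add: ac_simps)
  qed auto
  then show ?thesis .
qed

text \<open>A density that is a product of an \<open>F\<close>- and a \<open>G\<close>-measurable function preserves conditional
independence: in the integral of \<open>1\<^sub>A 1\<^sub>B p\<close> over a set of \<open>H\<close>, both factors can be projected to \<open>H\<close>
in turn.\<close>

lemma cond_indep_density_glue:
  assumes sF: "sigma_finite_subalgebra M F" and sG: "sigma_finite_subalgebra M G"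
    and sH: "sigma_finite_subalgebra M H" and FH: "subalgebra F H" and GH: "subalgebra G H"
    and ci: "cond_indep M F G H"
    and p[measurable]: "p \<in> borel_measurable M" and fin: "(\<integral>\<^sup>+x. p x \<partial>M) < \<infinity>"
    and eq: "AE x in M. p x = glue M F G H p x"
  shows "cond_indep (density M p) F G H"
  unfolding cond_indep_def
proof (intro ballI)
  fix A B assume A[measurable]: "A \<in> sets F" and B[measurable]: "B \<in> sets G"
  interpret F: sigma_finite_subalgebra M F by fact
  interpret G: sigma_finite_subalgebra M G by fact
  interpret H: sigma_finite_subalgebra M H by fact
  let ?P = "density M p"
  have "finite_measure ?P"
    using fin by (intro finite_measureI) (simp add: emeasure_density cong: nn_integral_cong)
  then interpret P: finite_measure_subalgebra ?P H
    using H.subalg by (intro finite_measure_subalgebra.intro) (auto simp: finite_measure_subalgebra_axioms_def subalgebra_def)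
  have [measurable]: "A \<in> sets M" "B \<in> sets M"
    using A B F.subalg G.subalg by (auto simp: subalgebra_def)
  let ?a = "nn_cond_exp ?P H (indicator A)" and ?b = "nn_cond_exp ?P H (indicator B)"
  have [measurable]: "?a \<in> borel_measurable H" "?b \<in> borel_measurable H"
    by simp_all
  have [measurable]: "?a \<in> borel_measurable M" "?b \<in> borel_measurable M"
    by (rule measurable_from_subalg[OF H.subalg], simp)+
  have [measurable]: "nn_cond_exp M H p \<in> borel_measurable F" "?b \<in> borel_measurable F"
    by (rule measurable_from_subalg[OF FH], simp)+
  have "AE x in ?P. ?a x * ?b x = nn_cond_exp ?P H (indicator (A \<inter> B)) x"
  proof (rule P.nn_cond_exp_charact)
    fix D assume D[measurable]: "D \<in> sets H"
    then have [measurable]: "D \<in> sets F"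
      using FH by (auto simp: subalgebra_def)
    then have [measurable]: "D \<in> sets M"
      using F.subalg by (auto simp: subalgebra_def)
    let ?f = "nn_cond_exp M F p" and ?g = "nn_cond_exp M G p" and ?h = "nn_cond_exp M H p"
    have "(\<integral>\<^sup>+x\<in>D. indicator (A \<inter> B) x \<partial>?P) = (\<integral>\<^sup>+x. p x * (indicator (A \<inter> B) x * indicator D x) \<partial>M)"
      by (subst nn_integral_density) auto
    also have "\<dots> = (\<integral>\<^sup>+x. (indicator D x * indicator A x * (?f x / ?h x)) * (indicator B x * ?g x) \<partial>M)"
      using eq by (intro nn_integral_cong_AE)
        (auto simp: glue_def divide_ennreal_def ac_simps indicator_inter_arith elim!: eventually_mono)
    also have "\<dots> = (\<integral>\<^sup>+x. (indicator D x * indicator A x * (?f x / ?h x)) * nn_cond_exp M H (\<lambda>x. indicator B x * ?g x) x \<partial>M)"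
      by (rule cond_indep_nn_integral[OF sH F.subalg G.subalg FH GH ci]) measurable
    also have "\<dots> = (\<integral>\<^sup>+x. (indicator D x * ?b x) * (indicator A x * ?f x) \<partial>M)"
    proof (rule nn_integral_cong_AE)
      show "AE x in M. (indicator D x * indicator A x * (?f x / ?h x)) * nn_cond_exp M H (\<lambda>x. indicator B x * ?g x) x
          = (indicator D x * ?b x) * (indicator A x * ?f x)"
        using nn_cond_exp_density[OF sG sH GH p fin B] cond_exp_divide_times_AE[OF sF sG sH FH GH ci p fin]
      proof eventually_elim
        case (elim x)
        have "(indicator D x * indicator A x * (?f x / ?h x)) * nn_cond_exp M H (\<lambda>x. indicator B x * ?g x) x
            = (indicator D x * ?b x) * (indicator A x * (?f x / ?h x * ?h x))"
          unfolding elim(1)[symmetric] by (simp add: ac_simps)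
        then show ?case
          unfolding elim(2) .
      qed
    qed
    also have "\<dots> = (\<integral>\<^sup>+x. (indicator D x * ?b x) * nn_cond_exp M H (\<lambda>x. indicator A x * ?f x) x \<partial>M)"
      by (rule H.nn_cond_exp_intg[symmetric]) auto
    also have "\<dots> = (\<integral>\<^sup>+x. (indicator D x * ?b x * ?a x) * ?h x \<partial>M)"
      using nn_cond_exp_density[OF sF sH FH p fin A]
      by (intro nn_integral_cong_AE) (auto simp: mult.assoc elim!: eventually_mono)
    also have "\<dots> = (\<integral>\<^sup>+x. (indicator D x * ?b x * ?a x) * p x \<partial>M)"
      by (rule H.nn_cond_exp_intg) auto
    also have "\<dots> = (\<integral>\<^sup>+x\<in>D. ?a x * ?b x \<partial>?P)"
      by (subst nn_integral_density) (auto simp: ac_simps)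
    finally show "(\<integral>\<^sup>+x\<in>D. indicator (A \<inter> B) x \<partial>?P) = (\<integral>\<^sup>+x\<in>D. ?a x * ?b x \<partial>?P)" .
  qed auto
  then show "AE x in ?P. nn_cond_exp ?P H (indicator (A \<inter> B)) x = ?a x * ?b x"
    by auto
qed

section \<open>Reciprocity of the minimizer\<close>

text \<open>The conventions for \<open>0\<close> and \<open>\<infinity>\<close> on both sides match, so this is unconditional.\<close>

lemma enn2real_divide: "enn2real (a / b) = enn2real a / enn2real b"
proof -
  have "enn2real (inverse b) = inverse (enn2real b)"
  proof (cases b)
    case (real r)
    then show ?thesis
      by (cases "r = 0") (auto simp: inverse_ennreal)
  qed auto
  then show ?thesis
    by (simp add: divide_ennreal_def enn2real_mult divide_inverse)
qed

lemma distr_density_cong_subalgebra: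
  assumes sub: "subalgebra M F" and [measurable]: "p \<in> borel_measurable M" "q \<in> borel_measurable M"
    and eq: "\<And>B. B \<in> sets F \<Longrightarrow> (\<integral>\<^sup>+x. p x * indicator B x \<partial>M) = (\<integral>\<^sup>+x. q x * indicator B x \<partial>M)"
    and X: "X \<in> measurable F N"
  shows "distr (density M p) N X = distr (density M q) N X"
proof (rule measure_eqI)
  have XM[measurable]: "X \<in> measurable M N"
    using measurable_from_subalg[OF sub X] .
  fix A assume "A \<in> sets (distr (density M p) N X)"
  then have A[measurable]: "A \<in> sets N"
    by simp
  have "X -` A \<inter> space M \<in> sets F"
    using measurable_sets[OF X A] sub by (simp add: subalgebra_def)
  from eq[OF this] show "emeasure (distr (density M p) N X) A = emeasure (distr (density M q) N X) A"
    by (simp add: emeasure_distr emeasure_density)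
qed simp

text \<open>Let \<open>f = E[p | F]\<close>. The Gibbs inequality bounds \<open>p ln (max 1 f)\<close> by \<open>p ln p + max 1 f - p\<close>. The
negative part of \<open>ln f\<close> is \<open>F\<close>-measurable, so its integral against \<open>p\<close> equals the one against
\<open>f\<close>, and \<open>- f ln f \<le> 1\<close> is integrable over the set \<open>C\<close> of finite measure.\<close>

lemma integrable_ln_cond_exp:
  fixes p :: "'b \<Rightarrow> real"
  assumes sF: "sigma_finite_subalgebra M F" and p0: "\<And>x. 0 \<le> p x"
    and ip: "integrable M p" and ipp: "integrable M (\<lambda>x. p x * ln (p x))"
    and C: "C \<in> sets F" and finC: "emeasure M C < \<infinity>"
  defines "f \<equiv> \<lambda>x. enn2real (nn_cond_exp M F p x)"
  shows "integrable M (\<lambda>x. p x * (indicator C x * ln (f x)))"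
proof -
  interpret F: sigma_finite_subalgebra M F by fact
  have [measurable]: "p \<in> borel_measurable M"
    using ip by auto
  have fin: "(\<integral>\<^sup>+x. ennreal (p x) \<partial>M) < \<infinity>"
    using ip p0 by (simp add: integrable_iff_bounded)
  have [measurable]: "C \<in> sets F" "C \<in> sets M"
    using C F.subalg by (auto simp: subalgebra_def)
  have fF[measurable]: "f \<in> borel_measurable F"
    unfolding f_def by measurable
  have [measurable]: "f \<in> borel_measurable M"
    by (rule measurable_from_subalg[OF F.subalg fF])
  have f0: "0 \<le> f x" for x
    by (simp add: f_def)
  have fe: "AE x in M. ennreal (f x) = nn_cond_exp M F p x"
    using nn_cond_exp_finite_AE[OF sF _ fin] by (auto simp: f_def less_top elim!: eventually_mono)
  have pf: "(\<integral>\<^sup>+x. \<phi> x * ennreal (p x) \<partial>M) = (\<integral>\<^sup>+x. \<phi> x * ennreal (f x) \<partial>M)"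
    if [measurable]: "\<phi> \<in> borel_measurable F" for \<phi>
  proof -
    have "(\<integral>\<^sup>+x. \<phi> x * ennreal (f x) \<partial>M) = (\<integral>\<^sup>+x. \<phi> x * nn_cond_exp M F p x \<partial>M)"
      using fe by (intro nn_integral_cong_AE) auto
    also have "\<dots> = (\<integral>\<^sup>+x. \<phi> x * ennreal (p x) \<partial>M)"
      by (rule F.nn_cond_exp_intg) auto
    finally show ?thesis ..
  qed
  (* the negative part of ln f on C; the default ln 0 = 0 is harmless because p = 0 a.e. where f = 0 *)
  define L where "L = (\<lambda>x. indicator C x * max 0 (- ln (f x)))"
  have LF[measurable]: "L \<in> borel_measurable F"
    unfolding L_def by measurable
  have LM[measurable]: "L \<in> borel_measurable M"
    by (rule measurable_from_subalg[OF F.subalg LF])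
  have "(\<integral>\<^sup>+x. ennreal (p x * L x) \<partial>M) = (\<integral>\<^sup>+x. ennreal (L x) * ennreal (p x) \<partial>M)"
    by (intro nn_integral_cong) (simp add: ennreal_mult'' p0 mult.commute)
  also have "\<dots> = (\<integral>\<^sup>+x. ennreal (L x) * ennreal (f x) \<partial>M)"
    by (rule pf) simp
  also have "\<dots> \<le> (\<integral>\<^sup>+x. indicator C x \<partial>M)"
  proof (intro nn_integral_mono)
    fix x
    have "L x * f x \<le> indicator C x"
      using gibbs_le[of "f x" 1] f0[of x] by (auto simp: L_def indicator_def max_def algebra_simps)
    then have "ennreal (L x * f x) \<le> ennreal (indicator C x)"
      by (rule ennreal_leI)
    then show "ennreal (L x) * ennreal (f x) \<le> indicator C x"
      by (simp add: ennreal_mult'' f0 ennreal_indicator)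
  qed
  also have "\<dots> < \<infinity>"
    using finC by simp
  finally have "(\<integral>\<^sup>+x. ennreal (p x * L x) \<partial>M) < \<infinity>" .
  then have iL: "integrable M (\<lambda>x. p x * L x)"
    by (intro integrableI_bounded) (auto simp: abs_mult p0 L_def)
  have "(\<integral>\<^sup>+x. ennreal (f x) \<partial>M) < \<infinity>"
    using pf[of "\<lambda>_. 1"] fin by simp
  then have "integrable M f"
    by (intro integrableI_bounded) (auto simp: f0)
  moreover have "integrable M (\<lambda>x. indicator C x :: real)"
    using finC by (intro integrable_real_indicator) auto
  ultimately have ib: "integrable M (\<lambda>x. \<bar>p x * ln (p x)\<bar> + (f x + indicator C x) + p x * L x)"
    using ipp iL by auto
  show ?thesis
  proof (rule Bochner_Integration.integrable_bound[OF ib])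
    show "AE x in M. norm (p x * (indicator C x * ln (f x))) \<le>
      norm (\<bar>p x * ln (p x)\<bar> + (f x + indicator C x) + p x * L x)"
    proof (rule AE_I2)
      fix x
      have "p x * ln (max 1 (f x)) \<le> \<bar>p x * ln (p x)\<bar> + max 1 (f x)"
      proof -
        have "p x * ln (max 1 (f x)) \<le> p x * ln (p x) + max 1 (f x) - p x"
          by (rule gibbs_le) (auto simp: p0)
        then show ?thesis
          using p0[of x] by linarith
      qed
      moreover have "\<bar>ln (f x)\<bar> = ln (max 1 (f x)) + max 0 (- ln (f x))"
        using f0[of x] by (cases "f x = 0") (auto simp: max_def)
      moreover have "0 \<le> p x * L x"
        using p0 by (auto simp: L_def)
      ultimately show "norm (p x * (indicator C x * ln (f x))) \<le>
          norm (\<bar>p x * ln (p x)\<bar> + (f x + indicator C x) + p x * L x)"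
        using p0[of x] f0[of x] by (auto simp: L_def indicator_def abs_mult distrib_left)
    qed
  qed (unfold f_def, measurable)
qed

lemma space_path_sigma [simp]: "space (path_sigma T) = paths"
  by (simp add: path_sigma_def)

lemma measurable_path_sigma_eval:
  assumes "t \<in> T"
  shows "(\<lambda>\<omega>. \<omega> t) \<in> measurable (path_sigma T) (borel :: 'a::polish_space measure)"
proof -
  have "(\<lambda>\<omega>. restrict \<omega> T) \<in> measurable (path_sigma T) (Pi\<^sub>M T (\<lambda>_. borel :: 'a measure))"
    unfolding path_sigma_def by (rule measurable_vimage_algebra1) (auto simp: space_PiM)
  from measurable_compose[OF this measurable_component_singleton[OF assms]] show ?thesis
    using assms by simp
qed

lemma subalgebra_path_sigma_if_measurable:
  assumes "space M = paths" "\<And>t. t \<in> T \<Longrightarrow> (\<lambda>\<omega>. \<omega> t) \<in> measurable M (borel :: 'a::polish_space measure)"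
  shows "subalgebra M (path_sigma T)"
proof -
  have "(\<lambda>\<omega>. restrict \<omega> T) \<in> measurable M (Pi\<^sub>M T (\<lambda>_. borel :: 'a measure))"
    using assms(2) by (intro measurable_restrict)
  then show ?thesis
    using assms(1) by (auto simp: subalgebra_def path_sigma_def measurable_iff_sets)
qed

lemma space_path_measures: "Q \<in> path_measures \<Longrightarrow> space Q = paths"
  using sets_eq_imp_space_eq[of Q path_borel] by (simp add: path_measures_def space_path_borel)

lemma measurable_path_measures_eval:
  assumes "Q \<in> path_measures" "t \<in> {0..1}"
  shows "(\<lambda>\<omega>. \<omega> t) \<in> measurable Q borel"
  using measurable_path_eval[OF assms(2)] assms(1) measurable_cong_sets[OF _ refl, of Q path_borel]
  by (auto simp: path_measures_def)

lemma subalgebra_path_sigma: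
  assumes "Q \<in> path_measures" "T \<subseteq> {0..1}"
  shows "subalgebra Q (path_sigma T)"
proof (rule subalgebra_path_sigma_if_measurable)
  show "(\<lambda>\<omega>. \<omega> t) \<in> borel_measurable Q" if "t \<in> T" for t
    using assms(2) that by (intro measurable_path_measures_eval[OF assms(1)]) auto
qed (rule space_path_measures[OF assms(1)])

lemma subalgebra_path_sigma_mono:
  "S \<subseteq> T \<Longrightarrow> subalgebra (path_sigma T) (path_sigma S)"
  by (intro subalgebra_path_sigma_if_measurable) (auto intro: measurable_path_sigma_eval)

lemma sigma_finite_path_sigma:
  fixes Q :: "(real \<Rightarrow> 'a::polish_space) measure"
  assumes Q: "conditionable Q" and T: "T \<subseteq> {0..1}" "t \<in> T"
  shows "sigma_finite_subalgebra Q (path_sigma T)"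
proof -
  have QM: "Q \<in> path_measures" and sf: "sigma_finite_measure (distr Q borel (\<lambda>\<omega>. \<omega> t))"
    using Q T by (auto simp: conditionable_def marg1_def)
  show ?thesis
    by (rule sigma_finite_subalgebraI_distr[OF subalgebra_path_sigma[OF QM T(1)] measurable_path_sigma_eval[OF T(2)] sf])
qed

lemma reciprocal_iff_cond_indep:
  "reciprocal Q \<longleftrightarrow> conditionable Q \<and>
     (\<forall>s u. 0 < s \<and> s < u \<and> u < 1 \<longrightarrow>
        cond_indep Q (path_sigma ({0..s} \<union> {u..1})) (path_sigma {s..u}) (path_sigma {s, u}))"
  unfolding reciprocal_def cond_indep_def cond_path_def by blast

lemma conditionable_prob:
  assumes "P \<in> path_probs"
  shows "conditionable P"
proof -
  interpret P: prob_space P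
    using assms by (simp add: path_probs_def)
  have PM: "P \<in> path_measures"
    using assms by (simp add: path_probs_def path_measures_def)
  have "sigma_finite_measure (marg1 P t)" if "t \<in> {0..1}" for t
  proof -
    interpret D: prob_space "marg1 P t"
      unfolding marg1_def by (rule P.prob_space_distr) (rule measurable_path_measures_eval[OF PM that])
    show ?thesis
      by (rule D.sigma_finite_measure_axioms)
  qed
  then show ?thesis
    using PM by (simp add: conditionable_def)
qed

lemma admissible_density_cong:
  fixes p q :: "(real \<Rightarrow> 'a::polish_space) \<Rightarrow> ennreal"
  assumes adm: "admissible T \<mu> \<pi> (density R p)"
    and [measurable]: "p \<in> borel_measurable R" "q \<in> borel_measurable R"
    and 1: "\<And>t. t \<in> T \<Longrightarrow> marg1 (density R q) t = marg1 (density R p) t"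
    and 2: "marg2 (density R q) 0 1 = marg2 (density R p) 0 1"
  shows "admissible T \<mu> \<pi> (density R q)"
proof -
  have P: "density R p \<in> path_probs"
    using adm by (simp add: admissible_def)
  then have RM: "R \<in> path_measures"
    by (auto simp: path_probs_def path_measures_def)
  interpret P: prob_space "density R p"
    using P by (simp add: path_probs_def)
  have ev: "(\<lambda>\<omega>. (\<omega> 0, \<omega> 1)) \<in> measurable R (borel :: ('a \<times> 'a) measure)"
    by (intro borel_measurable_Pair measurable_path_measures_eval[OF RM]) auto
  have "emeasure (density R f) (space (density R f)) = emeasure (marg2 (density R f) 0 1) UNIV" for f
    using ev by (auto simp: marg2_def emeasure_distr)
  then have "prob_space (density R q)"
    using 2 P.emeasure_space_1 by (intro prob_spaceI) auto
  then show ?thesis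
    using adm 1 2 by (auto simp: admissible_def path_probs_def)
qed

text \<open>Suppose that every constraint concerns \<open>F\<close> alone or \<open>G\<close> alone. Then the glued measure is admissible,
because it agrees with \<open>P\<close> on both. Its logarithmic density is a sum \<open>ln f + ln g - ln h\<close> of
functions measurable with respect to \<open>F\<close> or \<open>G\<close>, so it has the same mean under \<open>P\<close> and under the
glued measure, and strict convexity identifies the two. The comparison is made on each set \<open>C\<close> of
a countable cover by \<open>H\<close>-sets of finite measure: modifying the density on a set of \<open>H\<close> preserves
both marginals.\<close>

lemma entropy_minimizer_glue_eq:
  fixes p :: "(real \<Rightarrow> 'a::polish_space) \<Rightarrow> real"
  assumes sF: "sigma_finite_subalgebra R F" and sG: "sigma_finite_subalgebra R G"
    and sH: "sigma_finite_subalgebra R H" and FH: "subalgebra F H" and GH: "subalgebra G H"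
    and ci: "cond_indep R F G H"
    and margT: "\<And>t. t \<in> T \<Longrightarrow> (\<lambda>\<omega>. \<omega> t) \<in> borel_measurable F \<or> (\<lambda>\<omega>. \<omega> t) \<in> borel_measurable G"
    and marg01: "(\<lambda>\<omega>. (\<omega> 0, \<omega> 1)) \<in> borel_measurable F"
    and sol: "is_solution R T \<mu> \<pi> (density R p)"
    and p[measurable]: "p \<in> borel_measurable R" and p0: "\<And>\<omega>. 0 \<le> p \<omega>"
  shows "AE \<omega> in R. ennreal (p \<omega>) = glue R F G H p \<omega>"
proof -
  note ci' = cond_indep_commute[OF ci]
  interpret F: sigma_finite_subalgebra R F by fact
  interpret G: sigma_finite_subalgebra R G by fact
  interpret H: sigma_finite_subalgebra R H by fact
  have prP: "prob_space (density R p)" and adm: "admissible T \<mu> \<pi> (density R p)"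
    using sol by (auto simp: is_solution_def admissible_def path_probs_def)
  note ip = prob_space_density_real(1)[OF p p0 prP] and fin = prob_space_density_real(3)[OF p p0 prP]
  note ipp = entropy_minimizer_integrable[OF sol p p0]
  define f g h where "f = (\<lambda>\<omega>. enn2real (nn_cond_exp R F p \<omega>))"
    and "g = (\<lambda>\<omega>. enn2real (nn_cond_exp R G p \<omega>))" and "h = (\<lambda>\<omega>. enn2real (nn_cond_exp R H p \<omega>))"
  have m[measurable]: "f \<in> borel_measurable F" "g \<in> borel_measurable G" "h \<in> borel_measurable H"
    unfolding f_def g_def h_def by measurable
  have [measurable]: "h \<in> borel_measurable F" "h \<in> borel_measurable G"
    by (rule measurable_from_subalg[OF FH m(3)], rule measurable_from_subalg[OF GH m(3)])
  have [measurable]: "f \<in> borel_measurable R" "g \<in> borel_measurable R" "h \<in> borel_measurable R"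
    by (rule measurable_from_subalg[OF F.subalg m(1)], rule measurable_from_subalg[OF G.subalg m(2)],
        rule measurable_from_subalg[OF H.subalg m(3)])
  have p_ennreal: "(\<lambda>\<omega>. ennreal (p \<omega>)) \<in> borel_measurable R"
    by measurable
  note pos = nn_cond_exp_eq_0_AE[OF sF p_ennreal] nn_cond_exp_eq_0_AE[OF sG p_ennreal] nn_cond_exp_eq_0_AE[OF sH p_ennreal]
  note finite = nn_cond_exp_finite_AE[OF sF p_ennreal fin] nn_cond_exp_finite_AE[OF sG p_ennreal fin] nn_cond_exp_finite_AE[OF sH p_ennreal fin]
  have gl[measurable]: "glue R F G H p \<in> borel_measurable R"
    unfolding glue_def by measurable
  have int_gl: "(\<integral>\<^sup>+\<omega>. \<phi> \<omega> * glue R F G H p \<omega> \<partial>R) = (\<integral>\<^sup>+\<omega>. \<phi> \<omega> * p \<omega> \<partial>R)"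
    if "\<phi> \<in> borel_measurable F \<or> \<phi> \<in> borel_measurable G" for \<phi>
    using that
  proof
    assume "\<phi> \<in> borel_measurable F"
    then show ?thesis
      by (rule nn_integral_glue[OF sF sG sH FH GH ci p_ennreal fin])
  next
    assume "\<phi> \<in> borel_measurable G"
    then show ?thesis
      unfolding glue_commute[of R F] by (rule nn_integral_glue[OF sG sF sH GH FH ci' p_ennreal fin])
  qed
  have "(\<integral>\<^sup>+\<omega>. glue R F G H p \<omega> \<partial>R) < \<infinity>"
    using int_gl[of "\<lambda>_. 1"] fin by simp
  then have gl_fin: "AE \<omega> in R. glue R F G H p \<omega> < \<infinity>"
    using nn_integral_PInf_AE[OF gl] by (auto simp: less_top)
  have gl_eq: "enn2real (glue R F G H p \<omega>) = f \<omega> * g \<omega> / h \<omega>" for \<omega>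
    by (simp add: glue_def f_def g_def h_def enn2real_mult enn2real_divide)
  have on_C: "AE \<omega> in R. \<omega> \<in> C \<longrightarrow> ennreal (p \<omega>) = glue R F G H p \<omega>"
    if CH[measurable]: "C \<in> sets H" and finC: "emeasure R C < \<infinity>" for C
  proof -
    have [measurable]: "C \<in> sets F" "C \<in> sets G" "C \<in> sets R"
      using FH GH H.subalg CH by (auto simp: subalgebra_def)
    define q where "q = (\<lambda>\<omega>. if \<omega> \<in> C then enn2real (glue R F G H p \<omega>) else p \<omega>)"
    have q[measurable]: "q \<in> borel_measurable R"
      unfolding q_def by measurable
    have q0: "0 \<le> q \<omega>" for \<omega>
      by (simp add: q_def p0)
    have same: "(\<integral>\<^sup>+\<omega>. ennreal (p \<omega>) * indicator B \<omega> \<partial>R) = (\<integral>\<^sup>+\<omega>. ennreal (q \<omega>) * indicator B \<omega> \<partial>R)"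
      if B: "B \<in> sets F \<or> B \<in> sets G" for B
    proof -
      have [measurable]: "B \<in> sets R"
        using B F.subalg G.subalg by (auto simp: subalgebra_def)
      have BC: "(\<lambda>\<omega>. indicator (B \<inter> C) \<omega> :: ennreal) \<in> borel_measurable F \<or>
          (\<lambda>\<omega>. indicator (B \<inter> C) \<omega> :: ennreal) \<in> borel_measurable G"
        using B by auto
      have mm: "(\<lambda>\<omega>. indicator (B \<inter> C) \<omega> * glue R F G H p \<omega>) \<in> borel_measurable R"
          "(\<lambda>\<omega>. indicator (B - C) \<omega> * ennreal (p \<omega>)) \<in> borel_measurable R"
          "(\<lambda>\<omega>. indicator (B \<inter> C) \<omega> * ennreal (p \<omega>)) \<in> borel_measurable R"
        by measurable
      have "(\<integral>\<^sup>+\<omega>. ennreal (q \<omega>) * indicator B \<omega> \<partial>R) =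
          (\<integral>\<^sup>+\<omega>. indicator (B \<inter> C) \<omega> * glue R F G H p \<omega> + indicator (B - C) \<omega> * ennreal (p \<omega>) \<partial>R)"
        using gl_fin by (intro nn_integral_cong_AE)
          (auto simp: q_def indicator_def less_top elim!: eventually_mono)
      also have "\<dots> = (\<integral>\<^sup>+\<omega>. indicator (B \<inter> C) \<omega> * ennreal (p \<omega>) \<partial>R) + (\<integral>\<^sup>+\<omega>. indicator (B - C) \<omega> * ennreal (p \<omega>) \<partial>R)"
        by (simp only: nn_integral_add[OF mm(1,2)] int_gl[OF BC])
      also have "\<dots> = (\<integral>\<^sup>+\<omega>. indicator (B \<inter> C) \<omega> * ennreal (p \<omega>) + indicator (B - C) \<omega> * ennreal (p \<omega>) \<partial>R)"
        by (rule nn_integral_add[OF mm(3,2), symmetric])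
      also have "\<dots> = (\<integral>\<^sup>+\<omega>. ennreal (p \<omega>) * indicator B \<omega> \<partial>R)"
        by (intro nn_integral_cong) (auto simp: indicator_def)
      finally show ?thesis ..
    qed
    have margF: "distr (density R q) N X = distr (density R p) N X" if "X \<in> measurable F N" for N and X :: "_ \<Rightarrow> 'c"
      using same that by (intro distr_density_cong_subalgebra[OF F.subalg, symmetric]) auto
    have margG: "distr (density R q) N X = distr (density R p) N X" if "X \<in> measurable G N" for N and X :: "_ \<Rightarrow> 'c"
      using same that by (intro distr_density_cong_subalgebra[OF G.subalg, symmetric]) auto
    have admq: "admissible T \<mu> \<pi> (density R q)"
    proof (rule admissible_density_cong[OF adm])
      fix t assume "t \<in> T"
      from margT[OF this] show "marg1 (density R q) t = marg1 (density R p) t"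
        unfolding marg1_def by (auto intro: margF margG)
    next
      show "marg2 (density R q) 0 1 = marg2 (density R p) 0 1"
        unfolding marg2_def by (rule margF[OF marg01])
    qed auto
    define lf lg lh where "lf = (\<lambda>\<omega>. indicator C \<omega> * ln (f \<omega>))" and "lg = (\<lambda>\<omega>. indicator C \<omega> * ln (g \<omega>))"
      and "lh = (\<lambda>\<omega>. indicator C \<omega> * ln (h \<omega>))"
    have l[measurable]: "lf \<in> borel_measurable F" "lg \<in> borel_measurable G" "lh \<in> borel_measurable F"
      unfolding lf_def lg_def lh_def by measurable
    have ipl: "integrable R (\<lambda>\<omega>. p \<omega> * lf \<omega>)" "integrable R (\<lambda>\<omega>. p \<omega> * lg \<omega>)" "integrable R (\<lambda>\<omega>. p \<omega> * lh \<omega>)"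
      unfolding lf_def lg_def lh_def f_def g_def h_def
      by (rule integrable_ln_cond_exp[OF sF p0 ip ipp _ finC], simp)
        (rule integrable_ln_cond_exp[OF sG p0 ip ipp _ finC], simp, rule integrable_ln_cond_exp[OF sH p0 ip ipp CH finC])
    have iql: "integrable R (\<lambda>\<omega>. q \<omega> * lf \<omega>)" "integrable R (\<lambda>\<omega>. q \<omega> * lg \<omega>)" "integrable R (\<lambda>\<omega>. q \<omega> * lh \<omega>)"
      by (rule integral_eq_on_subalgebra(1)[OF F.subalg p q p0 q0 same l(1) ipl(1)], simp)
         (rule integral_eq_on_subalgebra(1)[OF G.subalg p q p0 q0 same l(2) ipl(2)], simp,
          rule integral_eq_on_subalgebra(1)[OF F.subalg p q p0 q0 same l(3) ipl(3)], simp)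
    have eql: "(\<integral>\<omega>. q \<omega> * lf \<omega> \<partial>R) = (\<integral>\<omega>. p \<omega> * lf \<omega> \<partial>R)" "(\<integral>\<omega>. q \<omega> * lg \<omega> \<partial>R) = (\<integral>\<omega>. p \<omega> * lg \<omega> \<partial>R)"
        "(\<integral>\<omega>. q \<omega> * lh \<omega> \<partial>R) = (\<integral>\<omega>. p \<omega> * lh \<omega> \<partial>R)"
      by (rule integral_eq_on_subalgebra(2)[OF F.subalg p q p0 q0 same l(1) ipl(1)], simp)
         (rule integral_eq_on_subalgebra(2)[OF G.subalg p q p0 q0 same l(2) ipl(2)], simp,
          rule integral_eq_on_subalgebra(2)[OF F.subalg p q p0 q0 same l(3) ipl(3)], simp)
    have [measurable]: "lf \<in> borel_measurable R" "lg \<in> borel_measurable R" "lh \<in> borel_measurable R"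
      unfolding lf_def lg_def lh_def by measurable
    have q_pos: "AE \<omega> in R. \<omega> \<in> C \<longrightarrow> q \<omega> = 0 \<longrightarrow> p \<omega> = 0"
      using pos finite
    proof eventually_elim
      case (elim \<omega>)
      show ?case
      proof (intro impI)
        assume "\<omega> \<in> C" "q \<omega> = 0"
        then have "f \<omega> = 0 \<or> g \<omega> = 0 \<or> h \<omega> = 0"
          using gl_eq[of \<omega>] by (simp add: q_def)
        then have "ennreal (p \<omega>) = 0"
          using elim by (auto simp: f_def g_def h_def enn2real_eq_0_iff)
        then show "p \<omega> = 0"
          using p0[of \<omega>] by (simp add: ennreal_eq_0_iff)
      qed
    qed
    have lnq: "AE \<omega> in R. indicator C \<omega> * ln (q \<omega>) = lf \<omega> + lg \<omega> - lh \<omega> \<or> (q \<omega> = 0 \<and> p \<omega> = 0)"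
      using q_pos
    proof eventually_elim
      case (elim \<omega>)
      show ?case
      proof (cases "\<omega> \<in> C \<and> q \<omega> \<noteq> 0")
        case True
        then have "q \<omega> = f \<omega> * g \<omega> / h \<omega>" "f \<omega> > 0" "g \<omega> > 0" "h \<omega> > 0"
          using gl_eq[of \<omega>] by (auto simp: q_def f_def g_def h_def less_le)
        then show ?thesis
          using True by (simp add: lf_def lg_def lh_def ln_mult ln_div)
      qed (use elim in \<open>auto simp: lf_def lg_def lh_def\<close>)
    qed
    from lnq have lnp: "AE \<omega> in R. indicator C \<omega> * (p \<omega> * ln (q \<omega>)) = p \<omega> * lf \<omega> + p \<omega> * lg \<omega> - p \<omega> * lh \<omega>"
    proof eventually_elim
      case (elim \<omega>)
      then have "p \<omega> * (indicator C \<omega> * ln (q \<omega>)) = p \<omega> * (lf \<omega> + lg \<omega> - lh \<omega>)"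
        by auto
      then show ?case
        by (simp only: mult.left_commute distrib_left right_diff_distrib)
    qed
    from lnq have lnq: "AE \<omega> in R. indicator C \<omega> * (q \<omega> * ln (q \<omega>)) = q \<omega> * lf \<omega> + q \<omega> * lg \<omega> - q \<omega> * lh \<omega>"
    proof eventually_elim
      case (elim \<omega>)
      then have "q \<omega> * (indicator C \<omega> * ln (q \<omega>)) = q \<omega> * (lf \<omega> + lg \<omega> - lh \<omega>)"
        by auto
      then show ?case
        by (simp only: mult.left_commute distrib_left right_diff_distrib)
    qed
    have "AE \<omega> in R. q \<omega> = p \<omega>"
    proof (rule entropy_minimizer_eq[OF sol p p0 q q0 _ finC _ admq q_pos])
      show "integrable R (\<lambda>\<omega>. indicator C \<omega> * (p \<omega> * ln (q \<omega>)))"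
        by (rule integrable_cong_AE[THEN iffD2, OF _ _ lnp]) (use ipl in auto)
      show "integrable R (\<lambda>\<omega>. indicator C \<omega> * (q \<omega> * ln (q \<omega>)))"
        by (rule integrable_cong_AE[THEN iffD2, OF _ _ lnq]) (use iql in auto)
      have "(\<integral>\<omega>. indicator C \<omega> * (p \<omega> * ln (q \<omega>)) \<partial>R) = (\<integral>\<omega>. p \<omega> * lf \<omega> + p \<omega> * lg \<omega> - p \<omega> * lh \<omega> \<partial>R)"
        by (rule integral_cong_AE[OF _ _ lnp]) auto
      also have "\<dots> = (\<integral>\<omega>. q \<omega> * lf \<omega> + q \<omega> * lg \<omega> - q \<omega> * lh \<omega> \<partial>R)"
        using ipl iql eql by simp
      also have "\<dots> = (\<integral>\<omega>. indicator C \<omega> * (q \<omega> * ln (q \<omega>)) \<partial>R)"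
        by (rule integral_cong_AE[OF _ _ lnq, symmetric]) auto
      finally show "(\<integral>\<omega>. indicator C \<omega> * (p \<omega> * ln (q \<omega>)) \<partial>R) = (\<integral>\<omega>. indicator C \<omega> * (q \<omega> * ln (q \<omega>)) \<partial>R)" .
    qed (auto simp: q_def)
    then show ?thesis
      using gl_fin
    proof eventually_elim
      case (elim \<omega>)
      show ?case
      proof
        assume "\<omega> \<in> C"
        then have "p \<omega> = enn2real (glue R F G H p \<omega>)"
          using elim(1) by (simp add: q_def)
        then show "ennreal (p \<omega>) = glue R F G H p \<omega>"
          using elim(2) by (simp only: ennreal_enn2real infinity_ennreal_def)
      qed
    qed
  qed
  obtain \<C> where \<C>: "countable \<C>" "\<C> \<subseteq> sets (restr_to_subalg R H)" "\<Union>\<C> = space (restr_to_subalg R H)"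
      "\<And>C. C \<in> \<C> \<Longrightarrow> emeasure (restr_to_subalg R H) C \<noteq> \<infinity>"
    using sigma_finite_measure.sigma_finite_countable[OF H.sigma_fin_subalg] by blast
  have "AE \<omega> in R. \<forall>C\<in>\<C>. \<omega> \<in> C \<longrightarrow> ennreal (p \<omega>) = glue R F G H p \<omega>"
    unfolding AE_ball_countable[OF \<C>(1)]
    using \<C>(2,4) by (auto intro!: on_C simp: sets_restr_to_subalg[OF H.subalg] emeasure_restr_to_subalg[OF H.subalg] less_top subset_iff)
  then show ?thesis
    using AE_space
  proof eventually_elim
    case (elim \<omega>)
    then show ?case
      using \<C>(3) by (auto simp: space_restr_to_subalg)
  qed
qed

text \<open>All indicators of sets of \<open>F\<close> are their own conditional expectations.\<close>

lemma cond_indep_self: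
  assumes sF: "sigma_finite_subalgebra M F"
  shows "cond_indep M F F F"
proof -
  interpret F: sigma_finite_subalgebra M F by fact
  have *: "AE x in M. indicator A x = nn_cond_exp M F (indicator A) x" if "A \<in> sets F" for A
    using that F.subalg by (intro F.nn_cond_exp_charact) (auto simp: subalgebra_def)
  show ?thesis
    unfolding cond_indep_def
  proof (intro ballI)
    fix A B assume A: "A \<in> sets F" and B: "B \<in> sets F"
    show "AE x in M. nn_cond_exp M F (indicator (A \<inter> B)) x = nn_cond_exp M F (indicator A) x * nn_cond_exp M F (indicator B) x"
      using *[OF A] *[OF B] *[OF sets.Int[OF A B]]
    proof eventually_elim
      case (elim x)
      show ?case
        unfolding elim[symmetric] by (rule indicator_inter_arith)
    qed
  qed
qed

text \<open>The case \<open>F = G = H\<close> of gluing, where the glued density is \<open>E[p | F]\<close>: the density of the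
minimizer depends only on what the constraints see.\<close>

lemma entropy_minimizer_eq_cond_exp:
  fixes p :: "(real \<Rightarrow> 'a::polish_space) \<Rightarrow> real"
  assumes sF: "sigma_finite_subalgebra R F"
    and margT: "\<And>t. t \<in> T \<Longrightarrow> (\<lambda>\<omega>. \<omega> t) \<in> borel_measurable F"
    and marg01: "(\<lambda>\<omega>. (\<omega> 0, \<omega> 1)) \<in> borel_measurable F"
    and sol: "is_solution R T \<mu> \<pi> (density R p)"
    and p[measurable]: "p \<in> borel_measurable R" and p0: "\<And>\<omega>. 0 \<le> p \<omega>"
  shows "AE \<omega> in R. ennreal (p \<omega>) = nn_cond_exp R F p \<omega>"
proof -
  have "density R p \<in> path_probs"
    using sol by (simp add: is_solution_def admissible_def)
  then have "prob_space (density R p)"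
    by (simp add: path_probs_def)
  note fin = prob_space_density_real(3)[OF p p0 this]
  have "subalgebra F F"
    by (simp add: subalgebra_def)
  then have "AE \<omega> in R. ennreal (p \<omega>) = glue R F F F p \<omega>"
    using margT by (intro entropy_minimizer_glue_eq[OF sF sF sF _ _ cond_indep_self[OF sF] _ marg01 sol p p0]) auto
  moreover have "AE \<omega> in R. nn_cond_exp R F p \<omega> < \<infinity>"
    using fin by (intro nn_cond_exp_finite_AE[OF sF]) auto
  ultimately show ?thesis
  proof eventually_elim
    case (elim \<omega>)
    have "a * a / a = a" if "a < \<infinity>" for a :: ennreal
      using that by (cases "a = 0") (auto simp: ennreal_mult_divide_eq)
    with elim show ?case
      by (simp add: glue_def)
  qed
qed

text \<open>Each time \<open>t\<close> lies in \<open>[s,u]\<close> or outside \<open>(s,u)\<close>, and the pair \<open>(X\<^sub>0, X\<^sub>1)\<close> is observed outside. So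
gluing along \<open>(X\<^sub>s, X\<^sub>u)\<close> respects the constraints.\<close>

lemma reciprocal_entropy_minimizer:
  fixes p :: "(real \<Rightarrow> 'a::polish_space) \<Rightarrow> real"
  assumes R: "reciprocal R" and T: "T \<subseteq> {0..1}"
    and sol: "is_solution R T \<mu> \<pi> (density R p)"
    and p[measurable]: "p \<in> borel_measurable R" and p0: "\<And>\<omega>. 0 \<le> p \<omega>"
  shows "reciprocal (density R p)"
  unfolding reciprocal_iff_cond_indep
proof (intro conjI allI impI)
  have P: "density R p \<in> path_probs"
    using sol by (simp add: is_solution_def admissible_def)
  then show "conditionable (density R p)"
    by (rule conditionable_prob)
  fix s u :: real assume su: "0 < s \<and> s < u \<and> u < 1"
  have cR: "conditionable R"
    using R by (simp add: reciprocal_def)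
  have "prob_space (density R p)"
    using P by (simp add: path_probs_def)
  note fin = prob_space_density_real(3)[OF p p0 this]
  show "cond_indep (density R p) (path_sigma ({0..s} \<union> {u..1})) (path_sigma {s..u}) (path_sigma {s, u})"
  proof (rule cond_indep_density_glue)
    show "cond_indep R (path_sigma ({0..s} \<union> {u..1})) (path_sigma {s..u}) (path_sigma {s, u})"
      using R su by (simp add: reciprocal_iff_cond_indep)
    show "AE \<omega> in R. ennreal (p \<omega>) = glue R (path_sigma ({0..s} \<union> {u..1})) (path_sigma {s..u}) (path_sigma {s, u}) p \<omega>"
    proof (rule entropy_minimizer_glue_eq[OF _ _ _ _ _ _ _ _ sol p p0])
      show "cond_indep R (path_sigma ({0..s} \<union> {u..1})) (path_sigma {s..u}) (path_sigma {s, u})"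
        using R su by (simp add: reciprocal_iff_cond_indep)
      fix t assume "t \<in> T"
      then have "t \<in> {0..s} \<union> {u..1} \<or> t \<in> {s..u}"
        using T by fastforce
      then show "(\<lambda>\<omega>. \<omega> t) \<in> borel_measurable (path_sigma ({0..s} \<union> {u..1})) \<or> (\<lambda>\<omega>. \<omega> t) \<in> borel_measurable (path_sigma {s..u})"
        by (elim disjE) (rule disjI1, erule measurable_path_sigma_eval, rule disjI2, erule measurable_path_sigma_eval)
    next
      show "(\<lambda>\<omega>. (\<omega> 0, \<omega> 1)) \<in> borel_measurable (path_sigma ({0..s} \<union> {u..1}))"
        using su by (intro borel_measurable_Pair measurable_path_sigma_eval) auto
    qed (use su in \<open>auto intro!: sigma_finite_path_sigma[OF cR, where t = s] subalgebra_path_sigma_mono\<close>)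
  qed (use su fin in \<open>auto intro!: sigma_finite_path_sigma[OF cR, where t = s] subalgebra_path_sigma_mono\<close>)
qed

section \<open>Exchange of coordinates\<close>

text \<open>The image under \<open>T\<close> of the restriction of \<open>W\<close> to \<open>B\<close> is dominated by the image \<open>M\<close> of all of \<open>W\<close>,
so it has a density between 0 and 1. It is carried by \<open>T B\<close>, and the chosen version vanishes off
any given \<open>G\<close> that contains \<open>T B\<close>.\<close>

lemma distr_indicator_density:
  assumes M: "finite_measure M" and W: "finite_measure W"
    and T[measurable]: "T \<in> measurable W M" and TM: "distr W M T = M"
    and B[measurable]: "B \<in> sets W" and G[measurable]: "G \<in> sets M" and TG: "\<And>w. w \<in> B \<Longrightarrow> T w \<in> G"
  obtains \<alpha> :: "'z \<Rightarrow> real" where "\<alpha> \<in> borel_measurable M" "\<And>x. 0 \<le> \<alpha> x" "\<And>x. \<alpha> x \<le> 1"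
    "\<And>x. x \<notin> G \<Longrightarrow> \<alpha> x = 0"
    "\<And>\<phi> :: 'z \<Rightarrow> real. \<phi> \<in> borel_measurable M \<Longrightarrow> (\<integral>x. \<alpha> x * \<phi> x \<partial>M) = (\<integral>w. indicator B w * \<phi> (T w) \<partial>W)"
proof -
  interpret M: finite_measure M by fact
  interpret W: finite_measure W by fact
  let ?N = "distr (density W (indicator B)) M T"
  have N_eq: "emeasure ?N A = emeasure W (B \<inter> (T -` A \<inter> space W))" if "A \<in> sets M" for A
  proof -
    have [measurable]: "A \<in> sets M"
      by fact
    have "emeasure ?N A = (\<integral>\<^sup>+w. indicator B w * indicator (T -` A \<inter> space W) w \<partial>W)"
      by (simp add: emeasure_distr emeasure_density)
    also have "\<dots> = (\<integral>\<^sup>+w. indicator (B \<inter> (T -` A \<inter> space W)) w \<partial>W)"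
      by (intro nn_integral_cong) (auto simp: indicator_def)
    finally show ?thesis
      by simp
  qed
  have N_le: "emeasure ?N A \<le> emeasure M A" if A: "A \<in> sets M" for A
  proof -
    have "emeasure ?N A \<le> emeasure W (T -` A \<inter> space W)"
      unfolding N_eq[OF A] using A by (intro emeasure_mono) auto
    also have "\<dots> = emeasure (distr W M T) A"
      using A by (simp add: emeasure_distr)
    finally show ?thesis
      by (simp add: TM)
  qed
  have ac: "absolutely_continuous M ?N"
    unfolding absolutely_continuous_def
  proof
    fix A assume "A \<in> null_sets M"
    then show "A \<in> null_sets ?N"
      using N_le[of A] by (auto simp: null_sets_def)
  qed
  define f where "f = RN_deriv M ?N"
  have f[measurable]: "f \<in> borel_measurable M" and Nf: "density M f = ?N"
    unfolding f_def by (auto intro!: M.density_RN_deriv ac)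
  have f1: "AE x in M. f x \<le> 1"
  proof -
    let ?A = "{x \<in> space M. 1 < f x}"
    have A: "?A \<in> sets M"
      by measurable
    have "(\<integral>\<^sup>+x. (f x - 1) * indicator ?A x \<partial>M) = (\<integral>\<^sup>+x. f x * indicator ?A x - indicator ?A x \<partial>M)"
      by (intro nn_integral_cong) (auto simp: indicator_def)
    also have "\<dots> = (\<integral>\<^sup>+x. f x * indicator ?A x \<partial>M) - (\<integral>\<^sup>+x. indicator ?A x \<partial>M)"
    proof (rule nn_integral_diff)
      show "(\<integral>\<^sup>+x. indicator ?A x \<partial>M) \<noteq> \<infinity>"
        by (subst nn_integral_indicator[OF A]) simp
    qed (use A in \<open>auto simp: indicator_def less_imp_le\<close>)
    also have "\<dots> = emeasure ?N ?A - emeasure M ?A"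
      using A by (simp add: Nf[symmetric] emeasure_density)
    also have "\<dots> = 0"
    proof -
      have "emeasure M ?A < top"
        using M.emeasure_finite[of ?A] unfolding less_top infinity_ennreal_def .
      from le_less_trans[OF N_le[OF A] this] show ?thesis
        using N_le[OF A] by (simp add: diff_eq_0_iff_ennreal)
    qed
    finally have "AE x in M. (f x - 1) * indicator ?A x = 0"
      using A by (subst (asm) nn_integral_0_iff_AE) auto
    then show ?thesis
      using AE_space
    proof eventually_elim
      case (elim x)
      show ?case
      proof (rule ccontr)
        assume "\<not> f x \<le> 1"
        with elim show False
          by (auto simp: diff_eq_0_iff_ennreal)
      qed
    qed
  qed
  have f0: "AE x in M. x \<notin> G \<longrightarrow> f x = 0"
  proof -
    have "(\<integral>\<^sup>+x. f x * indicator (space M - G) x \<partial>M) = emeasure ?N (space M - G)"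
      by (simp add: Nf[symmetric] emeasure_density)
    also have "\<dots> = emeasure W {}"
      unfolding N_eq[OF sets.compl_sets[OF G]] using TG by (intro arg_cong[where f = "emeasure W"]) auto
    also have "\<dots> = 0"
      by simp
    finally have "AE x in M. f x * indicator (space M - G) x = 0"
      by (subst (asm) nn_integral_0_iff_AE) auto
    then show ?thesis
      using AE_space by eventually_elim (auto simp: indicator_def split: if_splits)
  qed
  define \<alpha> where "\<alpha> = (\<lambda>x. if x \<in> G then min 1 (enn2real (f x)) else 0)"
  have \<alpha>[measurable]: "\<alpha> \<in> borel_measurable M" and \<alpha>0: "\<And>x. 0 \<le> \<alpha> x"
    by (auto simp: \<alpha>_def)
  have \<alpha>f: "AE x in M. ennreal (\<alpha> x) = f x"
    using f0 f1
  proof eventually_elim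
    case (elim x)
    then have "f x < top"
      using le_less_trans[of "f x" 1 top] by simp
    with elim have "enn2real (f x) \<le> 1" "ennreal (enn2real (f x)) = f x"
      using enn2real_mono[of "f x" 1] by (auto simp: ennreal_enn2real)
    then show ?case
      using elim by (auto simp: \<alpha>_def min_def)
  qed
  show ?thesis
  proof
    fix \<phi> :: "'z \<Rightarrow> real" assume [measurable]: "\<phi> \<in> borel_measurable M"
    have "density M \<alpha> = ?N"
      unfolding Nf[symmetric] using \<alpha>f by (intro density_cong) auto
    then have "(\<integral>x. \<alpha> x * \<phi> x \<partial>M) = (\<integral>x. \<phi> x \<partial>?N)"
      by (simp add: integral_density \<alpha>0 flip: \<open>density M \<alpha> = ?N\<close>)
    also have "\<dots> = (\<integral>w. \<phi> (T w) \<partial>density W (indicator B))"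
      by (rule integral_distr) auto
    also have "density W (indicator B) = density W (\<lambda>w. ennreal (indicator B w))"
      by (simp add: ennreal_indicator)
    also have "(\<integral>w. \<phi> (T w) \<partial>\<dots>) = (\<integral>w. indicator B w * \<phi> (T w) \<partial>W)"
      by (subst integral_density) auto
    finally show "(\<integral>x. \<alpha> x * \<phi> x \<partial>M) = (\<integral>w. indicator B w * \<phi> (T w) \<partial>W)" .
  qed (use \<alpha> \<alpha>0 in \<open>auto simp: \<alpha>_def\<close>)
qed

lemma abs_mult_ln_le:
  fixes x K :: real
  assumes "0 \<le> x" "x \<le> K"
  shows "\<bar>x * ln x\<bar> \<le> 1 + K * K"
proof (cases "x = 0")
  case False
  then have "0 < x"
    using assms by simp
  have "x * ln x \<le> x * x"
    using ln_le_minus_one[OF \<open>0 < x\<close>] \<open>0 < x\<close> by (intro mult_left_mono) auto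
  also have "\<dots> \<le> K * K"
    using assms by (intro mult_mono) auto
  finally have "x * ln x \<le> K * K" .
  moreover have "0 \<le> x * ln x + 1 - x"
    using gibbs_le[of x 1] assms by simp
  moreover have "0 \<le> K * K"
    by simp
  ultimately show ?thesis
    using assms(1) by linarith
qed simp

lemma integral_sum_diff_sum:
  fixes f g :: "'i \<Rightarrow> 'b \<Rightarrow> real"
  assumes "\<And>k. k \<in> I \<Longrightarrow> integrable M (f k)" "\<And>k. k \<in> I \<Longrightarrow> integrable M (g k)"
  shows "(\<integral>x. (\<Sum>k\<in>I. f k x) - (\<Sum>k\<in>I. g k x) \<partial>M) = (\<Sum>k\<in>I. \<integral>x. f k x \<partial>M) - (\<Sum>k\<in>I. \<integral>x. g k x \<partial>M)"
proof -
  have "integrable M (\<lambda>x. \<Sum>k\<in>I. f k x)" "integrable M (\<lambda>x. \<Sum>k\<in>I. g k x)"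
    using assms by (auto intro!: Bochner_Integration.integrable_sum)
  moreover have "(\<integral>x. (\<Sum>k\<in>I. f k x) \<partial>M) = (\<Sum>k\<in>I. \<integral>x. f k x \<partial>M)"
      "(\<integral>x. (\<Sum>k\<in>I. g k x) \<partial>M) = (\<Sum>k\<in>I. \<integral>x. g k x \<partial>M)"
    using assms by (auto intro!: Bochner_Integration.integral_sum)
  ultimately show ?thesis
    by simp
qed

text \<open>First-order optimality along exchanges of coordinates. Here \<open>p\<close> and \<open>r\<close> are densities of the
minimizer with respect to \<open>R\<close> and of \<open>R\<close> with respect to a probability \<open>M\<close>. Draw \<open>w\<close> at random and
move a little mass from the points \<open>U k w\<close> to the points \<open>T k w\<close>; by \<open>swap\<close> no constraint notices.
At first order the entropy changes by the mean of \<open>\<Sum> ln p (T k w) - \<Sum> ln p (U k w)\<close>, so this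
quantity cannot be negative on a set of positive measure. In particular mass at all points
\<open>U k w\<close> forces mass at all points \<open>T k w\<close>, since \<open>x ln x\<close> has slope \<open>-\<infinity>\<close> at 0.

In place of a limit of difference quotients, the contradiction is sought on a set \<open>B c\<close> where the
densities are bounded and the strict inequality survives an error of \<open>c / 2\<close> in \<open>p\<close>; there, for one
fixed small perturbation, the tangent inequality at the perturbed density suffices.\<close>

lemma swap_inequality:
  fixes p r :: "'z \<Rightarrow> real" and T U :: "nat \<Rightarrow> 'w \<Rightarrow> 'z"
  assumes M: "prob_space M" and W: "prob_space W"
    and T: "\<And>k. k < n \<Longrightarrow> T k \<in> measurable W M" "\<And>k. k < n \<Longrightarrow> distr W M (T k) = M"
    and U: "\<And>k. k < n \<Longrightarrow> U k \<in> measurable W M" "\<And>k. k < n \<Longrightarrow> distr W M (U k) = M"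
    and p[measurable]: "p \<in> borel_measurable M" and p0: "\<And>x. 0 \<le> p x"
    and r[measurable]: "r \<in> borel_measurable M" and r0: "AE x in M. 0 < r x"
    and \<A>: "\<A> \<subseteq> sets M"
    and swap: "\<And>A w. A \<in> \<A> \<Longrightarrow> w \<in> space W \<Longrightarrow>
      (\<Sum>k<n. indicator A (T k w)) = (\<Sum>k<n. indicator A (U k w) :: real)"
    and opt: "\<And>C u b. C \<in> sets M \<Longrightarrow> u \<in> borel_measurable M \<Longrightarrow>
      (\<And>x. x \<in> C \<Longrightarrow> 0 \<le> r x \<and> r x \<le> b \<and> p x \<le> b) \<Longrightarrow> (\<And>x. \<bar>u x\<bar> \<le> b) \<Longrightarrow> (\<And>x. x \<notin> C \<Longrightarrow> u x = 0) \<Longrightarrow>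
      (\<And>x. 0 \<le> p x + u x) \<Longrightarrow> (\<And>A. A \<in> \<A> \<Longrightarrow> (\<integral>x. indicator A x * (u x * r x) \<partial>M) = 0) \<Longrightarrow>
      0 \<le> (\<integral>x. r x * ((p x + u x) * ln (p x + u x) - p x * ln (p x)) \<partial>M)"
  shows "AE w in W. (\<Prod>k<n. p (U k w)) \<le> (\<Prod>k<n. p (T k w))"
proof -
  interpret M: prob_space M by fact
  interpret W: prob_space W by fact
  have Tm: "(\<lambda>w. f (T k w)) \<in> measurable W L" if "f \<in> measurable M L" "k < n" for f k and L :: "'l measure"
    using measurable_compose[OF T(1) that(1)] that(2) by blast
  have Um: "(\<lambda>w. f (U k w)) \<in> measurable W L" if "f \<in> measurable M L" "k < n" for f k and L :: "'l measure"
    using measurable_compose[OF U(1) that(1)] that(2) by blast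
  define G where "G = (\<lambda>c::real. {x \<in> space M. c \<le> r x \<and> r x \<le> 1 / c \<and> p x \<le> 1 / c})"
  define G' where "G' = (\<lambda>c::real. G c \<inter> {x \<in> space M. c \<le> p x})"
  (* the inequality fails there with margin c / 2; almost every point of failure lies in B c for
     all small c *)
  define B where "B = (\<lambda>c::real. {w \<in> space W. (\<forall>k<n. T k w \<in> G c) \<and> (\<forall>k<n. U k w \<in> G' c) \<and>
    (\<Prod>k<n. p (T k w) + c / 2) < (\<Prod>k<n. p (U k w) - c / 2)})"
  have G[measurable]: "G c \<in> sets M" and G'[measurable]: "G' c \<in> sets M" for c
    unfolding G_def G'_def by measurable
  have B_null: "AE w in W. w \<notin> B c" if c: "0 < c" for c
  proof -
    have [measurable]: "B c \<in> sets W"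
    proof -
      have [measurable]: "Measurable.pred W (\<lambda>w. T k w \<in> G c)" "Measurable.pred W (\<lambda>w. U k w \<in> G' c)" if "k < n" for k
        using that by (auto intro!: Tm Um)
      have [measurable]: "(\<lambda>w. \<Prod>k<n. p (T k w) + c / 2) \<in> borel_measurable W" "(\<lambda>w. \<Prod>k<n. p (U k w) - c / 2) \<in> borel_measurable W"
        using Tm[OF p] Um[OF p] by (auto intro!: borel_measurable_prod)
      have "B c = {w \<in> space W. (\<forall>k\<in>{..<n}. T k w \<in> G c) \<and> (\<forall>k\<in>{..<n}. U k w \<in> G' c) \<and>
        (\<Prod>k<n. p (T k w) + c / 2) < (\<Prod>k<n. p (U k w) - c / 2)}"
        by (auto simp: B_def)
      also have "\<dots> \<in> sets W"
        by (intro sets.sets_Collect_conj sets.sets_Collect_finite_All) (auto intro!: Tm Um)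
      finally show ?thesis .
    qed
    define \<gamma> where "\<gamma> V \<alpha> H \<longleftrightarrow> \<alpha> \<in> borel_measurable M \<and> (\<forall>x. 0 \<le> \<alpha> x \<and> \<alpha> x \<le> 1 \<and> (x \<notin> H \<longrightarrow> \<alpha> x = 0)) \<and>
      (\<forall>\<phi>\<in>borel_measurable M. (\<integral>x. \<alpha> x * \<phi> x \<partial>M) = (\<integral>w. indicator (B c) w * \<phi> (V w) \<partial>W))"
      for V and \<alpha> :: "'z \<Rightarrow> real" and H :: "'z set"
    have "\<exists>\<beta>. \<gamma> (T k) \<beta> (G c)" if "k < n" for k
      by (rule distr_indicator_density[OF M.finite_measure_axioms W.finite_measure_axioms T[OF that] \<open>B c \<in> sets W\<close> G[of c]])
         (use that in \<open>auto simp: B_def \<gamma>_def\<close>)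
    then obtain \<beta> where \<beta>: "\<And>k. k < n \<Longrightarrow> \<gamma> (T k) (\<beta> k) (G c)"
      by metis
    have "\<exists>\<alpha>. \<gamma> (U k) \<alpha> (G' c)" if "k < n" for k
      by (rule distr_indicator_density[OF M.finite_measure_axioms W.finite_measure_axioms U[OF that] \<open>B c \<in> sets W\<close> G'[of c]])
         (use that in \<open>auto simp: B_def \<gamma>_def\<close>)
    then obtain \<alpha> where \<alpha>: "\<And>k. k < n \<Longrightarrow> \<gamma> (U k) (\<alpha> k) (G' c)"
      by metis
    (* mass leaves the points U k w and arrives at the points T k w, for w in B c *)
    define \<nu> where "\<nu> x = (\<Sum>k<n. \<beta> k x) - (\<Sum>k<n. \<alpha> k x)" for x
    have [measurable]: "\<beta> k \<in> borel_measurable M" "\<alpha> k \<in> borel_measurable M" if "k < n" for k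
      using \<alpha>[OF that] \<beta>[OF that] by (auto simp: \<gamma>_def)
    have \<nu>m[measurable]: "\<nu> \<in> borel_measurable M"
      unfolding \<nu>_def by (intro borel_measurable_diff borel_measurable_sum) auto
    have sum01: "0 \<le> (\<Sum>k<n. \<beta> k x)" "(\<Sum>k<n. \<beta> k x) \<le> n" "0 \<le> (\<Sum>k<n. \<alpha> k x)" "(\<Sum>k<n. \<alpha> k x) \<le> n" for x
      using \<alpha> \<beta> sum_bounded_above[of "{..<n}" "\<lambda>k. \<beta> k x" 1] sum_bounded_above[of "{..<n}" "\<lambda>k. \<alpha> k x" 1]
      by (auto simp: \<gamma>_def intro!: sum_nonneg)
    have \<nu>n: "\<bar>\<nu> x\<bar> \<le> n" for x
      unfolding \<nu>_def using sum01[of x] by linarith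
    have \<nu>G: "\<nu> x = 0" if "x \<notin> G c" for x
      using that \<alpha> \<beta> by (simp add: \<nu>_def \<gamma>_def G'_def)
    have \<nu>G': "0 \<le> \<nu> x" if "x \<notin> G' c" for x
    proof -
      have "(\<Sum>k<n. \<alpha> k x) = 0"
        using that \<alpha> by (intro sum.neutral) (auto simp: \<gamma>_def)
      then show ?thesis
        using sum01(1)[of x] by (simp add: \<nu>_def)
    qed
    have int_\<nu>: "(\<integral>x. \<nu> x * \<phi> x \<partial>M) =
        (\<integral>w. indicator (B c) w * ((\<Sum>k<n. \<phi> (T k w)) - (\<Sum>k<n. \<phi> (U k w))) \<partial>W)"
      if \<phi>[measurable]: "\<phi> \<in> borel_measurable M" and bd: "\<And>x. \<bar>\<phi> x\<bar> \<le> K" for \<phi> K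
    proof -
      have K0: "0 \<le> K"
        using bd[of undefined] by linarith
      have iM: "integrable M (\<lambda>x. \<gamma> x * \<phi> x)" if "\<gamma> \<in> borel_measurable M" "\<And>x. 0 \<le> \<gamma> x \<and> \<gamma> x \<le> 1" for \<gamma>
      proof (rule M.integrable_const_bound[of _ K])
        show "AE x in M. norm (\<gamma> x * \<phi> x) \<le> K"
        proof (rule AE_I2)
          fix x
          have "\<bar>\<gamma> x\<bar> * \<bar>\<phi> x\<bar> \<le> 1 * K"
            using that(2)[of x] bd[of x] by (intro mult_mono) auto
          then show "norm (\<gamma> x * \<phi> x) \<le> K"
            by (simp add: abs_mult)
        qed
      qed (use that in measurable)
      have iW: "integrable W (\<lambda>w. indicator (B c) w * \<phi> (V w))" if "V \<in> measurable W M" for V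
      proof (rule W.integrable_const_bound[of _ K])
        show "AE w in W. norm (indicator (B c) w * \<phi> (V w)) \<le> K"
          using bd K0 by (intro AE_I2) (auto simp: indicator_def)
      qed (use that in measurable)
      have i\<beta>: "integrable M (\<lambda>x. \<beta> k x * \<phi> x)" and i\<alpha>: "integrable M (\<lambda>x. \<alpha> k x * \<phi> x)" if "k < n" for k
        using \<alpha>[OF that] \<beta>[OF that] by (auto simp: \<gamma>_def intro!: iM)
      have iT: "integrable W (\<lambda>w. indicator (B c) w * \<phi> (T k w))"
        and iU: "integrable W (\<lambda>w. indicator (B c) w * \<phi> (U k w))" if "k < n" for k
        using T(1)[OF that] U(1)[OF that] by (auto intro!: iW)
      have "(\<integral>x. \<nu> x * \<phi> x \<partial>M) = (\<integral>x. (\<Sum>k<n. \<beta> k x * \<phi> x) - (\<Sum>k<n. \<alpha> k x * \<phi> x) \<partial>M)"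
        by (simp add: \<nu>_def left_diff_distrib sum_distrib_right)
      also have "\<dots> = (\<Sum>k<n. \<integral>x. \<beta> k x * \<phi> x \<partial>M) - (\<Sum>k<n. \<integral>x. \<alpha> k x * \<phi> x \<partial>M)"
        by (rule integral_sum_diff_sum) (use i\<alpha> i\<beta> in auto)
      also have "\<dots> = (\<Sum>k<n. \<integral>w. indicator (B c) w * \<phi> (T k w) \<partial>W) - (\<Sum>k<n. \<integral>w. indicator (B c) w * \<phi> (U k w) \<partial>W)"
        using \<alpha> \<beta> by (simp add: \<gamma>_def)
      also have "\<dots> = (\<integral>w. (\<Sum>k<n. indicator (B c) w * \<phi> (T k w)) - (\<Sum>k<n. indicator (B c) w * \<phi> (U k w)) \<partial>W)"
        by (rule integral_sum_diff_sum[symmetric]) (use iT iU in auto)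
      finally show ?thesis
        by (simp add: right_diff_distrib sum_distrib_left)
    qed
    (* since r is at least c on G c, this size of the step bounds the change of p by c / 2 *)
    define \<epsilon> where "\<epsilon> = c * c / (2 * (real n + 1))"
    have \<epsilon>: "0 < \<epsilon>"
      using c by (simp add: \<epsilon>_def add_nonneg_pos)
    define u where "u x = (if x \<in> G c then \<epsilon> * \<nu> x / r x else 0)" for x
    have u[measurable]: "u \<in> borel_measurable M"
      unfolding u_def by measurable
    have u_bd: "\<bar>u x\<bar> \<le> c / 2" for x
    proof (cases "x \<in> G c")
      case True
      then have rx: "c \<le> r x"
        by (simp add: G_def)
      have "\<bar>u x\<bar> = \<epsilon> * \<bar>\<nu> x\<bar> / r x"
        using True rx c \<epsilon> by (simp add: u_def abs_mult)
      also have "\<dots> \<le> \<epsilon> * (real n + 1) / c"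
        using \<nu>n[of x] rx c \<epsilon> by (intro frac_le mult_left_mono) auto
      also have "\<dots> = c / 2"
      proof -
        have "c * c / (2 * a) * a / c = c / 2" if "0 < a" for a
          using c that by (simp add: field_simps)
        from this[of "real n + 1"] show ?thesis
          unfolding \<epsilon>_def by (simp only: add_nonneg_pos of_nat_0_le_iff zero_less_one)
      qed
      finally show ?thesis .
    qed (use c in \<open>simp add: u_def\<close>)
    have u_neg: "x \<in> G' c" if "u x < 0" for x
    proof (rule ccontr)
      assume "x \<notin> G' c"
      then have "0 \<le> u x"
        using \<nu>G'[of x] c \<epsilon> by (auto simp: u_def G_def)
      with that show False
        by simp
    qed
    have q0: "0 \<le> p x + u x" for x
    proof (cases "u x < 0")
      case True
      then have "c \<le> p x"
        using u_neg[of x] by (simp add: G'_def)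
      then show ?thesis
        using u_bd[of x] c by linarith
    qed (use p0[of x] in auto)
    have ur: "u x * r x = \<epsilon> * \<nu> x" for x
      using \<nu>G[of x] c by (auto simp: u_def G_def)
    define b where "b = max (1 / c) (c / 2)"
    define K where "K = 1 / c + c / 2"
    (* the slope of x ln x at the perturbed density; the truncation at c / 2 makes it bounded, and
       is inactive where mass is removed *)
    define \<Phi> where "\<Phi> x = indicator (G c) x * (1 + ln (max (p x + u x) (c / 2)))" for x
    have \<Phi>m[measurable]: "\<Phi> \<in> borel_measurable M"
      unfolding \<Phi>_def by measurable
    have K0: "0 < K" "c / 2 \<le> K"
      using c by (auto simp: K_def add_pos_pos)
    have qK: "p x + u x \<le> K" "p x \<le> K" if "x \<in> G c" for x
      using that u_bd[of x] c by (auto simp: G_def K_def abs_le_iff add_increasing2)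
    define L where "L = 1 + \<bar>ln (c / 2)\<bar> + \<bar>ln K\<bar>"
    have \<Phi>L: "\<bar>\<Phi> x\<bar> \<le> L" for x
    proof (cases "x \<in> G c")
      case True
      have "c / 2 \<le> max (p x + u x) (c / 2)" "max (p x + u x) (c / 2) \<le> K"
        using qK[OF True] K0 by auto
      then have "ln (c / 2) \<le> ln (max (p x + u x) (c / 2))" "ln (max (p x + u x) (c / 2)) \<le> ln K"
        using c K0 by auto
      then show ?thesis
        using True unfolding \<Phi>_def L_def by simp
    qed (simp add: \<Phi>_def L_def)
    have gain: "r x * ((p x + u x) * ln (p x + u x) - p x * ln (p x)) \<le> \<epsilon> * (\<nu> x * \<Phi> x)" for x
    proof (cases "x \<in> G c")
      case True
      let ?q = "p x + u x"
      have "?q * ln ?q - p x * ln (p x) \<le> u x * \<Phi> x"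
      proof (cases "u x = 0")
        case False
        have *: "0 < ?q" "u x * (1 + ln ?q) \<le> u x * \<Phi> x"
        proof -
          have "0 < ?q \<and> u x * ln ?q \<le> u x * ln (max ?q (c / 2))"
          proof (cases "u x < 0")
            case True
            then have "c \<le> p x"
              using u_neg[of x] by (simp add: G'_def)
            then show ?thesis
              using u_bd[of x] c by (auto simp: max_def abs_le_iff)
          next
            case False
            then have "0 < ?q"
              using p0[of x] \<open>u x \<noteq> 0\<close> by linarith
            then show ?thesis
              using False by (auto intro!: mult_left_mono)
          qed
          then show "0 < ?q" "u x * (1 + ln ?q) \<le> u x * \<Phi> x"
            using True by (auto simp: \<Phi>_def distrib_left)
        qed
        have "p x * ln ?q \<le> p x * ln (p x) + ?q - p x"
          by (rule gibbs_le) (use *(1) p0[of x] in auto)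
        then have "?q * ln ?q - p x * ln (p x) \<le> u x * (1 + ln ?q)"
          by (simp add: algebra_simps)
        then show ?thesis
          using *(2) by linarith
      qed simp
      then have "r x * (?q * ln ?q - p x * ln (p x)) \<le> r x * (u x * \<Phi> x)"
        using True c by (intro mult_left_mono) (auto simp: G_def)
      also have "\<dots> = (u x * r x) * \<Phi> x"
        by (simp add: ac_simps)
      finally show ?thesis
        unfolding ur by (simp only: mult.assoc)
    qed (simp add: u_def \<Phi>_def)
    have "integrable M (\<lambda>x. r x * ((p x + u x) * ln (p x + u x) - p x * ln (p x)))"
    proof (rule M.integrable_const_bound[of _ "1 / c * ((1 + K * K) + (1 + K * K))"])
      show "AE x in M. norm (r x * ((p x + u x) * ln (p x + u x) - p x * ln (p x))) \<le> 1 / c * ((1 + K * K) + (1 + K * K))"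
      proof (rule AE_I2)
        fix x
        show "norm (r x * ((p x + u x) * ln (p x + u x) - p x * ln (p x))) \<le> 1 / c * ((1 + K * K) + (1 + K * K))"
        proof (cases "x \<in> G c")
          case True
          have "\<bar>(p x + u x) * ln (p x + u x) - p x * ln (p x)\<bar> \<le> (1 + K * K) + (1 + K * K)"
            using abs_mult_ln_le[of "p x + u x" K] abs_mult_ln_le[of "p x" K] qK[OF True] q0[of x] p0[of x]
            by linarith
          moreover have "\<bar>r x\<bar> \<le> 1 / c"
            using True c by (auto simp: G_def)
          ultimately show ?thesis
            unfolding real_norm_def abs_mult using c by (intro mult_mono) auto
        qed (use c in \<open>simp add: u_def\<close>)
      qed
    qed measurable
    moreover have "integrable M (\<lambda>x. \<nu> x * \<Phi> x)"
    proof (rule M.integrable_const_bound[of _ "real n * L"])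
      show "AE x in M. norm (\<nu> x * \<Phi> x) \<le> real n * L"
        using \<nu>n \<Phi>L by (intro AE_I2) (auto simp: abs_mult intro!: mult_mono)
    qed measurable
    ultimately have le: "(\<integral>x. r x * ((p x + u x) * ln (p x + u x) - p x * ln (p x)) \<partial>M) \<le> (\<integral>x. \<epsilon> * (\<nu> x * \<Phi> x) \<partial>M)"
      using gain by (intro integral_mono) auto
    have "0 \<le> (\<integral>x. r x * ((p x + u x) * ln (p x + u x) - p x * ln (p x)) \<partial>M)"
    proof (rule opt[of "G c" u b])
      show "0 \<le> r x \<and> r x \<le> b \<and> p x \<le> b" if "x \<in> G c" for x
        using that c by (auto simp: G_def b_def)
      show "\<bar>u x\<bar> \<le> b" for x
        using u_bd[of x] by (simp add: b_def)
      fix A assume A: "A \<in> \<A>"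
      then have [measurable]: "A \<in> sets M"
        using \<A> by auto
      have "(\<integral>x. indicator A x * (u x * r x) \<partial>M) = (\<integral>x. \<epsilon> * (\<nu> x * indicator A x) \<partial>M)"
        unfolding ur by (simp add: ac_simps)
      also have "\<dots> = \<epsilon> * (\<integral>x. \<nu> x * indicator A x \<partial>M)"
        by simp
      also have "(\<integral>x. \<nu> x * indicator A x \<partial>M) =
          (\<integral>w. indicator (B c) w * ((\<Sum>k<n. indicator A (T k w)) - (\<Sum>k<n. indicator A (U k w))) \<partial>W)"
        by (rule int_\<nu>[of _ 1]) (auto simp: indicator_def)
      also have "\<dots> = (\<integral>w. 0 \<partial>W)"
        using swap[OF A] by (intro Bochner_Integration.integral_cong) auto
      finally show "(\<integral>x. indicator A x * (u x * r x) \<partial>M) = 0"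
        by simp
    qed (use q0 in \<open>auto simp: u_def\<close>)
    also note le
    also have "(\<integral>x. \<epsilon> * (\<nu> x * \<Phi> x) \<partial>M) = \<epsilon> * (\<integral>x. \<nu> x * \<Phi> x \<partial>M)"
      by simp
    also have "(\<integral>x. \<nu> x * \<Phi> x \<partial>M) =
        (\<integral>w. indicator (B c) w * ((\<Sum>k<n. \<Phi> (T k w)) - (\<Sum>k<n. \<Phi> (U k w))) \<partial>W)"
      by (rule int_\<nu>[OF \<Phi>m \<Phi>L])
    finally have nonneg: "0 \<le> (\<integral>w. indicator (B c) w * ((\<Sum>k<n. \<Phi> (T k w)) - (\<Sum>k<n. \<Phi> (U k w))) \<partial>W)"
      using \<epsilon> by (simp add: zero_le_mult_iff)
    (* positive on B c by the margin in its definition, but its mean is not positive *)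
    define D where "D w = indicator (B c) w * ((\<Sum>k<n. \<Phi> (U k w)) - (\<Sum>k<n. \<Phi> (T k w)))" for w
    have D_pos: "0 < D w" if w: "w \<in> B c" for w
    proof -
      have 1: "0 < p (T k w) + c / 2 \<and> \<Phi> (T k w) \<le> 1 + ln (p (T k w) + c / 2)" if k: "k < n" for k
      proof -
        have "T k w \<in> G c"
          using w k by (simp add: B_def)
        moreover have "p (T k w) + u (T k w) \<le> p (T k w) + c / 2"
          using u_bd[of "T k w"] by linarith
        ultimately show ?thesis
          using p0[of "T k w"] c by (auto simp: \<Phi>_def)
      qed
      have 2: "0 < p (U k w) - c / 2 \<and> 1 + ln (p (U k w) - c / 2) \<le> \<Phi> (U k w)" if k: "k < n" for k
      proof -
        have "U k w \<in> G' c"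
          using w k by (simp add: B_def)
        then have *: "U k w \<in> G c" "c \<le> p (U k w)"
          by (auto simp: G'_def)
        moreover have "p (U k w) - c / 2 \<le> p (U k w) + u (U k w)"
          using u_bd[of "U k w"] by linarith
        moreover have "0 < p (U k w) - c / 2"
          using * c by linarith
        ultimately show ?thesis
          by (auto simp: \<Phi>_def)
      qed
      have "(\<Sum>k<n. \<Phi> (T k w)) \<le> (\<Sum>k<n. 1 + ln (p (T k w) + c / 2))"
        using 1 by (intro sum_mono) auto
      also have "\<dots> = n + ln (\<Prod>k<n. p (T k w) + c / 2)"
        using 1 by (subst ln_prod) (force simp: sum.distrib)+
      also have "\<dots> < n + ln (\<Prod>k<n. p (U k w) - c / 2)"
      proof -
        have "0 < (\<Prod>k<n. p (T k w) + c / 2)"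
          by (rule prod_pos) (use 1 in auto)
        moreover have "(\<Prod>k<n. p (T k w) + c / 2) < (\<Prod>k<n. p (U k w) - c / 2)"
          using w by (simp add: B_def)
        ultimately show ?thesis
          by simp
      qed
      also have "\<dots> = (\<Sum>k<n. 1 + ln (p (U k w) - c / 2))"
        using 2 by (subst ln_prod) (force simp: sum.distrib)+
      also have "\<dots> \<le> (\<Sum>k<n. \<Phi> (U k w))"
        using 2 by (intro sum_mono) auto
      finally show ?thesis
        using w by (simp add: D_def)
    qed
    have D0: "0 \<le> D w" for w
      using D_pos[of w] by (cases "w \<in> B c") (auto simp: D_def)
    have "integrable W D"
    proof (rule W.integrable_const_bound[of _ "real n * L + real n * L"])
      show "AE w in W. norm (D w) \<le> real n * L + real n * L"
      proof (rule AE_I2)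
        fix w
        have "\<bar>\<Sum>k<n. \<Phi> (V k w)\<bar> \<le> real n * L" for V :: "nat \<Rightarrow> 'w \<Rightarrow> 'z"
          using sum_bounded_above[of "{..<n}" "\<lambda>k. \<bar>\<Phi> (V k w)\<bar>" L] \<Phi>L
          by (intro order.trans[OF sum_abs]) auto
        from this[of U] this[of T]
        have "\<bar>(\<Sum>k<n. \<Phi> (U k w)) - (\<Sum>k<n. \<Phi> (T k w))\<bar> \<le> real n * L + real n * L"
          by linarith
        moreover have "norm (D w) \<le> \<bar>(\<Sum>k<n. \<Phi> (U k w)) - (\<Sum>k<n. \<Phi> (T k w))\<bar>"
          by (simp add: D_def indicator_def)
        ultimately show "norm (D w) \<le> real n * L + real n * L"
          by (rule order.trans[rotated])
      qed
      show "D \<in> borel_measurable W"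
        unfolding D_def using Tm[OF \<Phi>m] Um[OF \<Phi>m]
        by (intro borel_measurable_times borel_measurable_diff borel_measurable_sum) auto
    qed
    moreover have "(\<integral>w. D w \<partial>W) = 0"
    proof -
      have "(\<integral>w. D w \<partial>W) = (\<integral>w. - (indicator (B c) w * ((\<Sum>k<n. \<Phi> (T k w)) - (\<Sum>k<n. \<Phi> (U k w)))) \<partial>W)"
        by (intro Bochner_Integration.integral_cong) (auto simp: D_def algebra_simps)
      also have "\<dots> \<le> 0"
        using nonneg by simp
      finally have "(\<integral>w. D w \<partial>W) \<le> 0" .
      moreover have "0 \<le> (\<integral>w. D w \<partial>W)"
        using D0 by simp
      ultimately show ?thesis
        by linarith
    qed
    ultimately have "AE w in W. D w = 0"
      using D0 by (subst (asm) integral_nonneg_eq_0_iff_AE) auto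
    then show ?thesis
      using D_pos by (auto elim!: eventually_mono dest!: D_pos)
  qed
  have "AE w in W. \<forall>j. w \<notin> B (1 / (real j + 1))"
    unfolding AE_all_countable by (auto intro!: B_null)
  moreover have "AE w in W. \<forall>k\<in>{..<n}. 0 < r (T k w)"
  proof (rule AE_finite_allI)
    fix k assume "k \<in> {..<n}"
    then show "AE w in W. 0 < r (T k w)"
      using r0 T[of k] by (subst (asm) T(2)[of k, symmetric]) (auto simp: AE_distr_iff)
  qed simp
  moreover have "AE w in W. \<forall>k\<in>{..<n}. 0 < r (U k w)"
  proof (rule AE_finite_allI)
    fix k assume "k \<in> {..<n}"
    then show "AE w in W. 0 < r (U k w)"
      using r0 U[of k] by (subst (asm) U(2)[of k, symmetric]) (auto simp: AE_distr_iff)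
  qed simp
  ultimately show ?thesis
    using AE_space
  proof eventually_elim
    case (elim w)
    show ?case
    proof (rule ccontr)
      assume "\<not> ?case"
      then have less: "(\<Prod>k<n. p (T k w)) < (\<Prod>k<n. p (U k w))"
        by simp
      then have pU: "0 < p (U k w)" if "k < n" for k
        using that p0 prod_nonneg[of "{..<n}" "\<lambda>k. p (T k w)"] prod_zero[of "{..<n}" "\<lambda>k. p (U k w)"]
        by (metis finite_lessThan lessThan_iff linorder_not_less order_le_less)
      let ?c = "\<lambda>j. 1 / (real j + 1)"
      have c0: "?c \<longlonglongrightarrow> 0"
        using LIMSEQ_inverse_real_of_nat by (simp add: inverse_eq_divide add.commute)
      have small: "\<forall>\<^sub>F j in sequentially. ?c j \<le> a" if "0 < a" for a
        using order_tendstoD(2)[OF c0 that] by (auto elim!: eventually_mono)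
      have large: "\<forall>\<^sub>F j in sequentially. a \<le> 1 / ?c j" for a
        using eventually_ge_at_top[of "nat \<lceil>a\<rceil>"]
      proof eventually_elim
        case (elim j)
        then have "a \<le> real j"
          by linarith
        then show ?case
          by simp
      qed
      have "(\<lambda>j. (\<Prod>k<n. p (U k w) - ?c j / 2) - (\<Prod>k<n. p (T k w) + ?c j / 2)) \<longlonglongrightarrow>
          (\<Prod>k<n. p (U k w) - 0 / 2) - (\<Prod>k<n. p (T k w) + 0 / 2)"
        by (intro tendsto_intros c0) auto
      then have "\<forall>\<^sub>F j in sequentially. 0 < (\<Prod>k<n. p (U k w) - ?c j / 2) - (\<Prod>k<n. p (T k w) + ?c j / 2)"
        using less by (intro order_tendstoD) auto
      moreover have "\<forall>\<^sub>F j in sequentially. \<forall>k\<in>{..<n}. ?c j \<le> r (T k w) \<and> ?c j \<le> r (U k w) \<and> ?c j \<le> p (U k w) \<and>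
          r (T k w) \<le> 1 / ?c j \<and> r (U k w) \<le> 1 / ?c j \<and> p (T k w) \<le> 1 / ?c j \<and> p (U k w) \<le> 1 / ?c j"
        using elim pU by (intro eventually_ball_finite ballI eventually_conj small large) auto
      ultimately have "\<forall>\<^sub>F j in sequentially. w \<in> B (?c j)"
      proof eventually_elim
        case (elim j)
        have "T k w \<in> space M" "U k w \<in> space M" if "k < n" for k
          using T(1)[OF that] U(1)[OF that] \<open>w \<in> space W\<close> by (auto dest: measurable_space)
        then show ?case
          using elim \<open>w \<in> space W\<close> by (auto simp: B_def G_def G'_def)
      qed
      then show False
        using elim(1) by (auto simp: eventually_sequentially)
    qed
  qed
qed

text \<open>The components of a pair of independent copies are all independent.\<close>

lemma distr_pair_fun_upd:
  assumes I: "finite I" "j \<in> I" and m: "\<And>i. prob_space (m i)"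
  shows "(\<lambda>(x, z). x(j := z j)) \<in> measurable (Pi\<^sub>M I m \<Otimes>\<^sub>M Pi\<^sub>M I m) (Pi\<^sub>M I m)"
    and "distr (Pi\<^sub>M I m \<Otimes>\<^sub>M Pi\<^sub>M I m) (Pi\<^sub>M I m) (\<lambda>(x, z). x(j := z j)) = Pi\<^sub>M I m"
proof -
  interpret m: product_prob_space m
    by (intro product_prob_spaceI m)
  have P: "prob_space (Pi\<^sub>M I m)"
    by (rule prob_space_PiM) (rule m)
  let ?T = "\<lambda>(x, z). x(j := z j)"
  have "(\<lambda>w. (\<lambda>i\<in>I. (if i = j then snd w j else fst w i))) \<in> measurable (Pi\<^sub>M I m \<Otimes>\<^sub>M Pi\<^sub>M I m) (Pi\<^sub>M I m)"
  proof (intro measurable_restrict)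
    fix i assume i: "i \<in> I"
    show "(\<lambda>w. if i = j then snd w j else fst w i) \<in> measurable (Pi\<^sub>M I m \<Otimes>\<^sub>M Pi\<^sub>M I m) (m i)"
      using i I by (cases "i = j")
        (auto intro: measurable_compose[OF measurable_snd measurable_component_singleton]
          measurable_compose[OF measurable_fst measurable_component_singleton])
  qed
  moreover have "(\<lambda>i\<in>I. (if i = j then snd w j else fst w i)) = ?T w"
    if w_in: "w \<in> space (Pi\<^sub>M I m \<Otimes>\<^sub>M Pi\<^sub>M I m)" for w
  proof -
    obtain x z where w: "w = (x, z)" "x \<in> (\<Pi>\<^sub>E i\<in>I. space (m i))"
      using w_in by (auto simp: space_pair_measure space_PiM)
    show ?thesis
    proof
      fix i
      show "(\<lambda>i\<in>I. if i = j then snd w j else fst w i) i = ?T w i"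
        using PiE_arb[OF w(2), of i] I(2) by (cases "i \<in> I") (auto simp: w(1))
    qed
  qed
  ultimately show T: "?T \<in> measurable (Pi\<^sub>M I m \<Otimes>\<^sub>M Pi\<^sub>M I m) (Pi\<^sub>M I m)"
    by (rule measurable_cong[THEN iffD1, rotated])
  show "distr (Pi\<^sub>M I m \<Otimes>\<^sub>M Pi\<^sub>M I m) (Pi\<^sub>M I m) ?T = Pi\<^sub>M I m"
  proof (rule m.PiM_eqI[OF I(1)])
    fix A assume A: "\<And>i. i \<in> I \<Longrightarrow> A i \<in> sets (m i)"
    define A1 where "A1 i = (if i = j then space (m j) else A i)" for i
    define A2 where "A2 i = (if i = j then A j else space (m i))" for i
    have sets: "A1 i \<in> sets (m i)" "A2 i \<in> sets (m i)" if "i \<in> I" for i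
      using A[OF that] by (auto simp: A1_def A2_def)
    have "A i \<subseteq> space (m i)" if "i \<in> I" for i
      using sets.sets_into_space[OF A[OF that]] .
    then have eq: "?T -` Pi\<^sub>E I A \<inter> space (Pi\<^sub>M I m \<Otimes>\<^sub>M Pi\<^sub>M I m) = Pi\<^sub>E I A1 \<times> Pi\<^sub>E I A2"
    proof (intro set_eqI iffI)
      fix w assume "w \<in> ?T -` Pi\<^sub>E I A \<inter> space (Pi\<^sub>M I m \<Otimes>\<^sub>M Pi\<^sub>M I m)"
      then obtain x z where w: "w = (x, z)" "x(j := z j) \<in> Pi\<^sub>E I A"
          "x \<in> (\<Pi>\<^sub>E i\<in>I. space (m i))" "z \<in> (\<Pi>\<^sub>E i\<in>I. space (m i))"
        by (auto simp: space_pair_measure space_PiM)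
      have "x i \<in> A i" if "i \<in> I" "i \<noteq> j" for i
        using PiE_mem[OF w(2) that(1)] that(2) by simp
      then have "x \<in> Pi\<^sub>E I A1"
        using w(3) by (auto simp: PiE_iff A1_def)
      moreover have "z \<in> Pi\<^sub>E I A2"
        using w(4) PiE_mem[OF w(2) I(2)] by (auto simp: PiE_iff A2_def)
      ultimately show "w \<in> Pi\<^sub>E I A1 \<times> Pi\<^sub>E I A2"
        by (simp add: w(1))
    next
      fix w assume "w \<in> Pi\<^sub>E I A1 \<times> Pi\<^sub>E I A2"
      then obtain x z where w: "w = (x, z)" "x \<in> Pi\<^sub>E I A1" "z \<in> Pi\<^sub>E I A2"
        by auto
      have "x i \<in> space (m i)" "z i \<in> space (m i)" if "i \<in> I" for i
        using PiE_mem[OF w(2) that] PiE_mem[OF w(3) that] sets[OF that] sets.sets_into_space by blast+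
      moreover have "x(j := z j) \<in> Pi\<^sub>E I A"
      proof (rule PiE_I)
        show "(x(j := z j)) i \<in> A i" if "i \<in> I" for i
          using PiE_mem[OF w(2) that] PiE_mem[OF w(3) that] by (auto simp: A1_def A2_def split: if_splits)
        show "(x(j := z j)) i = undefined" if "i \<notin> I" for i
          using PiE_arb[OF w(2) that] that I(2) by auto
      qed
      ultimately show "w \<in> ?T -` Pi\<^sub>E I A \<inter> space (Pi\<^sub>M I m \<Otimes>\<^sub>M Pi\<^sub>M I m)"
        using w by (auto simp: space_pair_measure space_PiM PiE_iff)
    qed
    have "emeasure (distr (Pi\<^sub>M I m \<Otimes>\<^sub>M Pi\<^sub>M I m) (Pi\<^sub>M I m) ?T) (Pi\<^sub>E I A) =
        emeasure (Pi\<^sub>M I m \<Otimes>\<^sub>M Pi\<^sub>M I m) (Pi\<^sub>E I A1 \<times> Pi\<^sub>E I A2)"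
      using I A by (subst emeasure_distr[OF T]) (auto simp: eq intro!: sets_PiM_I_finite)
    also have "\<dots> = (\<Prod>i\<in>I. emeasure (m i) (A1 i)) * (\<Prod>i\<in>I. emeasure (m i) (A2 i))"
      using I sets by (subst sigma_finite_measure.emeasure_pair_measure_Times[OF prob_space_imp_sigma_finite[OF P]]) (auto intro!: sets_PiM_I_finite simp: m.emeasure_PiM)
    also have "\<dots> = (\<Prod>i\<in>I. emeasure (m i) (A1 i) * emeasure (m i) (A2 i))"
      by (simp add: prod.distrib)
    also have "\<dots> = (\<Prod>i\<in>I. emeasure (m i) (A i))"
      using m by (intro prod.cong) (auto simp: A1_def A2_def prob_space.emeasure_space_1)
    finally show "emeasure (distr (Pi\<^sub>M I m \<Otimes>\<^sub>M Pi\<^sub>M I m) (Pi\<^sub>M I m) ?T) (Pi\<^sub>E I A) = (\<Prod>i\<in>I. emeasure (m i) (A i))" .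
  qed simp
qed

text \<open>Take two independent points \<open>x\<close>, \<open>z\<close> of the product space with \<open>n\<close> coordinates. The points
\<open>x(j := z j)\<close>, for all \<open>j\<close>, carry in each coordinate \<open>i\<close> the value \<open>z i\<close> once and \<open>x i\<close> the other
\<open>n - 1\<close> times, just as \<open>z\<close> together with \<open>n - 1\<close> copies of \<open>x\<close>. The swap inequality in both
directions yields \<open>p z * p x ^ (n - 1) = \<Prod>j. p (x(j := z j))\<close> almost everywhere. Freezing one \<open>x\<close> with
\<open>p x > 0\<close> exhibits \<open>p z\<close> as a product of functions of single coordinates, zeros included.\<close>

lemma minimizer_product_form:
  fixes p r :: "('i \<Rightarrow> 'e) \<Rightarrow> real"
  assumes I: "finite I" "I \<noteq> {}" and m: "\<And>i. prob_space (m i)"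
  defines "M \<equiv> Pi\<^sub>M I m"
  assumes p[measurable]: "p \<in> borel_measurable M" and p0: "\<And>x. 0 \<le> p x"
    and r[measurable]: "r \<in> borel_measurable M" and r0: "AE x in M. 0 < r x"
    and opt: "\<And>C u b. C \<in> sets M \<Longrightarrow> u \<in> borel_measurable M \<Longrightarrow>
      (\<And>x. x \<in> C \<Longrightarrow> 0 \<le> r x \<and> r x \<le> b \<and> p x \<le> b) \<Longrightarrow> (\<And>x. \<bar>u x\<bar> \<le> b) \<Longrightarrow> (\<And>x. x \<notin> C \<Longrightarrow> u x = 0) \<Longrightarrow>
      (\<And>x. 0 \<le> p x + u x) \<Longrightarrow>
      (\<And>i A. i \<in> I \<Longrightarrow> A \<in> sets (m i) \<Longrightarrow> (\<integral>x. indicator A (x i) * (u x * r x) \<partial>M) = 0) \<Longrightarrow>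
      0 \<le> (\<integral>x. r x * ((p x + u x) * ln (p x + u x) - p x * ln (p x)) \<partial>M)"
    and nz: "\<not> (AE x in M. p x = 0)"
  obtains x where "x \<in> space M" "0 < p x"
    "AE z in M. p z * p x ^ (card I - 1) = (\<Prod>j\<in>I. p (x(j := z j)))"
proof -
  let ?W = "M \<Otimes>\<^sub>M M"
  interpret M: prob_space M
    unfolding M_def by (rule prob_space_PiM) (rule m)
  interpret MM: pair_prob_space M M ..
  define n where "n = card I"
  have n: "0 < n"
    using I by (simp add: n_def card_gt_0_iff)
  obtain e where e: "bij_betw e {..<n} I"
    using ex_bij_betw_nat_finite[OF I(1)] by (auto simp: n_def atLeast0LessThan)
  have eI: "e k \<in> I" if "k < n" for k
    using that e by (auto simp: bij_betw_def)
  define T where "T k w = (fst w)(e k := snd w (e k))" for k and w :: "('i \<Rightarrow> 'e) \<times> ('i \<Rightarrow> 'e)"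
  define U where "U k w = (if k = 0 then snd w else fst w)" for k :: nat and w :: "('i \<Rightarrow> 'e) \<times> ('i \<Rightarrow> 'e)"
  have T: "T k \<in> measurable ?W M" "distr ?W M (T k) = M" if "k < n" for k
    using distr_pair_fun_upd[OF I(1) eI[OF that] m] by (simp_all add: T_def[abs_def] M_def case_prod_beta')
  have "distr ?W M snd = distr (distr ?W ?W (\<lambda>(x, y). (y, x))) M fst"
    by (subst distr_distr) (auto simp: comp_def case_prod_beta')
  also have "\<dots> = M"
    using MM.distr_pair_swap M.distr_pair_fst by simp
  finally have U: "U k \<in> measurable ?W M" "distr ?W M (U k) = M" for k
    using M.distr_pair_fst[of M] by (cases "k = 0"; simp add: U_def[abs_def])+
  define \<A> where "\<A> = {{x \<in> space M. x i \<in> A} | i A. i \<in> I \<and> A \<in> sets (m i)}"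
  have \<A>: "\<A> \<subseteq> sets M"
  proof
    fix B assume "B \<in> \<A>"
    then obtain i A where B: "B = {x \<in> space M. x i \<in> A}" and [measurable]: "i \<in> I" "A \<in> sets (m i)"
      by (auto simp: \<A>_def)
    show "B \<in> sets M"
      unfolding B M_def by measurable
  qed
  have swap: "(\<Sum>k<n. indicator B (T k w)) = (\<Sum>k<n. indicator B (U k w) :: real)"
    if B: "B \<in> \<A>" and w: "w \<in> space ?W" for B w
  proof -
    obtain x z where xz: "w = (x, z)" "x \<in> space M" "z \<in> space M"
      using w by (auto simp: space_pair_measure)
    obtain i A where i: "i \<in> I" "A \<in> sets (m i)" and B_eq: "B = {x \<in> space M. x i \<in> A}"
      using B by (auto simp: \<A>_def)
    have Tw: "T k w \<in> space M" if "k < n" for k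
      using measurable_space[OF T(1)[OF that] w] .
    have "(\<Sum>k<n. indicator B (T k w) :: real) = (\<Sum>k<n. if e k = i then indicator A (z i) else indicator A (x i))"
      using Tw by (intro sum.cong) (auto simp: B_eq T_def xz indicator_def)
    also have "\<dots> = (\<Sum>j\<in>I. if j = i then indicator A (z i) else indicator A (x i))"
      using sum.reindex_bij_betw[OF e, of "\<lambda>j. if j = i then indicator A (z i) else indicator A (x i) :: real"] by simp
    also have "\<dots> = indicator A (z i) + (real n - 1) * indicator A (x i)"
      using I i n by (simp add: sum.remove[OF I(1) i(1)] n_def of_nat_diff)
    also have "\<dots> = (\<Sum>k<n. if k = 0 then indicator A (z i) else indicator A (x i))"
      using n by (simp add: sum.remove[of "{..<n}" 0] of_nat_diff)
    also have "\<dots> = (\<Sum>k<n. indicator B (U k w))"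
      using xz by (intro sum.cong) (auto simp: B_eq U_def indicator_def)
    finally show ?thesis .
  qed
  have opt': "0 \<le> (\<integral>x. r x * ((p x + u x) * ln (p x + u x) - p x * ln (p x)) \<partial>M)"
    if "C \<in> sets M" "u \<in> borel_measurable M" "\<And>x. x \<in> C \<Longrightarrow> 0 \<le> r x \<and> r x \<le> b \<and> p x \<le> b" "\<And>x. \<bar>u x\<bar> \<le> b"
      "\<And>x. x \<notin> C \<Longrightarrow> u x = 0" "\<And>x. 0 \<le> p x + u x"
      and marg: "\<And>B. B \<in> \<A> \<Longrightarrow> (\<integral>x. indicator B x * (u x * r x) \<partial>M) = 0" for C u b
  proof (rule opt[OF that(1-6)])
    fix i A assume "i \<in> I" "A \<in> sets (m i)"
    then have "(\<integral>x. indicator {x \<in> space M. x i \<in> A} x * (u x * r x) \<partial>M) = 0"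
      by (intro marg) (auto simp: \<A>_def)
    also have "(\<integral>x. indicator {x \<in> space M. x i \<in> A} x * (u x * r x) \<partial>M) = (\<integral>x. indicator A (x i) * (u x * r x) \<partial>M)"
      by (intro Bochner_Integration.integral_cong) (auto simp: indicator_def)
    finally show "(\<integral>x. indicator A (x i) * (u x * r x) \<partial>M) = 0" .
  qed
  have "AE w in ?W. (\<Prod>k<n. p (U k w)) \<le> (\<Prod>k<n. p (T k w))"
    by (rule swap_inequality[OF M.prob_space_axioms MM.prob_space_axioms T U p p0 r r0 \<A> swap opt'])
  moreover have "AE w in ?W. (\<Prod>k<n. p (T k w)) \<le> (\<Prod>k<n. p (U k w))"
    by (rule swap_inequality[OF M.prob_space_axioms MM.prob_space_axioms U T p p0 r r0 \<A> swap[symmetric] opt'])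
  ultimately have "AE w in ?W. (\<Prod>k<n. p (U k w)) = (\<Prod>k<n. p (T k w))"
    by eventually_elim simp
  then have "AE x in M. AE z in M. (\<Prod>k<n. p (U k (x, z))) = (\<Prod>k<n. p (T k (x, z)))"
    by (rule MM.AE_pair)
  moreover have "(\<Prod>k<n. p (U k (x, z))) = p z * p x ^ (n - 1)" for x z
    using n by (simp add: prod.remove[of "{..<n}" 0] U_def)
  moreover have "(\<Prod>k<n. p (T k (x, z))) = (\<Prod>j\<in>I. p (x(j := z j)))" for x z
    using prod.reindex_bij_betw[OF e, of "\<lambda>j. p (x(j := z j))"] by (simp add: T_def)
  ultimately have ae: "AE x in M. AE z in M. p z * p x ^ (n - 1) = (\<Prod>j\<in>I. p (x(j := z j)))"
    by simp
  have "\<exists>x\<in>space M. 0 < p x \<and> (AE z in M. p z * p x ^ (n - 1) = (\<Prod>j\<in>I. p (x(j := z j))))"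
  proof (rule ccontr)
    assume none: "\<not> ?thesis"
    have "AE x in M. p x = 0"
      using ae AE_space
    proof eventually_elim
      case (elim x)
      then show ?case
        using none p0[of x] by (auto simp: less_le)
    qed
    with nz show False
      by simp
  qed
  then show ?thesis
    using that by (auto simp: n_def)
qed

section \<open>Null sets of an irreducible reciprocal measure\<close>

lemma null_sets_eqI_AE:
  assumes s: "sets M = sets N" and ae: "\<And>D. D \<in> sets M \<Longrightarrow> (AE x in M. x \<in> D) \<longleftrightarrow> (AE x in N. x \<in> D)"
  shows "null_sets M = null_sets N"
proof -
  have "A \<in> null_sets M \<longleftrightarrow> A \<in> null_sets N" if A: "A \<in> sets M" for A
  proof -
    have "A \<in> null_sets M \<longleftrightarrow> (AE x in M. x \<in> space M - A)"
      using A by (subst AE_iff_null_sets) (auto intro!: AE_cong)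
    also have "\<dots> \<longleftrightarrow> (AE x in N. x \<in> space M - A)"
      using A by (intro ae) auto
    also have "\<dots> \<longleftrightarrow> (AE x in N. x \<in> space N - A)"
      by (simp only: sets_eq_imp_space_eq[OF s])
    also have "\<dots> \<longleftrightarrow> A \<in> null_sets N"
      using A s by (subst AE_iff_null_sets) (auto intro!: AE_cong)
    finally show ?thesis .
  qed
  then show ?thesis
    using s by (auto simp: null_sets_def)
qed

text \<open>Conditional independence transfers equivalence with a product from \<open>Z\<close> to \<open>Y\<close>. If the law of
\<open>(X, Z)\<close> has the null sets of the product of the laws of \<open>X\<close> and \<open>Z\<close>, it has a positive density
\<open>d (x, z)\<close> with respect to that product. As \<open>X\<close> and \<open>Y\<close> are conditionally independent given \<open>Z\<close>, the
law of \<open>(X, Y, Z)\<close> has the same density with respect to the product of the law of \<open>X\<close> and the law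
of \<open>(Y, Z)\<close>. Null sets are expressed by iterated \<open>AE\<close>, which avoids naming the product measures.\<close>

lemma cond_indep_AE_prod:
  fixes X :: "'w \<Rightarrow> 's" and Y :: "'w \<Rightarrow> 't" and Z :: "'w \<Rightarrow> 'k"
  assumes F: "subalgebra M F" and G: "subalgebra M G"
    and Z[measurable]: "Z \<in> measurable M K"
  defines "H \<equiv> vimage_algebra (space M) Z K"
  assumes FH: "subalgebra F H" and GH: "subalgebra G H"
    and ci: "cond_indep M F G H"
    and X: "X \<in> measurable F S" and Y: "Y \<in> measurable G N"
    and sX: "sigma_finite_measure (distr M S X)" and sZ: "sigma_finite_measure (distr M K Z)"
    and prod: "\<And>D. D \<in> sets (S \<Otimes>\<^sub>M K) \<Longrightarrow>
      (AE \<omega> in M. (X \<omega>, Z \<omega>) \<in> D) \<longleftrightarrow> (AE x in distr M S X. AE \<omega> in M. (x, Z \<omega>) \<in> D)"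
    and D: "D \<in> sets (S \<Otimes>\<^sub>M N)"
  shows "(AE \<omega> in M. (X \<omega>, Y \<omega>) \<in> D) \<longleftrightarrow> (AE x in distr M S X. AE \<omega> in M. (x, Y \<omega>) \<in> D)"
proof -
  have XM[measurable]: "X \<in> measurable M S" and YM[measurable]: "Y \<in> measurable M N"
    using measurable_from_subalg[OF F X] measurable_from_subalg[OF G Y] .
  have ZH: "Z \<in> measurable H K"
    unfolding H_def using measurable_space[OF Z] by (intro measurable_vimage_algebra1) auto
  have ZG: "Z \<in> measurable G K"
    by (rule measurable_from_subalg[OF GH ZH])
  have MH: "subalgebra M H"
    using F FH by (auto simp: subalgebra_def)
  let ?\<mu> = "distr M S X" and ?\<zeta> = "distr M K Z"
  interpret \<mu>: sigma_finite_measure ?\<mu> by fact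
  interpret \<zeta>: sigma_finite_measure ?\<zeta> by fact
  interpret \<mu>\<zeta>: pair_sigma_finite ?\<mu> ?\<zeta> ..
  have H: "sigma_finite_subalgebra M H"
    by (rule sigma_finite_subalgebraI_distr[OF MH ZH sZ])
  interpret H: sigma_finite_subalgebra M H by fact
  let ?\<kappa> = "distr M (S \<Otimes>\<^sub>M K) (\<lambda>\<omega>. (X \<omega>, Z \<omega>))"
  let ?\<rho> = "?\<mu> \<Otimes>\<^sub>M ?\<zeta>"
  have sets_\<rho>[measurable_cong]: "sets ?\<rho> = sets (S \<Otimes>\<^sub>M K)"
    by (intro sets_pair_measure_cong) auto
  have AE_\<rho>: "(AE y in ?\<rho>. y \<in> D) \<longleftrightarrow> (AE y in ?\<kappa>. y \<in> D)" if D[measurable]: "D \<in> sets (S \<Otimes>\<^sub>M K)" for D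
  proof -
    have "(AE y in ?\<rho>. y \<in> D) \<longleftrightarrow> (AE x in ?\<mu>. AE z in ?\<zeta>. (x, z) \<in> D)"
    proof -
      have "{y \<in> space ?\<rho>. (fst y, snd y) \<in> D} \<in> sets ?\<rho>"
        by measurable
      from \<mu>\<zeta>.AE_pair_iff[of "\<lambda>x z. (x, z) \<in> D", OF this] show ?thesis
        by simp
    qed
    also have "\<dots> \<longleftrightarrow> (AE x in ?\<mu>. AE \<omega> in M. (x, Z \<omega>) \<in> D)"
      by (intro AE_cong) (simp add: AE_distr_iff)
    also have "\<dots> \<longleftrightarrow> (AE \<omega> in M. (X \<omega>, Z \<omega>) \<in> D)"
      by (rule prod[OF D, symmetric])
    also have "\<dots> \<longleftrightarrow> (AE y in ?\<kappa>. y \<in> D)"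
      by (simp add: AE_distr_iff)
    finally show ?thesis .
  qed
  have null: "null_sets ?\<rho> = null_sets ?\<kappa>"
    by (rule null_sets_eqI_AE) (auto simp: sets_\<rho> AE_\<rho>)
  have "sigma_finite_measure ?\<kappa>"
  proof (rule sigma_finite_measure_distr)
    show "sigma_finite_measure (distr ?\<kappa> K snd)"
      using sZ by (simp add: distr_distr comp_def)
  qed simp
  then interpret \<kappa>: sigma_finite_measure ?\<kappa> .
  define d where "d = RN_deriv ?\<rho> ?\<kappa>"
  have d[measurable]: "d \<in> borel_measurable (S \<Otimes>\<^sub>M K)" and \<kappa>_eq: "density ?\<rho> d = ?\<kappa>"
  proof -
    show "d \<in> borel_measurable (S \<Otimes>\<^sub>M K)"
      unfolding d_def using borel_measurable_RN_deriv[of ?\<rho> ?\<kappa>] measurable_cong_sets[OF sets_\<rho> refl] by blast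
    show "density ?\<rho> d = ?\<kappa>"
      unfolding d_def using null by (intro \<mu>\<zeta>.P.density_RN_deriv) (auto simp: absolutely_continuous_def sets_\<rho>)
  qed
  have d_pos: "AE y in ?\<rho>. d y > 0"
  proof -
    have "AE y in ?\<kappa>. y \<in> {y \<in> space (S \<Otimes>\<^sub>M K). d y > 0}"
      unfolding \<kappa>_eq[symmetric] by (subst AE_density) (auto simp: space_pair_measure)
    then have "AE y in ?\<rho>. y \<in> {y \<in> space (S \<Otimes>\<^sub>M K). d y > 0}"
      by (subst AE_\<rho>) auto
    then show ?thesis
      by (auto elim!: eventually_mono)
  qed
  (* the conditional probability of X in B given Z = z *)
  define \<kappa> where "\<kappa> B z = (\<integral>\<^sup>+x. indicator B x * d (x, z) \<partial>?\<mu>)" for B z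
  have \<kappa>m: "\<kappa> B \<in> borel_measurable K" if [measurable]: "B \<in> sets S" for B
  proof -
    have "(\<lambda>(z, x). indicator B x * d (x, z)) \<in> borel_measurable (K \<Otimes>\<^sub>M ?\<mu>)"
      by measurable
    from \<mu>.borel_measurable_nn_integral_fst[OF this] show ?thesis
      by (simp add: \<kappa>_def[abs_def])
  qed
  have cond: "AE \<omega> in M. \<kappa> B (Z \<omega>) = nn_cond_exp M H (indicator (X -` B \<inter> space M)) \<omega>"
    if B[measurable]: "B \<in> sets S" for B
  proof (rule H.nn_cond_exp_charact)
    note \<kappa>m[OF B, measurable]
    fix A assume "A \<in> sets H"
    then obtain A' where A': "A' \<in> sets K" "A = Z -` A' \<inter> space M"
      using measurable_space[OF Z] unfolding H_def by (subst (asm) sets_vimage_algebra2) auto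
    note A'(1)[measurable]
    have "(\<integral>\<^sup>+\<omega>\<in>A. \<kappa> B (Z \<omega>) \<partial>M) = (\<integral>\<^sup>+z. \<kappa> B z * indicator A' z \<partial>?\<zeta>)"
      by (subst nn_integral_distr) (auto intro!: nn_integral_cong simp: A' indicator_def)
    also have "\<dots> = (\<integral>\<^sup>+z. \<integral>\<^sup>+x. indicator B x * d (x, z) * indicator A' z \<partial>?\<mu> \<partial>?\<zeta>)"
      unfolding \<kappa>_def by (intro nn_integral_cong) (subst nn_integral_multc, auto)
    also have "\<dots> = (\<integral>\<^sup>+y. indicator B (fst y) * d y * indicator A' (snd y) \<partial>?\<rho>)"
      by (subst \<mu>\<zeta>.nn_integral_snd[symmetric]) (auto simp: case_prod_beta')
    also have "\<dots> = (\<integral>\<^sup>+y. d y * (indicator B (fst y) * indicator A' (snd y)) \<partial>?\<rho>)"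
      by (simp add: ac_simps)
    also have "\<dots> = (\<integral>\<^sup>+y. indicator B (fst y) * indicator A' (snd y) \<partial>?\<kappa>)"
      unfolding \<kappa>_eq[symmetric] by (rule nn_integral_density[symmetric]) measurable
    also have "\<dots> = (\<integral>\<^sup>+\<omega>\<in>A. indicator (X -` B \<inter> space M) \<omega> \<partial>M)"
      by (subst nn_integral_distr) (auto intro!: nn_integral_cong simp: A' indicator_def)
    finally show "(\<integral>\<^sup>+\<omega>\<in>A. indicator (X -` B \<inter> space M) \<omega> \<partial>M) = (\<integral>\<^sup>+\<omega>\<in>A. \<kappa> B (Z \<omega>) \<partial>M)" ..
  qed (use measurable_compose[OF ZH \<kappa>m[OF B]] in auto)
  define N' where "N' = N \<Otimes>\<^sub>M K"
  define Y' where "Y' \<omega> = (Y \<omega>, Z \<omega>)" for \<omega>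
  have snd_N'[measurable]: "snd \<in> measurable N' K"
    unfolding N'_def by measurable
  have Y'G: "Y' \<in> measurable G N'"
    unfolding Y'_def[abs_def] N'_def using Y ZG by measurable
  have Y'[measurable]: "Y' \<in> measurable M N'"
    by (rule measurable_from_subalg[OF G Y'G])
  let ?\<eta> = "distr M N' Y'"
  have "sigma_finite_measure ?\<eta>"
  proof (rule sigma_finite_measure_distr)
    have "distr ?\<eta> K snd = ?\<zeta>"
      by (subst distr_distr[OF _ Y']) (auto simp: N'_def comp_def Y'_def)
    then show "sigma_finite_measure (distr ?\<eta> K snd)"
      using sZ by simp
  qed (simp add: N'_def)
  then interpret \<eta>: sigma_finite_measure ?\<eta> .
  interpret \<mu>\<eta>: pair_sigma_finite ?\<mu> ?\<eta> ..
  define d' where "d' y = d (fst y, snd (snd y))" for y :: "'s \<times> 't \<times> 'k"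
  have d'[measurable]: "d' \<in> borel_measurable (S \<Otimes>\<^sub>M N')"
    unfolding d'_def[abs_def] N'_def by measurable
  have sets_\<eta>[measurable_cong]: "sets (?\<mu> \<Otimes>\<^sub>M ?\<eta>) = sets (S \<Otimes>\<^sub>M N')"
    by (intro sets_pair_measure_cong) auto
  have rect: "emeasure (distr M (S \<Otimes>\<^sub>M N') (\<lambda>\<omega>. (X \<omega>, Y' \<omega>))) (B \<times> C) = emeasure (density (?\<mu> \<Otimes>\<^sub>M ?\<eta>) d') (B \<times> C)"
    if B[measurable]: "B \<in> sets S" and C[measurable]: "C \<in> sets N'" for B C
  proof -
    note \<kappa>m[OF B, measurable]
    have CY: "(\<lambda>\<omega>. indicator C (Y' \<omega>) :: ennreal) \<in> borel_measurable G"
      by (rule measurable_compose[OF Y'G]) simp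
    have XB: "(indicator (X -` B \<inter> space M) :: _ \<Rightarrow> ennreal) \<in> borel_measurable F"
      using measurable_sets[OF X B] F by (auto simp: subalgebra_def)
    let ?E = "(X -` B \<inter> space M) \<inter> (Y' -` C \<inter> space M)"
    have "emeasure (distr M (S \<Otimes>\<^sub>M N') (\<lambda>\<omega>. (X \<omega>, Y' \<omega>))) (B \<times> C) = emeasure M ?E"
      by (subst emeasure_distr) (auto intro!: arg_cong[where f = "emeasure M"])
    also have "\<dots> = (\<integral>\<^sup>+\<omega>. indicator ?E \<omega> \<partial>M)"
      by (rule nn_integral_indicator[symmetric]) simp
    also have "\<dots> = (\<integral>\<^sup>+\<omega>. indicator C (Y' \<omega>) * indicator (X -` B \<inter> space M) \<omega> \<partial>M)"
      by (intro nn_integral_cong) (auto split: split_indicator)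
    also have "\<dots> = (\<integral>\<^sup>+\<omega>. indicator C (Y' \<omega>) * nn_cond_exp M H (indicator (X -` B \<inter> space M)) \<omega> \<partial>M)"
      by (rule cond_indep_nn_integral[OF H G F GH FH cond_indep_commute[OF ci] CY XB])
    also have "\<dots> = (\<integral>\<^sup>+\<omega>. indicator C (Y' \<omega>) * \<kappa> B (snd (Y' \<omega>)) \<partial>M)"
      using cond[OF B] by (intro nn_integral_cong_AE) (auto simp: Y'_def)
    also have "\<dots> = (\<integral>\<^sup>+y. indicator C y * \<kappa> B (snd y) \<partial>?\<eta>)"
      by (rule nn_integral_distr[symmetric]) measurable
    also have "\<dots> = (\<integral>\<^sup>+y. \<integral>\<^sup>+x. indicator C y * (indicator B x * d' (x, y)) \<partial>?\<mu> \<partial>?\<eta>)"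
    proof (rule nn_integral_cong)
      fix y assume "y \<in> space ?\<eta>"
      then have [measurable]: "snd y \<in> space K"
        using measurable_space[OF snd_N'] by simp
      show "indicator C y * \<kappa> B (snd y) = (\<integral>\<^sup>+x. indicator C y * (indicator B x * d' (x, y)) \<partial>?\<mu>)"
        unfolding \<kappa>_def d'_def fst_conv snd_conv by (rule nn_integral_cmult[symmetric]) measurable
    qed
    also have "\<dots> = (\<integral>\<^sup>+y. indicator C (snd y) * (indicator B (fst y) * d' y) \<partial>(?\<mu> \<Otimes>\<^sub>M ?\<eta>))"
      by (subst \<mu>\<eta>.nn_integral_snd[symmetric]) (auto simp: case_prod_beta')
    also have "\<dots> = (\<integral>\<^sup>+y. d' y * indicator (B \<times> C) y \<partial>(?\<mu> \<Otimes>\<^sub>M ?\<eta>))"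
      by (intro nn_integral_cong) (auto split: split_indicator)
    also have "\<dots> = emeasure (density (?\<mu> \<Otimes>\<^sub>M ?\<eta>) d') (B \<times> C)"
      by (rule emeasure_density[symmetric]) (auto simp: sets_\<eta>)
    finally show ?thesis .
  qed
  obtain C :: "nat \<Rightarrow> _" where C: "range C \<subseteq> sets ?\<eta>" "(\<Union>i. C i) = space ?\<eta>" "\<And>i. emeasure ?\<eta> (C i) \<noteq> \<infinity>"
    using \<eta>.sigma_finite by blast
  have law: "distr M (S \<Otimes>\<^sub>M N') (\<lambda>\<omega>. (X \<omega>, Y' \<omega>)) = density (?\<mu> \<Otimes>\<^sub>M ?\<eta>) d'"
  proof (rule measure_eqI_generator_eq[where \<Omega> = "space S \<times> space N'" and E = "{a \<times> b | a b. a \<in> sets S \<and> b \<in> sets N'}"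
        and A = "\<lambda>i. space S \<times> C i"])
    show "range (\<lambda>i. space S \<times> C i) \<subseteq> {a \<times> b |a b. a \<in> sets S \<and> b \<in> sets N'}"
      using C(1) by auto
    show "(\<Union>i. space S \<times> C i) = space S \<times> space N'"
      using C(2) by auto
    show "emeasure (distr M (S \<Otimes>\<^sub>M N') (\<lambda>\<omega>. (X \<omega>, Y' \<omega>))) (space S \<times> C i) \<noteq> \<infinity>" for i
    proof -
      have [measurable]: "C i \<in> sets N'"
        using C(1) by auto
      have "emeasure (distr M (S \<Otimes>\<^sub>M N') (\<lambda>\<omega>. (X \<omega>, Y' \<omega>))) (space S \<times> C i) = emeasure ?\<eta> (C i)"
        using measurable_space[OF XM] by (auto simp: emeasure_distr intro!: arg_cong[where f = "emeasure M"])
      then show ?thesis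
        using C(3) by simp
    qed
  qed (use rect in \<open>auto simp: Int_stable_pair_measure_generator sets_pair_measure pair_measure_closed sets_\<eta>\<close>)
  let ?D = "{y \<in> space (S \<Otimes>\<^sub>M N'). (fst y, fst (snd y)) \<in> D}"
  have D'[measurable]: "?D \<in> sets (S \<Otimes>\<^sub>M N')"
    using D unfolding N'_def by measurable
  have pos: "AE y in ?\<mu> \<Otimes>\<^sub>M ?\<eta>. d' y > 0"
  proof (rule \<mu>\<eta>.AE_pair_measure)
    show "{y \<in> space (?\<mu> \<Otimes>\<^sub>M ?\<eta>). 0 < d' y} \<in> sets (?\<mu> \<Otimes>\<^sub>M ?\<eta>)"
      by measurable
    have "AE x in ?\<mu>. AE z in ?\<zeta>. d (x, z) > 0"
      by (rule \<mu>\<zeta>.AE_pair[OF d_pos])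
    then show "AE x in ?\<mu>. AE y in ?\<eta>. 0 < d' (x, y)"
      using AE_space
    proof eventually_elim
      case (elim x)
      then have [measurable]: "x \<in> space S"
        by simp
      show ?case
      proof (subst AE_distr_iff)
        show "Y' \<in> measurable M N'" "{y \<in> space N'. 0 < d' (x, y)} \<in> sets N'"
          by measurable
        show "AE \<omega> in M. 0 < d' (x, Y' \<omega>)"
          using elim(1) by (simp add: AE_distr_iff d'_def Y'_def)
      qed
    qed
  qed
  have "(AE \<omega> in M. (X \<omega>, Y \<omega>) \<in> D) \<longleftrightarrow> (AE y in distr M (S \<Otimes>\<^sub>M N') (\<lambda>\<omega>. (X \<omega>, Y' \<omega>)). y \<in> ?D)"
  proof -
    have "(AE y in distr M (S \<Otimes>\<^sub>M N') (\<lambda>\<omega>. (X \<omega>, Y' \<omega>)). y \<in> ?D) \<longleftrightarrow> (AE \<omega> in M. (X \<omega>, Y' \<omega>) \<in> ?D)"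
      by (rule AE_distr_iff) measurable
    also have "\<dots> \<longleftrightarrow> (AE \<omega> in M. (X \<omega>, Y \<omega>) \<in> D)"
      using measurable_space[OF XM] measurable_space[OF Y']
      by (intro AE_cong) (auto simp: Y'_def space_pair_measure)
    finally show ?thesis ..
  qed
  also have "\<dots> \<longleftrightarrow> (AE y in ?\<mu> \<Otimes>\<^sub>M ?\<eta>. y \<in> ?D)"
    unfolding law using pos by (subst AE_density) (auto simp: sets_\<eta> elim: eventually_elim2)
  also have "\<dots> \<longleftrightarrow> (AE x in ?\<mu>. AE y in ?\<eta>. (x, y) \<in> ?D)"
  proof -
    have "{y \<in> space (?\<mu> \<Otimes>\<^sub>M ?\<eta>). (fst y, snd y) \<in> ?D} \<in> sets (?\<mu> \<Otimes>\<^sub>M ?\<eta>)"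
      unfolding prod.collapse by measurable
    from \<mu>\<eta>.AE_pair_iff[of "\<lambda>x y. (x, y) \<in> ?D", OF this] show ?thesis
      unfolding prod.collapse ..
  qed
  also have "\<dots> \<longleftrightarrow> (AE x in ?\<mu>. AE \<omega> in M. (x, Y \<omega>) \<in> D)"
  proof (rule AE_cong)
    fix x assume "x \<in> space ?\<mu>"
    then have x: "x \<in> space S"
      by simp
    have "{y \<in> space N'. (x, y) \<in> ?D} = Pair x -` ?D \<inter> space N'"
      by auto
    then have "{y \<in> space N'. (x, y) \<in> ?D} \<in> sets N'"
      using measurable_sets[OF measurable_Pair1'[OF x] D'] by simp
    then have "(AE y in ?\<eta>. (x, y) \<in> ?D) \<longleftrightarrow> (AE \<omega> in M. (x, Y' \<omega>) \<in> ?D)"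
      by (rule AE_distr_iff[OF Y'])
    also have "\<dots> \<longleftrightarrow> (AE \<omega> in M. (x, Y \<omega>) \<in> D)"
      using x measurable_space[OF Y'] by (intro AE_cong) (auto simp: space_pair_measure Y'_def)
    finally show "(AE y in ?\<eta>. (x, y) \<in> ?D) \<longleftrightarrow> (AE \<omega> in M. (x, Y \<omega>) \<in> D)" .
  qed
  finally show ?thesis .
qed

lemma path_sigma_pair:
  assumes "s \<noteq> v"
  shows "sets (path_sigma {s, v} :: (real \<Rightarrow> 'a::polish_space) measure) =
    sets (vimage_algebra paths (\<lambda>\<omega>. (\<omega> s, \<omega> v)) (borel \<Otimes>\<^sub>M borel))"
proof (rule antisym)
  let ?V = "vimage_algebra paths (\<lambda>\<omega>. (\<omega> s, \<omega> v)) (borel \<Otimes>\<^sub>M borel :: ('a \<times> 'a) measure)"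
  have pair: "(\<lambda>\<omega>. (\<omega> s, \<omega> v)) \<in> measurable ?V (borel \<Otimes>\<^sub>M borel :: ('a \<times> 'a) measure)"
    by (rule measurable_vimage_algebra1) (auto simp: space_pair_measure)
  have "subalgebra ?V (path_sigma {s, v})"
  proof (rule subalgebra_path_sigma_if_measurable)
    fix t assume "t \<in> {s, v}"
    then show "(\<lambda>\<omega>. \<omega> t) \<in> borel_measurable ?V"
      using measurable_compose[OF pair measurable_fst] measurable_compose[OF pair measurable_snd] by auto
  qed simp
  then show "sets (path_sigma {s, v} :: (real \<Rightarrow> 'a) measure) \<subseteq> sets ?V"
    by (simp add: subalgebra_def)
  have "(\<lambda>\<omega>. (\<omega> s, \<omega> v)) \<in> measurable (path_sigma {s, v}) (borel \<Otimes>\<^sub>M borel :: ('a \<times> 'a) measure)"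
    by (intro measurable_Pair measurable_path_sigma_eval) auto
  then show "sets ?V \<subseteq> sets (path_sigma {s, v} :: (real \<Rightarrow> 'a) measure)"
    by (simp add: measurable_iff_sets)
qed

lemma irreducible_AE_iff:
  fixes R :: "(real \<Rightarrow> 'a::polish_space) measure"
  assumes R: "conditionable R" and irr: "irreducible_path R"
    and t: "0 \<le> s" "s < u" "u < v" "v \<le> 1"
    and Q[measurable]: "Measurable.pred (borel \<Otimes>\<^sub>M (borel \<Otimes>\<^sub>M borel)) Q"
  shows "(AE \<omega> in R. Q (\<omega> s, \<omega> u, \<omega> v)) \<longleftrightarrow> (AE y in marg1 R s \<Otimes>\<^sub>M (marg1 R u \<Otimes>\<^sub>M marg1 R v). Q y)"
proof -
  have RM: "R \<in> path_measures"
    using R by (simp add: conditionable_def)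
  let ?P = "marg1 R s \<Otimes>\<^sub>M (marg1 R u \<Otimes>\<^sub>M marg1 R v)"
  have [measurable]: "(\<lambda>\<omega>. \<omega> s) \<in> borel_measurable R" "(\<lambda>\<omega>. \<omega> u) \<in> borel_measurable R" "(\<lambda>\<omega>. \<omega> v) \<in> borel_measurable R"
    using t by (auto intro!: measurable_path_measures_eval[OF RM])
  have borel_eq: "sets (borel \<Otimes>\<^sub>M (borel \<Otimes>\<^sub>M borel)) = sets (borel :: ('a \<times> 'a \<times> 'a) measure)"
    unfolding borel_prod ..
  have sP: "sets ?P = sets (borel :: ('a \<times> 'a \<times> 'a) measure)"
    unfolding borel_eq[symmetric] by (intro sets_pair_measure_cong) (auto simp: marg1_def)
  have sM: "sets (marg3 R s u v) = sets (borel :: ('a \<times> 'a \<times> 'a) measure)"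
    by (simp add: marg3_def)
  have ac: "absolutely_continuous (marg3 R s u v) ?P" "absolutely_continuous ?P (marg3 R s u v)"
    using irr t unfolding irreducible_path_def by blast+
  have "(AE \<omega> in R. Q (\<omega> s, \<omega> u, \<omega> v)) \<longleftrightarrow> (AE y in marg3 R s u v. Q y)"
  proof -
    have "{y \<in> space borel. Q y} \<in> sets borel"
      using measurable_sets[OF Q, of "{True}"] unfolding borel_eq by (auto simp: vimage_def space_pair_measure)
    then show ?thesis
      unfolding marg3_def by (subst AE_distr_iff) (auto simp: borel_prod[symmetric])
  qed
  also have "\<dots> \<longleftrightarrow> (AE y in ?P. Q y)"
    using absolutely_continuous_AE[OF _ ac(1), of Q] absolutely_continuous_AE[OF _ ac(2), of Q] sP sM by auto
  finally show ?thesis .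
qed

lemma (in sigma_finite_measure) sets_Collect_AE_pair:
  assumes [measurable]: "Measurable.pred (N \<Otimes>\<^sub>M M) P"
  shows "{x \<in> space N. AE y in M. P (x, y)} \<in> sets N"
proof -
  have m: "(\<lambda>w. indicator {w. \<not> P w} w :: ennreal) \<in> borel_measurable (N \<Otimes>\<^sub>M M)"
  proof -
    have "Measurable.pred (N \<Otimes>\<^sub>M M) (\<lambda>w. \<not> P w)"
      by measurable
    then show ?thesis
      by (simp add: borel_measurable_indicator_iff pred_def Int_def conj_commute)
  qed
  have "(AE y in M. P (x, y)) \<longleftrightarrow> (\<integral>\<^sup>+y. indicator {w. \<not> P w} (x, y) \<partial>M) = 0" if "x \<in> space N" for x
  proof (subst nn_integral_0_iff_AE)
    show "(\<lambda>y. indicator {w. \<not> P w} (x, y) :: ennreal) \<in> borel_measurable M"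
      by (rule measurable_compose[OF measurable_Pair1'[OF that] m])
  qed (simp add: indicator_def)
  then have "{x \<in> space N. AE y in M. P (x, y)} = {x \<in> space N. (\<integral>\<^sup>+y. indicator {w. \<not> P w} (x, y) \<partial>M) = 0}"
    by auto
  also have "\<dots> \<in> sets N"
    using borel_measurable_nn_integral_fst[OF m] by simp
  finally show ?thesis .
qed

text \<open>Irreducibility compares with the triple product; projecting out the middle time shows that the law of
\<open>(X\<^sub>s, X\<^sub>v)\<close> has the null sets of \<open>R\<^sub>s \<Otimes> R\<^sub>v\<close>. For this \<open>R \<noteq> 0\<close> is needed.\<close>

lemma irreducible_AE_prod:
  fixes R :: "(real \<Rightarrow> 'a::polish_space) measure"
  assumes R: "conditionable R" and irr: "irreducible_path R" and nz: "emeasure R (space R) \<noteq> 0"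
    and t: "0 \<le> s" "s < u" "u < v" "v \<le> 1"
    and D: "D \<in> sets (borel \<Otimes>\<^sub>M (borel \<Otimes>\<^sub>M borel))"
  shows "(AE \<omega> in R. (\<omega> u, \<omega> s, \<omega> v) \<in> D) \<longleftrightarrow> (AE x in marg1 R u. AE \<omega> in R. (x, \<omega> s, \<omega> v) \<in> D)"
proof -
  have RM: "R \<in> path_measures"
    using R by (simp add: conditionable_def)
  let ?S = "marg1 R s" and ?U = "marg1 R u" and ?V = "marg1 R v"
  have ev[measurable]: "(\<lambda>\<omega>. \<omega> s) \<in> borel_measurable R" "(\<lambda>\<omega>. \<omega> u) \<in> borel_measurable R" "(\<lambda>\<omega>. \<omega> v) \<in> borel_measurable R"
    using t by (auto intro!: measurable_path_measures_eval[OF RM])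
  have sb[measurable_cong]: "sets ?S = sets borel" "sets ?U = sets borel" "sets ?V = sets borel"
    by (simp_all add: marg1_def)
  interpret S: sigma_finite_measure ?S using R t by (auto simp: conditionable_def)
  interpret U: sigma_finite_measure ?U using R t by (auto simp: conditionable_def)
  interpret V: sigma_finite_measure ?V using R t by (auto simp: conditionable_def)
  interpret UV: pair_sigma_finite ?U ?V ..
  interpret SV: pair_sigma_finite ?S ?V ..
  interpret S_UV: pair_sigma_finite ?S "?U \<Otimes>\<^sub>M ?V" ..
  interpret U_SV: pair_sigma_finite ?U "?S \<Otimes>\<^sub>M ?V" ..
  interpret SU: pair_sigma_finite ?S ?U ..
  note D[measurable]
  have Unz: "emeasure ?U (space ?U) \<noteq> 0"
    using nz by (simp add: marg1_def emeasure_distr)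
  have triple: "(AE \<omega> in R. Q (\<omega> s) (\<omega> u) (\<omega> v)) \<longleftrightarrow> (AE a in ?S. AE x in ?U. AE b in ?V. Q a x b)"
    if Q[measurable]: "Measurable.pred (borel \<Otimes>\<^sub>M (borel \<Otimes>\<^sub>M borel)) (\<lambda>(a, x, b). Q a x b)" for Q
  proof -
    have "(AE \<omega> in R. Q (\<omega> s) (\<omega> u) (\<omega> v)) \<longleftrightarrow> (AE y in ?S \<Otimes>\<^sub>M (?U \<Otimes>\<^sub>M ?V). Q (fst y) (fst (snd y)) (snd (snd y)))"
      using irreducible_AE_iff[OF R irr t Q] by (simp add: case_prod_beta')
    also have "\<dots> \<longleftrightarrow> (AE a in ?S. AE y in ?U \<Otimes>\<^sub>M ?V. Q a (fst y) (snd y))"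
      using S_UV.AE_pair_iff[of "\<lambda>a y. Q a (fst y) (snd y)"] Q
      by (subst S_UV.AE_pair_iff) (auto simp: case_prod_beta' pred_def)
    also have "\<dots> \<longleftrightarrow> (AE a in ?S. AE x in ?U. AE b in ?V. Q a x b)"
    proof (rule AE_cong)
      fix a :: 'a
      have "Measurable.pred (?U \<Otimes>\<^sub>M ?V) (\<lambda>y. Q a (fst y) (snd y))"
        using measurable_compose[OF _ Q, of "\<lambda>y. (a, y)" "?U \<Otimes>\<^sub>M ?V"] by (simp add: case_prod_beta')
      then show "(AE y in ?U \<Otimes>\<^sub>M ?V. Q a (fst y) (snd y)) \<longleftrightarrow> (AE x in ?U. AE b in ?V. Q a x b)"
        by (subst UV.AE_pair_iff) (auto simp: pred_def)
    qed
    finally show ?thesis .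
  qed
  have "(AE \<omega> in R. (\<omega> u, \<omega> s, \<omega> v) \<in> D) \<longleftrightarrow> (AE a in ?S. AE x in ?U. AE b in ?V. (x, a, b) \<in> D)"
    by (rule triple[of "\<lambda>a x b. (x, a, b) \<in> D"]) measurable
  also have "\<dots> \<longleftrightarrow> (AE x in ?U. AE a in ?S. AE b in ?V. (x, a, b) \<in> D)"
  proof (rule SU.AE_commute)
    have "Measurable.pred ((?S \<Otimes>\<^sub>M ?U) \<Otimes>\<^sub>M ?V) (\<lambda>y. (snd (fst y), fst (fst y), snd y) \<in> D)"
      by measurable
    from V.sets_Collect_AE_pair[OF this]
    show "{y \<in> space (?S \<Otimes>\<^sub>M ?U). AE b in ?V. (snd y, fst y, b) \<in> D} \<in> sets (?S \<Otimes>\<^sub>M ?U)"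
      by simp
  qed
  also have "\<dots> \<longleftrightarrow> (AE x in ?U. AE \<omega> in R. (x, \<omega> s, \<omega> v) \<in> D)"
  proof (rule AE_cong)
    fix x :: 'a
    have "(AE \<omega> in R. (x, \<omega> s, \<omega> v) \<in> D) \<longleftrightarrow> (AE a in ?S. AE y in ?U. AE b in ?V. (x, a, b) \<in> D)"
      by (rule triple[of "\<lambda>a y b. (x, a, b) \<in> D"]) measurable
    also have "\<dots> \<longleftrightarrow> (AE a in ?S. AE b in ?V. (x, a, b) \<in> D)"
      using Unz by (simp add: eventually_const_iff ae_filter_eq_bot_iff)
    finally show "(AE a in ?S. AE b in ?V. (x, a, b) \<in> D) \<longleftrightarrow> (AE \<omega> in R. (x, \<omega> s, \<omega> v) \<in> D)" ..
  qed
  finally show ?thesis .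
qed

text \<open>The time \<open>u\<close> is separated by the strictly interior times \<open>s\<close> and \<open>v\<close> from \<open>Y\<close>, which may depend on
\<open>X\<^sub>0\<close> and \<open>X\<^sub>1\<close>.\<close>

lemma reciprocal_irreducible_AE_prod:
  fixes R :: "(real \<Rightarrow> 'a::polish_space) measure"
  assumes R: "reciprocal R" and irr: "irreducible_path R" and nz: "emeasure R (space R) \<noteq> 0"
    and t: "0 < s" "s < u" "u < v" "v < 1"
    and Y: "Y \<in> measurable (path_sigma ({0..s} \<union> {v..1})) N"
    and D: "D \<in> sets (borel \<Otimes>\<^sub>M N)"
  shows "(AE \<omega> in R. (\<omega> u, Y \<omega>) \<in> D) \<longleftrightarrow> (AE x in marg1 R u. AE \<omega> in R. (x, Y \<omega>) \<in> D)"
proof -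
  have cR: "conditionable R"
    using R by (simp add: reciprocal_def)
  have RM: "R \<in> path_measures"
    using cR by (simp add: conditionable_def)
  note spR = space_path_measures[OF RM]
  let ?F = "path_sigma {s..v} :: (real \<Rightarrow> 'a) measure" and ?G = "path_sigma ({0..s} \<union> {v..1}) :: (real \<Rightarrow> 'a) measure"
  let ?K = "borel \<Otimes>\<^sub>M borel :: ('a \<times> 'a) measure"
  let ?Z = "\<lambda>\<omega>::real \<Rightarrow> 'a. (\<omega> s, \<omega> v)"
  let ?H = "vimage_algebra (space R) ?Z ?K"
  have ev: "(\<lambda>\<omega>. \<omega> r) \<in> borel_measurable R" if "r \<in> {s, u, v}" for r
    using t that by (intro measurable_path_measures_eval[OF RM]) auto
  have Z: "?Z \<in> measurable R ?K"
    by (intro measurable_Pair ev) auto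
  have setsH: "sets ?H = sets (path_sigma {s, v} :: (real \<Rightarrow> 'a) measure)"
    unfolding spR by (rule path_sigma_pair[symmetric]) (use t in simp)
  have H_sub: "subalgebra M ?H" if "subalgebra M (path_sigma {s, v} :: (real \<Rightarrow> 'a) measure)" for M
    using that setsH sets_eq_imp_space_eq[OF setsH] by (simp add: subalgebra_def)
  have "nn_cond_exp R ?H = nn_cond_exp R (path_sigma {s, v})"
    using setsH sets_eq_imp_space_eq[OF setsH]
    by (intro ext) (simp add: nn_cond_exp_def restr_to_subalg_def subalgebra_def)
  then have ci: "cond_indep R ?F ?G ?H"
    using cond_indep_commute[of R ?G ?F "path_sigma {s, v}"] R t
    unfolding reciprocal_iff_cond_indep cond_indep_def by simp
  show ?thesis
    unfolding marg1_def
  proof (rule cond_indep_AE_prod[where F = ?F and G = ?G and Z = ?Z and K = ?K])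
    show "subalgebra R ?F" "subalgebra R ?G"
      using t by (auto intro!: subalgebra_path_sigma[OF RM])
    show "subalgebra ?F ?H" "subalgebra ?G ?H"
      using t by (auto intro!: H_sub subalgebra_path_sigma_mono)
    show "(\<lambda>\<omega>. \<omega> u) \<in> measurable ?F borel"
      using t by (intro measurable_path_sigma_eval) auto
    show "sigma_finite_measure (distr R borel (\<lambda>\<omega>. \<omega> u))"
      using cR t by (auto simp: conditionable_def marg1_def)
    show "sigma_finite_measure (distr R ?K ?Z)"
    proof (rule sigma_finite_measure_distr)
      have "distr (distr R ?K ?Z) borel fst = marg1 R s"
        using Z by (subst distr_distr) (auto simp: marg1_def comp_def)
      then show "sigma_finite_measure (distr (distr R ?K ?Z) borel fst)"
        using cR t by (auto simp: conditionable_def)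
    qed simp
    show "(AE \<omega> in R. (\<omega> u, ?Z \<omega>) \<in> D) \<longleftrightarrow> (AE x in distr R borel (\<lambda>\<omega>. \<omega> u). AE \<omega> in R. (x, ?Z \<omega>) \<in> D)"
      if "D \<in> sets (borel \<Otimes>\<^sub>M ?K)" for D
      using irreducible_AE_prod[OF cR irr nz _ _ _ _ that] t unfolding marg1_def by simp
  qed (use Z ci Y D in auto)
qed

text \<open>The constraints at interior times and the endpoint constraint become coordinates of one type: index
\<open>0\<close> stands for \<open>(X\<^sub>0, X\<^sub>1)\<close>, and any other index \<open>i\<close> for \<open>(X\<^sub>i, X\<^sub>i)\<close>.\<close>

definition end_or_point :: "real \<Rightarrow> (real \<Rightarrow> 'a) \<Rightarrow> 'a \<times> 'a" where
  "end_or_point i \<omega> = (\<omega> i, \<omega> (if i = 0 then 1 else i))"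

lemma measurable_end_or_point:
  assumes "i = 0 \<longrightarrow> 1 \<in> T" "i \<in> T" "\<And>t. t \<in> T \<Longrightarrow> (\<lambda>\<omega>. \<omega> t) \<in> measurable M (borel :: 'a::polish_space measure)"
  shows "end_or_point i \<in> borel_measurable M"
  unfolding end_or_point_def[abs_def] using assms by (intro borel_measurable_Pair) auto

text \<open>The interior times are added in increasing order. A new time \<open>b\<close> is separated by interior times \<open>s\<close>
and \<open>v\<close> from the earlier ones and from the endpoints, so \<open>reciprocal_irreducible_AE_prod\<close> applies at each step.\<close>

lemma reciprocal_irreducible_AE_PiM:
  fixes R :: "(real \<Rightarrow> 'a::polish_space) measure"
  assumes R: "reciprocal R" and irr: "irreducible_path R" and nz: "emeasure R (space R) \<noteq> 0"
    and m: "\<And>i. prob_space (m i)" "\<And>i. sets (m i) = sets borel"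
    and m_AE: "\<And>i B. i \<in> insert 0 A \<Longrightarrow> B \<in> sets borel \<Longrightarrow>
      (AE y in m i. y \<in> B) \<longleftrightarrow> (AE \<omega> in R. end_or_point i \<omega> \<in> B)"
    and A: "finite A" "A \<subseteq> {0<..<1}"
    and D: "D \<in> sets (Pi\<^sub>M (insert 0 A) (\<lambda>_. borel))"
  shows "(AE \<omega> in R. (\<lambda>i\<in>insert 0 A. end_or_point i \<omega>) \<in> D) \<longleftrightarrow> (AE z in Pi\<^sub>M (insert 0 A) m. z \<in> D)"
  using A m_AE D
proof (induction A arbitrary: D rule: finite_linorder_max_induct)
  case empty
  note m(2)[measurable_cong]
  interpret m: product_prob_space m
    by (intro product_prob_spaceI m)
  have [measurable]: "D \<in> sets (Pi\<^sub>M {0} m)"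
    using empty.prems(3) sets_PiM_cong[of "{0::real}" "{0}" m "\<lambda>_. borel"] m(2) by simp
  have emb[measurable]: "(\<lambda>x. \<lambda>i\<in>{0}. x) \<in> measurable (m 0) (Pi\<^sub>M {0} m)"
    by (intro measurable_restrict) auto
  have "(AE z in Pi\<^sub>M {0} m. z \<in> D) \<longleftrightarrow> (AE z in distr (m 0) (Pi\<^sub>M {0} m) (\<lambda>x. \<lambda>i\<in>{0}. x). z \<in> D)"
    by (subst m.distr_component) (rule refl)
  also have "\<dots> \<longleftrightarrow> (AE x in m 0. (\<lambda>i\<in>{0}. x) \<in> D)"
    by (rule AE_distr_iff) measurable
  also have "\<dots> \<longleftrightarrow> (AE x in m 0. x \<in> {x. (\<lambda>i\<in>{0}. x) \<in> D})"
    by simp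
  also have "\<dots> \<longleftrightarrow> (AE \<omega> in R. end_or_point 0 \<omega> \<in> {x. (\<lambda>i\<in>{0}. x) \<in> D})"
  proof (rule empty.prems(2))
    have "{x \<in> space (m 0). (\<lambda>i\<in>{0}. x) \<in> D} \<in> sets (m 0)"
      by measurable
    then show "{x. (\<lambda>i\<in>{0}. x) \<in> D} \<in> sets borel"
      using sets_eq_imp_space_eq[OF m(2)] m(2) by simp
  qed simp
  also have "\<dots> \<longleftrightarrow> (AE \<omega> in R. (\<lambda>i\<in>{0}. end_or_point i \<omega>) \<in> D)"
    by (intro AE_cong) (auto simp: restrict_def fun_eq_iff cong: if_cong)
  finally show ?case ..
next
  case (insert b A)
  note m(2)[measurable_cong]
  have cR: "conditionable R"
    using R by (simp add: reciprocal_def)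
  have RM: "R \<in> path_measures"
    using cR by (simp add: conditionable_def)
  let ?I = "insert 0 A"
  let ?B = "Pi\<^sub>M ?I (\<lambda>_. borel) :: (real \<Rightarrow> 'a \<times> 'a) measure"
  have b: "0 < b" "b < 1" and A01: "A \<subseteq> {0<..<1}"
    using insert.prems(1) by auto
  have bI: "b \<notin> ?I" and I_eq: "insert 0 (insert b A) = insert b ?I"
    using insert.hyps(2) b by auto
  define s where "s = (if A = {} then b / 2 else Max A)"
  have s: "0 < s" "s < b" "A \<subseteq> {0..s}"
    using b A01 insert.hyps by (auto simp: s_def Max_gr_iff subset_iff)
  define v where "v = (b + 1) / 2"
  have v: "b < v" "v < 1"
    using b by (auto simp: v_def)
  let ?Y = "\<lambda>\<omega>::real \<Rightarrow> 'a. \<lambda>i\<in>?I. end_or_point i \<omega>"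
  have Y: "?Y \<in> measurable (path_sigma ({0..s} \<union> {v..1})) ?B"
  proof (rule measurable_restrict)
    fix i assume "i \<in> ?I"
    then show "end_or_point i \<in> borel_measurable (path_sigma ({0..s} \<union> {v..1}))"
      using s v by (intro measurable_end_or_point[where T = "{0..s} \<union> {v..1}"] measurable_path_sigma_eval) auto
  qed
  have D[measurable]: "D \<in> sets (Pi\<^sub>M (insert b ?I) (\<lambda>_. borel))"
    using insert.prems(3) unfolding I_eq .
  have upd[measurable]: "(\<lambda>w. (snd w)(b := fst w)) \<in> measurable (borel \<Otimes>\<^sub>M ?B) (Pi\<^sub>M (insert b ?I) (\<lambda>_. borel))"
    by (rule measurable_fun_upd) (auto intro: measurable_snd measurable_fst)
  let ?E = "{w \<in> space (borel \<Otimes>\<^sub>M ?B). (snd w)(b := fst w) \<in> D}"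
  have E[measurable]: "?E \<in> sets (borel \<Otimes>\<^sub>M ?B)"
    by measurable
  let ?M = "Pi\<^sub>M ?I m"
  interpret M: prob_space ?M
    by (rule prob_space_PiM) (rule m)
  interpret mb: prob_space "m b"
    by (rule m)
  interpret bM: pair_sigma_finite "m b" ?M ..
  have sM[measurable_cong]: "sets ?M = sets ?B"
    by (rule sets_PiM_cong) (simp_all add: m)
  have spB: "y \<in> space ?B \<Longrightarrow> (x, y) \<in> ?E \<longleftrightarrow> y(b := x) \<in> D" for x y
    by (simp add: space_pair_measure)
  have Ysp: "?Y \<omega> \<in> space ?B" for \<omega>
    by (simp add: space_PiM)
  let ?G = "{x \<in> space (m b). AE z in ?M. (x, z) \<in> ?E}"
  have "Measurable.pred (m b \<Otimes>\<^sub>M ?M) (\<lambda>w. w \<in> ?E)"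
    by measurable
  then have "?G \<in> sets (m b)"
    by (rule M.sets_Collect_AE_pair)
  then have G: "?G \<in> sets borel"
    by (simp add: m)
  have "(AE \<omega> in R. (\<lambda>i\<in>insert b ?I. end_or_point i \<omega>) \<in> D) \<longleftrightarrow>
      (AE \<omega> in R. (\<omega> b, ?Y \<omega>) \<in> {w \<in> space (borel \<Otimes>\<^sub>M ?B). ((fst w, fst w), snd w) \<in> ?E})"
  proof (rule AE_cong)
    fix \<omega> :: "real \<Rightarrow> 'a"
    have "(\<lambda>i\<in>insert b ?I. end_or_point i \<omega>) = (?Y \<omega>)(b := (\<omega> b, \<omega> b))"
      using bI b by (auto simp: fun_eq_iff end_or_point_def)
    then show "(\<lambda>i\<in>insert b ?I. end_or_point i \<omega>) \<in> D \<longleftrightarrow>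
        (\<omega> b, ?Y \<omega>) \<in> {w \<in> space (borel \<Otimes>\<^sub>M ?B). ((fst w, fst w), snd w) \<in> ?E}"
      using spB[OF Ysp, of "(\<omega> b, \<omega> b)" \<omega>] Ysp[of \<omega>] by (simp add: space_pair_measure)
  qed
  also have "\<dots> \<longleftrightarrow> (AE x in marg1 R b. AE \<omega> in R. (x, ?Y \<omega>) \<in> {w \<in> space (borel \<Otimes>\<^sub>M ?B). ((fst w, fst w), snd w) \<in> ?E})"
    by (rule reciprocal_irreducible_AE_prod[OF R irr nz s(1,2) v Y]) measurable
  also have "\<dots> \<longleftrightarrow> (AE x in marg1 R b. (x, x) \<in> ?G)"
  proof (rule AE_cong)
    fix x :: 'a
    have [measurable]: "{z \<in> space ?B. ((x, x), z) \<in> ?E} \<in> sets ?B"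
      by measurable
    have "(AE \<omega> in R. (x, ?Y \<omega>) \<in> {w \<in> space (borel \<Otimes>\<^sub>M ?B). ((fst w, fst w), snd w) \<in> ?E}) \<longleftrightarrow>
        (AE \<omega> in R. ?Y \<omega> \<in> {z \<in> space ?B. ((x, x), z) \<in> ?E})"
      using Ysp by (intro AE_cong) (simp add: space_pair_measure)
    also have "\<dots> \<longleftrightarrow> (AE z in ?M. z \<in> {z \<in> space ?B. ((x, x), z) \<in> ?E})"
      by (rule insert.IH) (use A01 insert.prems(2) in auto)
    also have "\<dots> \<longleftrightarrow> (AE z in ?M. ((x, x), z) \<in> ?E)"
      using sets_eq_imp_space_eq[OF sM] by (intro AE_cong) simp
    also have "\<dots> \<longleftrightarrow> (x, x) \<in> ?G"
      using sets_eq_imp_space_eq[OF m(2), of b] by simp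
    finally show "(AE \<omega> in R. (x, ?Y \<omega>) \<in> {w \<in> space (borel \<Otimes>\<^sub>M ?B). ((fst w, fst w), snd w) \<in> ?E}) \<longleftrightarrow> (x, x) \<in> ?G" .
  qed
  also have "\<dots> \<longleftrightarrow> (AE \<omega> in R. (\<omega> b, \<omega> b) \<in> ?G)"
    unfolding marg1_def
  proof (rule AE_distr_iff)
    show "(\<lambda>\<omega>. \<omega> b) \<in> borel_measurable R"
      using b by (intro measurable_path_measures_eval[OF RM]) auto
    have "(\<lambda>x::'a. (x, x)) \<in> measurable borel (borel \<Otimes>\<^sub>M borel)"
      by measurable
    then have "(\<lambda>x::'a. (x, x)) \<in> measurable borel borel"
      by (simp add: borel_prod)
    from measurable_sets[OF this G] show "{x \<in> space borel. (x, x) \<in> ?G} \<in> sets borel"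
      by (simp add: vimage_def)
  qed
  also have "\<dots> \<longleftrightarrow> (AE \<omega> in R. end_or_point b \<omega> \<in> ?G)"
    using b by (simp add: end_or_point_def)
  also have "\<dots> \<longleftrightarrow> (AE x in m b. x \<in> ?G)"
    by (rule insert.prems(2)[symmetric]) (use G in auto)
  also have "\<dots> \<longleftrightarrow> (AE x in m b. AE z in ?M. (x, z) \<in> ?E)"
    by (intro AE_cong) simp
  also have "\<dots> \<longleftrightarrow> (AE w in m b \<Otimes>\<^sub>M ?M. (fst w, snd w) \<in> ?E)"
    by (rule bM.AE_pair_iff) (use \<open>Measurable.pred (m b \<Otimes>\<^sub>M ?M) (\<lambda>w. w \<in> ?E)\<close> in \<open>simp add: pred_def\<close>)
  also have "\<dots> \<longleftrightarrow> (AE w in m b \<Otimes>\<^sub>M ?M. (\<lambda>(x, X). X(b := x)) w \<in> D)"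
    using sets_eq_imp_space_eq[OF sM] by (intro AE_cong) (auto simp: space_pair_measure)
  also have "\<dots> \<longleftrightarrow> (AE z in distr (m b \<Otimes>\<^sub>M ?M) (Pi\<^sub>M (insert b ?I) m) (\<lambda>(x, X). X(b := x)). z \<in> D)"
  proof (rule AE_distr_iff[symmetric])
    have s2: "sets (Pi\<^sub>M (insert b ?I) m) = sets (Pi\<^sub>M (insert b ?I) (\<lambda>_. borel))"
      by (rule sets_PiM_cong) (simp_all add: m)
    show "(\<lambda>(x, X). X(b := x)) \<in> measurable (m b \<Otimes>\<^sub>M ?M) (Pi\<^sub>M (insert b ?I) m)"
      using upd unfolding measurable_cong_sets[OF sets_pair_measure_cong[OF m(2) sM] s2] by (simp add: case_prod_beta')
    show "{z \<in> space (Pi\<^sub>M (insert b ?I) m). z \<in> D} \<in> sets (Pi\<^sub>M (insert b ?I) m)"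
      using D sets.sets_into_space[OF D] unfolding s2 sets_eq_imp_space_eq[OF s2] by (simp add: Collect_conj_eq Int_absorb1)
  qed
  also have "\<dots> \<longleftrightarrow> (AE z in Pi\<^sub>M (insert b ?I) m. z \<in> D)"
    by (subst distr_pair_PiM_eq_PiM) (use m in auto)
  finally show ?case
    unfolding I_eq .
qed

section \<open>Product form of the minimizing density\<close>

lemma is_solution_cong_AE:
  fixes p q :: "(real \<Rightarrow> 'a::polish_space) \<Rightarrow> real"
  assumes "is_solution R T \<mu> \<pi> (density R p)" "AE \<omega> in R. p \<omega> = q \<omega>"
    and [measurable]: "p \<in> borel_measurable R" "q \<in> borel_measurable R"
  shows "is_solution R T \<mu> \<pi> (density R q)"
proof -
  have "density R p = density R q"
    by (rule density_cong) (use assms(2) in auto)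
  then show ?thesis
    using assms(1) by simp
qed

text \<open>The function \<open>p'\<close> is the density of the law of \<open>Z\<close> under \<open>P\<close> with respect to its law under
\<open>R\<close>; composed with \<open>Z\<close> it is \<open>E[p | Z]\<close>, hence \<open>p\<close>.\<close>

lemma entropy_minimizer_factor:
  fixes p :: "(real \<Rightarrow> 'a::polish_space) \<Rightarrow> real" and Z :: "(real \<Rightarrow> 'a) \<Rightarrow> 'z"
  assumes R: "R \<in> path_measures"
    and Z[measurable]: "Z \<in> measurable R N" and sZ: "sigma_finite_measure (distr R N Z)"
    and margT: "\<And>t. t \<in> T \<Longrightarrow> (\<lambda>\<omega>. \<omega> t) \<in> borel_measurable (vimage_algebra paths Z N)"
    and marg01: "(\<lambda>\<omega>. (\<omega> 0, \<omega> 1)) \<in> borel_measurable (vimage_algebra paths Z N)"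
    and sol: "is_solution R T \<mu> \<pi> (density R p)"
    and p[measurable]: "p \<in> borel_measurable R" and p0: "\<And>\<omega>. 0 \<le> p \<omega>"
  obtains p' where "p' \<in> borel_measurable N" "\<And>z. 0 \<le> p' z" "AE \<omega> in R. p \<omega> = p' (Z \<omega>)"
proof -
  note spR = space_path_measures[OF R]
  let ?F = "vimage_algebra paths Z N"
  have Zsp: "Z \<in> paths \<rightarrow> space N"
    using measurable_space[OF Z] spR by auto
  have ZF: "Z \<in> measurable ?F N"
    by (rule measurable_vimage_algebra1[OF Zsp])
  have sub: "subalgebra R ?F"
    using Z by (simp add: subalgebra_def spR measurable_iff_sets)
  have sF: "sigma_finite_subalgebra R ?F"
    by (rule sigma_finite_subalgebraI_distr[OF sub ZF sZ])
  interpret F: sigma_finite_subalgebra R ?F by fact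
  interpret RZ: sigma_finite_measure "distr R N Z" by fact
  have "density R p \<in> path_probs"
    using sol by (simp add: is_solution_def admissible_def)
  then interpret P: prob_space "density R p"
    by (simp add: path_probs_def)
  interpret PZ: prob_space "distr (density R p) N Z"
    by (rule P.prob_space_distr) simp
  have ac: "absolutely_continuous (distr R N Z) (distr (density R p) N Z)"
    unfolding absolutely_continuous_def
  proof
    fix A assume "A \<in> null_sets (distr R N Z)"
    then have "A \<in> sets N" "Z -` A \<inter> space R \<in> null_sets R"
      by (auto simp: null_sets_distr_iff)
    moreover have "absolutely_continuous R (density R p)"
      by (rule absolutely_continuousI_density) simp
    ultimately show "A \<in> null_sets (distr (density R p) N Z)"
      by (auto simp: null_sets_distr_iff absolutely_continuous_def)
  qed
  define h where "h = RN_deriv (distr R N Z) (distr (density R p) N Z)"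
  have h[measurable]: "h \<in> borel_measurable N"
    unfolding h_def using borel_measurable_RN_deriv[of "distr R N Z" "distr (density R p) N Z"] by simp
  have h_eq: "density (distr R N Z) h = distr (density R p) N Z"
    unfolding h_def by (rule RZ.density_RN_deriv[OF ac]) simp
  have "AE \<omega> in R. h (Z \<omega>) = nn_cond_exp R ?F p \<omega>"
  proof (rule F.nn_cond_exp_charact)
    fix A assume "A \<in> sets ?F"
    then obtain A' where A': "A' \<in> sets N" "A = Z -` A' \<inter> paths"
      by (subst (asm) sets_vimage_algebra2[OF Zsp]) auto
    note A'(1)[measurable]
    have "(\<integral>\<^sup>+\<omega>\<in>A. ennreal (p \<omega>) \<partial>R) = emeasure (distr (density R p) N Z) A'"
    proof -
      have "Z -` A' \<inter> paths \<in> sets R"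
        using measurable_sets[OF Z A'(1)] by (simp add: spR)
      then show ?thesis
        by (simp add: emeasure_distr emeasure_density A'(2) spR)
    qed
    also have "\<dots> = (\<integral>\<^sup>+z. h z * indicator A' z \<partial>distr R N Z)"
      unfolding h_eq[symmetric] by (simp add: emeasure_density)
    also have "\<dots> = (\<integral>\<^sup>+\<omega>\<in>A. h (Z \<omega>) \<partial>R)"
      by (subst nn_integral_distr) (auto intro!: nn_integral_cong simp: A' spR indicator_def)
    finally show "(\<integral>\<^sup>+\<omega>\<in>A. ennreal (p \<omega>) \<partial>R) = (\<integral>\<^sup>+\<omega>\<in>A. h (Z \<omega>) \<partial>R)" .
  qed (use measurable_compose[OF ZF h] in auto)
  moreover have "AE \<omega> in R. ennreal (p \<omega>) = nn_cond_exp R ?F p \<omega>"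
    by (rule entropy_minimizer_eq_cond_exp[OF sF _ marg01 sol p p0]) (rule margT)
  ultimately have "AE \<omega> in R. p \<omega> = enn2real (h (Z \<omega>))"
  proof eventually_elim
    case (elim \<omega>)
    then have "ennreal (p \<omega>) = h (Z \<omega>)"
      by simp
    then show ?case
      using p0[of \<omega>] by (metis enn2real_ennreal)
  qed
  then show ?thesis
    by (intro that[of "\<lambda>z. enn2real (h z)"]) auto
qed

lemma admissible_add:
  fixes p v :: "(real \<Rightarrow> 'a::polish_space) \<Rightarrow> real"
  assumes adm: "admissible T \<mu> \<pi> (density R p)"
    and p[measurable]: "p \<in> borel_measurable R" and p0: "\<And>\<omega>. 0 \<le> p \<omega>"
    and v: "integrable R v" and pv0: "\<And>\<omega>. 0 \<le> p \<omega> + v \<omega>"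
    and v1: "\<And>t B. t \<in> T \<Longrightarrow> B \<in> sets borel \<Longrightarrow> (\<integral>\<omega>. indicator B (\<omega> t) * v \<omega> \<partial>R) = 0"
    and v2: "\<And>B. B \<in> sets borel \<Longrightarrow> (\<integral>\<omega>. indicator B (\<omega> 0, \<omega> 1) * v \<omega> \<partial>R) = 0"
    and T: "T \<subseteq> {0..1}"
  shows "admissible T \<mu> \<pi> (density R (\<lambda>\<omega>. p \<omega> + v \<omega>))"
proof -
  have "density R p \<in> path_probs"
    using adm by (simp add: admissible_def)
  then have "prob_space (density R p)"
    by (simp add: path_probs_def)
  note ip = prob_space_density_real(1)[OF p p0 this]
  have RM: "R \<in> path_measures"
    using adm by (simp add: admissible_def path_probs_def path_measures_def)
  have [measurable]: "v \<in> borel_measurable R"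
    using v by auto
  have marg: "distr (density R (\<lambda>\<omega>. p \<omega> + v \<omega>)) N X = distr (density R p) N X"
    if X[measurable]: "X \<in> measurable R N" and zero: "\<And>B. B \<in> sets N \<Longrightarrow> (\<integral>\<omega>. indicator B (X \<omega>) * v \<omega> \<partial>R) = 0"
    for N :: "'n measure" and X
  proof (rule measure_eqI)
    fix B assume "B \<in> sets (distr (density R (\<lambda>\<omega>. p \<omega> + v \<omega>)) N X)"
    then have B[measurable]: "B \<in> sets N"
      by simp
    have ind: "integrable R (\<lambda>\<omega>. indicator B (X \<omega>) * w \<omega>)" if w: "integrable R w" for w :: "_ \<Rightarrow> real"
    proof (rule Bochner_Integration.integrable_bound[OF w])
      have [measurable]: "w \<in> borel_measurable R"
        using w by auto
      show "(\<lambda>\<omega>. indicator B (X \<omega>) * w \<omega>) \<in> borel_measurable R"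
        by measurable
    qed (auto simp: indicator_def)
    have em: "emeasure (distr (density R w) N X) B = ennreal (\<integral>\<omega>. indicator B (X \<omega>) * w \<omega> \<partial>R)"
      if w: "integrable R w" "\<And>\<omega>. 0 \<le> w \<omega>" for w :: "_ \<Rightarrow> real"
    proof -
      have [measurable]: "w \<in> borel_measurable R"
        using w(1) by auto
      have "emeasure (distr (density R w) N X) B = (\<integral>\<^sup>+\<omega>. ennreal (w \<omega>) * indicator (X -` B \<inter> space R) \<omega> \<partial>R)"
        by (simp add: emeasure_distr emeasure_density)
      also have "\<dots> = (\<integral>\<^sup>+\<omega>. ennreal (indicator B (X \<omega>) * w \<omega>) \<partial>R)"
        by (intro nn_integral_cong) (auto simp: indicator_def)
      also have "\<dots> = ennreal (\<integral>\<omega>. indicator B (X \<omega>) * w \<omega> \<partial>R)"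
        using ind[OF w(1)] w(2) by (intro nn_integral_eq_integral) auto
      finally show ?thesis .
    qed
    have "(\<integral>\<omega>. indicator B (X \<omega>) * (p \<omega> + v \<omega>) \<partial>R) = (\<integral>\<omega>. indicator B (X \<omega>) * p \<omega> \<partial>R)"
      using ind[OF ip] ind[OF v] zero[OF B] by (simp add: distrib_left)
    then show "emeasure (distr (density R (\<lambda>\<omega>. p \<omega> + v \<omega>)) N X) B = emeasure (distr (density R p) N X) B"
      using em[of "\<lambda>\<omega>. p \<omega> + v \<omega>"] em[of p] ip v p0 pv0 by simp
  qed simp
  show ?thesis
  proof (rule admissible_density_cong[OF adm])
    fix t assume t: "t \<in> T"
    show "marg1 (density R (\<lambda>\<omega>. p \<omega> + v \<omega>)) t = marg1 (density R p) t"
      unfolding marg1_def using t T by (intro marg measurable_path_measures_eval[OF RM] v1) auto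
  next
    show "marg2 (density R (\<lambda>\<omega>. p \<omega> + v \<omega>)) 0 1 = marg2 (density R p) 0 1"
      unfolding marg2_def by (intro marg v2 borel_measurable_Pair measurable_path_measures_eval[OF RM]) auto
  qed auto
qed

text \<open>Let \<open>Z\<close> collect the pair \<open>(X\<^sub>0, X\<^sub>1)\<close> and the positions at the interior constraint times; constraints
at times \<open>0\<close> and \<open>1\<close> are implied by the one on the pair. The density is \<open>p' (Z \<omega>)\<close>, and the law of \<open>Z\<close>
under \<open>R\<close> has the null sets of a product of probability measures. A perturbation of \<open>p'\<close> that
keeps all coordinate marginals is admissible, so the exchange argument applies.\<close>

lemma entropy_minimizer_product_form:
  fixes p :: "(real \<Rightarrow> 'a::polish_space) \<Rightarrow> real"
  assumes R: "reciprocal R" and irr: "irreducible_path R" and T: "finite T" "T \<subseteq> {0..1}"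
    and sol: "is_solution R T \<mu> \<pi> (density R p)"
    and p[measurable]: "p \<in> borel_measurable R" and p0: "\<And>\<omega>. 0 \<le> p \<omega>"
  obtains g :: "real \<Rightarrow> 'a \<times> 'a \<Rightarrow> real" where "\<And>i. g i \<in> borel_measurable borel" "\<And>i y. 0 \<le> g i y"
    "AE \<omega> in R. p \<omega> = (\<Prod>i\<in>insert 0 (T \<inter> {0<..<1}). g i (end_or_point i \<omega>))"
proof -
  have cR: "conditionable R"
    using R by (simp add: reciprocal_def)
  have RM: "R \<in> path_measures"
    using cR by (simp add: conditionable_def)
  note spR = space_path_measures[OF RM]
  obtain W where W: "entropy_weight (density R p) R W"
    using sol by (auto simp: is_solution_def rel_entropy_defined_def)
  obtain z where z: "z > 0" "weighted R W = density R (\<lambda>\<omega>. ennreal (exp (- W \<omega>) / z))" "prob_space (weighted R W)"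
    by (rule weighted_facts[OF W])
  have [measurable]: "W \<in> borel_measurable R"
    using W by (simp add: entropy_weight_def)
  (* a probability measure with the null sets of R, to serve as the source of coordinate laws *)
  define R' where "R' = weighted R W"
  have sR': "sets R' = sets R" "space R' = space R"
    by (simp_all add: R'_def z(2))
  have AE_R': "(AE \<omega> in R'. Q \<omega>) \<longleftrightarrow> (AE \<omega> in R. Q \<omega>)" for Q
    unfolding R'_def z(2) using z(1) by (subst AE_density) auto
  interpret R': prob_space R'
    unfolding R'_def by (rule z(3))
  have nz: "emeasure R (space R) \<noteq> 0"
  proof
    assume "emeasure R (space R) = 0"
    then have "AE \<omega> in R. False"
      by (simp add: eventually_const_iff ae_filter_eq_bot_iff)
    then have "AE \<omega> in R'. False"
      unfolding AE_R' .
    then show False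
      by simp
  qed
  define A where "A = T \<inter> {0<..<1}"
  define I where "I = insert 0 A"
  have A: "finite A" "A \<subseteq> {0<..<1}"
    using T by (auto simp: A_def)
  have I: "finite I" "I \<noteq> {}" "I \<subseteq> {0..1}"
    using A by (auto simp: I_def)
  have ep[measurable]: "end_or_point i \<in> borel_measurable R" if "i \<in> I" for i
    using that I by (intro measurable_end_or_point[where T = "{0..1}"] measurable_path_measures_eval[OF RM]) auto
  have epR': "end_or_point i \<in> borel_measurable R'" if "i \<in> I" for i
    using ep[OF that] measurable_cong_sets[OF sR'(1) refl] by blast
  define m :: "real \<Rightarrow> ('a \<times> 'a) measure" where
    "m i = (if i \<in> I then distr R' borel (end_or_point i) else return borel undefined)" for i
  have m: "prob_space (m i)" "sets (m i) = sets borel" for i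
    using epR' by (auto simp: m_def intro!: R'.prob_space_distr prob_space_return)
  have m_AE: "(AE y in m i. y \<in> B) \<longleftrightarrow> (AE \<omega> in R. end_or_point i \<omega> \<in> B)"
    if "i \<in> insert 0 A" and B: "B \<in> sets borel" for i B
  proof -
    have i: "i \<in> I"
      using that by (simp add: I_def)
    have "m i = distr R' borel (end_or_point i)"
      using i by (simp add: m_def)
    then have "(AE y in m i. y \<in> B) \<longleftrightarrow> (AE y in distr R' borel (end_or_point i). y \<in> B)"
      by (simp only:)
    also have "\<dots> \<longleftrightarrow> (AE \<omega> in R'. end_or_point i \<omega> \<in> B)"
      using B by (intro AE_distr_iff epR'[OF i]) auto
    finally show ?thesis
      unfolding AE_R' .
  qed
  let ?B = "Pi\<^sub>M I (\<lambda>_. borel) :: (real \<Rightarrow> 'a \<times> 'a) measure"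
  let ?M = "Pi\<^sub>M I m"
  have sM[measurable_cong]: "sets ?M = sets ?B"
    by (rule sets_PiM_cong) (simp_all add: m)
  note spM = sets_eq_imp_space_eq[OF sM]
  have mB: "measurable ?B L = measurable ?M L" for L :: "'l measure"
    by (rule measurable_cong_sets[OF sM[symmetric] refl])
  interpret M: prob_space ?M
    by (rule prob_space_PiM) (rule m)
  define Z where "Z \<omega> = (\<lambda>i\<in>I. end_or_point i \<omega>)" for \<omega> :: "real \<Rightarrow> 'a"
  have Z[measurable]: "Z \<in> measurable R ?B"
    unfolding Z_def[abs_def] by (intro measurable_restrict ep)
  have ZM[measurable]: "Z \<in> measurable R ?M"
    using Z measurable_cong_sets[OF refl sM] by blast
  have AE_Z: "(AE \<omega> in R. Z \<omega> \<in> D) \<longleftrightarrow> (AE z in ?M. z \<in> D)" if "D \<in> sets ?B" for D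
    using reciprocal_irreducible_AE_PiM[OF R irr nz m m_AE A] that unfolding Z_def I_def by blast
  let ?R = "distr R ?B Z"
  have 0: "0 \<in> I"
    by (simp add: I_def)
  have fst_snd: "(fst :: 'a \<times> 'a \<Rightarrow> 'a) \<in> measurable borel borel" "(snd :: 'a \<times> 'a \<Rightarrow> 'a) \<in> measurable borel borel"
    by (simp_all add: borel_prod[symmetric])
  have fst0: "(\<lambda>z. fst (z 0)) \<in> borel_measurable ?B"
    by (rule measurable_compose[OF measurable_component_singleton[OF 0] fst_snd(1)])
  have sZ: "sigma_finite_measure ?R"
  proof (rule sigma_finite_measure_distr)
    have "distr ?R borel (\<lambda>z. fst (z 0)) = marg1 R 0"
      using 0 by (subst distr_distr[OF fst0 Z]) (simp add: marg1_def comp_def Z_def end_or_point_def)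
    then show "sigma_finite_measure (distr ?R borel (\<lambda>z. fst (z 0)))"
      using cR by (simp add: conditionable_def)
    show "(\<lambda>z. fst (z 0)) \<in> borel_measurable ?R"
      using fst0 by simp
  qed
  then interpret RZ: sigma_finite_measure ?R .
  have null: "null_sets ?R = null_sets ?M"
  proof (rule null_sets_eqI_AE)
    fix D assume "D \<in> sets ?R"
    then have D: "D \<in> sets ?B"
      by simp
    then show "(AE z in ?R. z \<in> D) \<longleftrightarrow> (AE z in ?M. z \<in> D)"
      unfolding AE_Z[OF D, symmetric] by (intro AE_distr_iff[OF Z]) auto
  qed (simp add: sM)
  define r where "r z = enn2real (RN_deriv ?M ?R z)" for z
  have RN: "RN_deriv ?M ?R \<in> borel_measurable ?M"
    by simp
  have r[measurable]: "r \<in> borel_measurable ?M"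
    unfolding r_def[abs_def] by measurable
  have dR: "density ?M (RN_deriv ?M ?R) = ?R"
    using null by (intro M.density_RN_deriv) (auto simp: absolutely_continuous_def sM)
  have fin_RN: "AE z in ?M. RN_deriv ?M ?R z \<noteq> \<infinity>"
    using null sZ by (intro M.RN_deriv_finite) (auto simp: absolutely_continuous_def sM)
  have dr: "density ?M r = ?R"
  proof -
    have "density ?M r = density ?M (RN_deriv ?M ?R)"
      using fin_RN by (intro density_cong) (auto simp: r_def less_top elim!: eventually_mono)
    then show ?thesis
      by (simp add: dR)
  qed
  have r0: "AE z in ?M. 0 < r z"
  proof -
    have "{z \<in> space ?M. 0 < r z} \<in> sets ?M"
      by measurable
    then have pos: "{z \<in> space ?B. 0 < r z} \<in> sets ?B"
      unfolding spM sM .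
    have "AE z in ?R. 0 < r z"
      unfolding dr[symmetric] by (subst AE_density) auto
    then have "AE \<omega> in R. 0 < r (Z \<omega>)"
      by (subst (asm) AE_distr_iff[OF Z pos]) simp
    then have "AE \<omega> in R. Z \<omega> \<in> {z \<in> space ?B. 0 < r z}"
      using AE_space by eventually_elim (use measurable_space[OF Z] in simp)
    then have "AE z in ?M. z \<in> {z \<in> space ?B. 0 < r z}"
      unfolding AE_Z[OF pos] .
    then show ?thesis
      by (auto elim!: eventually_mono)
  qed
  have int_R: "(\<integral>\<omega>. \<phi> (Z \<omega>) \<partial>R) = (\<integral>z. r z * \<phi> z \<partial>?M)" if [measurable]: "\<phi> \<in> borel_measurable ?M" for \<phi> :: "_ \<Rightarrow> real"
  proof -
    have "(\<integral>\<omega>. \<phi> (Z \<omega>) \<partial>R) = (\<integral>z. \<phi> z \<partial>?R)"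
      by (rule integral_distr[symmetric]) (auto simp: mB)
    also have "\<dots> = (\<integral>z. r z * \<phi> z \<partial>?M)"
      unfolding dr[symmetric] by (subst integral_density) (auto simp: r_def)
    finally show ?thesis .
  qed
  have comp: "(\<lambda>\<omega>. f (end_or_point i \<omega>)) \<in> borel_measurable (vimage_algebra paths Z ?B)"
    if "i \<in> I" "f \<in> measurable borel (borel :: 'c::topological_space measure)" for i f
  proof -
    have "Z \<in> measurable (vimage_algebra paths Z ?B) ?B"
      using measurable_space[OF Z] by (intro measurable_vimage_algebra1) (auto simp: spR)
    from measurable_compose[OF measurable_compose[OF this measurable_component_singleton[OF that(1)]] that(2)]
    show ?thesis
      using that(1) by (simp add: Z_def)
  qed
  have T_cases: "t \<in> A \<or> t = 0 \<or> t = 1" if "t \<in> T" for t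
    using that T(2) by (auto simp: A_def less_le)
  have marg01: "(\<lambda>\<omega>. (\<omega> 0, \<omega> 1)) \<in> borel_measurable (vimage_algebra paths Z ?B)"
    using comp[OF 0, of "\<lambda>y. y"] by (simp add: end_or_point_def)
  have margT: "(\<lambda>\<omega>. \<omega> t) \<in> borel_measurable (vimage_algebra paths Z ?B)" if "t \<in> T" for t
    using T_cases[OF that] comp[of t fst] comp[OF 0, of fst] comp[OF 0, of snd] fst_snd
    by (auto simp: end_or_point_def I_def)
  obtain p' where p': "p' \<in> borel_measurable ?B" "\<And>z. 0 \<le> p' z" "AE \<omega> in R. p \<omega> = p' (Z \<omega>)"
    by (rule entropy_minimizer_factor[OF RM Z sZ margT marg01 sol p p0]) auto
  have p'M[measurable]: "p' \<in> borel_measurable ?M"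
    using p'(1) by (simp add: mB)
  have p'Z[measurable]: "(\<lambda>\<omega>. p' (Z \<omega>)) \<in> borel_measurable R"
    by measurable
  have sol': "is_solution R T \<mu> \<pi> (density R (\<lambda>\<omega>. p' (Z \<omega>)))"
    by (rule is_solution_cong_AE[OF sol p'(3) p p'Z])
  have adm: "admissible T \<mu> \<pi> (density R (\<lambda>\<omega>. p' (Z \<omega>)))"
    using sol' by (simp add: is_solution_def)
  note ipp = entropy_minimizer_integrable[OF sol' p'Z p'(2)]
  have opt: "0 \<le> (\<integral>z. r z * ((p' z + u z) * ln (p' z + u z) - p' z * ln (p' z)) \<partial>?M)"
    if C[measurable]: "C \<in> sets ?M" and u[measurable]: "u \<in> borel_measurable ?M"
      and bd: "\<And>z. z \<in> C \<Longrightarrow> 0 \<le> r z \<and> r z \<le> b \<and> p' z \<le> b" and ub: "\<And>z. \<bar>u z\<bar> \<le> b"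
      and uC: "\<And>z. z \<notin> C \<Longrightarrow> u z = 0" and pu: "\<And>z. 0 \<le> p' z + u z"
      and marg: "\<And>i B. i \<in> I \<Longrightarrow> B \<in> sets (m i) \<Longrightarrow> (\<integral>z. indicator B (z i) * (u z * r z) \<partial>?M) = 0"
    for C u b
  proof -
    let ?C = "Z -` C \<inter> space R"
    have C'[measurable]: "?C \<in> sets R"
      by measurable
    have "emeasure R ?C = emeasure ?R C"
      using C by (simp add: emeasure_distr sM)
    also have "\<dots> = (\<integral>\<^sup>+z. ennreal (r z) * indicator C z \<partial>?M)"
      unfolding dr[symmetric] by (simp add: emeasure_density)
    also have "\<dots> \<le> (\<integral>\<^sup>+z. ennreal b \<partial>?M)"
      using bd by (intro nn_integral_mono) (auto simp: indicator_def ennreal_leI)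
    also have "\<dots> < \<infinity>"
      by (simp add: M.emeasure_space_1)
    finally have finC: "emeasure R ?C < \<infinity>" .
    have bdd_int: "integrable R f"
      if [measurable]: "f \<in> borel_measurable R" and "\<And>\<omega>. \<omega> \<in> space R \<Longrightarrow> \<bar>f \<omega>\<bar> \<le> k * indicator ?C \<omega>" for f :: "_ \<Rightarrow> real" and k
    proof (rule Bochner_Integration.integrable_bound[where f = "\<lambda>\<omega>. k * indicator ?C \<omega>"])
      show "integrable R (\<lambda>\<omega>. k * indicator ?C \<omega>)"
        using finC by (intro integrable_mult_right integrable_real_indicator) auto
      show "AE \<omega> in R. norm (f \<omega>) \<le> norm (k * indicator ?C \<omega> :: real)"
        unfolding real_norm_def by (intro AE_I2 order.trans[OF that(2) abs_ge_self])
    qed simp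
    let ?u = "\<lambda>\<omega>. u (Z \<omega>)"
    have iu: "integrable R ?u"
      by (rule bdd_int[of _ b]) (use ub uC in \<open>auto simp: indicator_def\<close>)
    have int0: "(\<integral>\<omega>. indicator B (end_or_point i \<omega>) * ?u \<omega> \<partial>R) = 0" if i: "i \<in> I" and B: "B \<in> sets borel" for i B
    proof -
      have [measurable]: "(\<lambda>z. indicator B (z i) :: real) \<in> borel_measurable ?M"
        using measurable_compose[OF measurable_component_singleton[OF i] borel_measurable_indicator[OF B]] by (simp add: mB)
      have "(\<integral>\<omega>. indicator B (end_or_point i \<omega>) * ?u \<omega> \<partial>R) = (\<integral>\<omega>. (\<lambda>z. indicator B (z i) * u z) (Z \<omega>) \<partial>R)"
        using i by (simp add: Z_def)
      also have "\<dots> = (\<integral>z. r z * (indicator B (z i) * u z) \<partial>?M)"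
        by (rule int_R) measurable
      also have "\<dots> = (\<integral>z. indicator B (z i) * (u z * r z) \<partial>?M)"
        by (simp add: ac_simps)
      also have "\<dots> = 0"
        using marg[OF i] B by (simp add: m)
      finally show ?thesis .
    qed
    have admq: "admissible T \<mu> \<pi> (density R (\<lambda>\<omega>. p' (Z \<omega>) + ?u \<omega>))"
    proof (rule admissible_add[OF adm p'Z p'(2) iu pu _ _ T(2)])
      fix B :: "('a \<times> 'a) set" assume "B \<in> sets borel"
      from int0[OF 0 this] show "(\<integral>\<omega>. indicator B (\<omega> 0, \<omega> 1) * ?u \<omega> \<partial>R) = 0"
        by (simp add: end_or_point_def)
    next
      fix t and B :: "'a set" assume t: "t \<in> T" and B: "B \<in> sets borel"
      have fB: "fst -` B \<in> sets (borel :: ('a \<times> 'a) measure)" "snd -` B \<in> sets (borel :: ('a \<times> 'a) measure)"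
        using measurable_sets[OF fst_snd(1) B] measurable_sets[OF fst_snd(2) B] by simp_all
      from T_cases[OF t] show "(\<integral>\<omega>. indicator B (\<omega> t) * ?u \<omega> \<partial>R) = 0"
      proof (elim disjE)
        assume "t \<in> A"
        then show ?thesis
          using int0[of t, OF _ fB(1)] by (simp add: I_def end_or_point_def indicator_def)
      next
        assume "t = 0"
        then show ?thesis
          using int0[OF 0 fB(1)] by (simp add: end_or_point_def indicator_def)
      next
        assume "t = 1"
        then show ?thesis
          using int0[OF 0 fB(2)] by (simp add: end_or_point_def indicator_def)
      qed
    qed
    let ?q = "\<lambda>\<omega>. p' (Z \<omega>) + ?u \<omega>"
    have q[measurable]: "?q \<in> borel_measurable R"
      by measurable
    let ?d = "\<lambda>\<omega>. ?q \<omega> * ln (?q \<omega>) - p' (Z \<omega>) * ln (p' (Z \<omega>))"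
    have id: "integrable R ?d"
    proof (rule bdd_int[of _ "2 * (1 + (2 * b) * (2 * b))"])
      fix \<omega> assume "\<omega> \<in> space R"
      show "\<bar>?d \<omega>\<bar> \<le> 2 * (1 + (2 * b) * (2 * b)) * indicator ?C \<omega>"
      proof (cases "Z \<omega> \<in> C")
        case True
        have "p' (Z \<omega>) \<le> b" "?q \<omega> \<le> 2 * b" "0 \<le> b"
          using bd[OF True] ub[of "Z \<omega>"] by auto
        then have "\<bar>?q \<omega> * ln (?q \<omega>)\<bar> \<le> 1 + (2 * b) * (2 * b)" "\<bar>p' (Z \<omega>) * ln (p' (Z \<omega>))\<bar> \<le> 1 + (2 * b) * (2 * b)"
          using abs_mult_ln_le[OF pu, of "Z \<omega>" "2 * b"] abs_mult_ln_le[OF p'(2), of "Z \<omega>" "2 * b"] by auto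
        then show ?thesis
          using True \<open>\<omega> \<in> space R\<close> by simp
      qed (use uC in simp)
    qed measurable
    have iq: "integrable R (\<lambda>\<omega>. ?q \<omega> * ln (?q \<omega>))"
      using Bochner_Integration.integrable_add[OF id ipp] by simp
    have "(\<integral>\<omega>. p' (Z \<omega>) * ln (p' (Z \<omega>)) \<partial>R) \<le> (\<integral>\<omega>. ?q \<omega> * ln (?q \<omega>) \<partial>R)"
      by (rule entropy_minimizer_le[OF sol' p'Z p'(2) q pu C' finC _ admq iq]) (use uC in auto)
    then have "0 \<le> (\<integral>\<omega>. ?d \<omega> \<partial>R)"
      using iq ipp by simp
    also have "\<dots> = (\<integral>z. r z * ((p' z + u z) * ln (p' z + u z) - p' z * ln (p' z)) \<partial>?M)"
      by (rule int_R) measurable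
    finally show ?thesis .
  qed
  have p'nz: "\<not> (AE z in ?M. p' z = 0)"
  proof
    assume "AE z in ?M. p' z = 0"
    then have "AE z in ?M. z \<in> {z \<in> space ?B. p' z = 0}"
      using AE_space by eventually_elim (simp add: spM)
    then have "AE \<omega> in R. Z \<omega> \<in> {z \<in> space ?B. p' z = 0}"
      using p'(1) by (subst AE_Z) auto
    then have "density R (\<lambda>\<omega>. p' (Z \<omega>)) = density R (\<lambda>_. 0)"
      by (intro density_cong) auto
    moreover have "prob_space (density R (\<lambda>\<omega>. p' (Z \<omega>)))"
      using adm by (simp add: admissible_def path_probs_def)
    ultimately have "emeasure (density R (\<lambda>_. 0)) (space R) = 1"
      using prob_space.emeasure_space_1 by fastforce
    then show False
      by (simp add: emeasure_density)
  qed
  obtain x where x: "x \<in> space ?M" "0 < p' x"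
    and eq: "AE z in ?M. p' z * p' x ^ (card I - 1) = (\<Prod>j\<in>I. p' (x(j := z j)))"
    by (rule minimizer_product_form[OF I(1,2) m(1) p'M p'(2) r r0 opt p'nz])
  define c where "c = p' x ^ (card I - 1)"
  have c: "0 < c"
    using x(2) by (simp add: c_def)
  (* the normalizing constant goes into the coordinate of the endpoints *)
  define g where "g i y = (if i \<in> I then p' (x(i := y)) / (if i = 0 then c else 1) else 0)" for i y
  have upd: "(\<lambda>y. x(i := y)) \<in> measurable borel ?M" if "i \<in> I" for i
  proof -
    have "(\<lambda>y. \<lambda>j\<in>I. if j = i then y else x j) \<in> measurable borel ?B"
      by (intro measurable_restrict) auto
    moreover have "(\<lambda>j\<in>I. if j = i then y else x j) = x(i := y)" for y
      using x(1) that by (auto simp: fun_eq_iff space_PiM PiE_iff extensional_def)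
    ultimately show ?thesis
      unfolding measurable_cong_sets[OF refl sM] by simp
  qed
  have g: "g i \<in> borel_measurable borel" for i
  proof (cases "i \<in> I")
    case True
    show ?thesis
      unfolding g_def[abs_def] using measurable_compose[OF upd[OF True] p'M] True by simp
  qed (simp add: g_def[abs_def])
  have prod_g: "(\<Prod>i\<in>I. g i (w i)) = (\<Prod>i\<in>I. p' (x(i := w i))) / c" for w
  proof -
    have "(\<Prod>i\<in>I. g i (w i)) = (\<Prod>i\<in>I. p' (x(i := w i)) / (if i = 0 then c else 1))"
      by (intro prod.cong) (auto simp: g_def)
    also have "\<dots> = (\<Prod>i\<in>I. p' (x(i := w i))) / (\<Prod>i\<in>I. if i = 0 then c else 1)"
      by (rule prod_dividef)
    also have "(\<Prod>i\<in>I. if i = 0 then c else 1) = c"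
      using I(1) 0 by simp
    finally show ?thesis .
  qed
  show ?thesis
  proof (rule that[of g])
    show "0 \<le> g i y" for i y
      using p'(2) c by (simp add: g_def)
    have [measurable]: "(\<lambda>z. p' (x(j := z j))) \<in> borel_measurable ?B" if "j \<in> I" for j
      using measurable_compose[OF measurable_component_singleton[OF that] measurable_compose[OF upd[OF that] p'M]] .
    have [measurable]: "p' \<in> borel_measurable ?B"
      by (rule p'(1))
    have "AE z in ?M. z \<in> {z \<in> space ?B. p' z * c = (\<Prod>j\<in>I. p' (x(j := z j)))}"
      using eq AE_space by eventually_elim (simp add: spM c_def)
    then have "AE \<omega> in R. Z \<omega> \<in> {z \<in> space ?B. p' z * c = (\<Prod>j\<in>I. p' (x(j := z j)))}"
      by (subst AE_Z) measurable
    with p'(3) have "AE \<omega> in R. p \<omega> = (\<Prod>i\<in>I. g i (end_or_point i \<omega>))"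
    proof eventually_elim
      case (elim \<omega>)
      have "p' (Z \<omega>) * c = (\<Prod>i\<in>I. p' (x(i := end_or_point i \<omega>)))"
        using elim(2) by (simp add: Z_def cong: prod.cong)
      then show ?case
        using elim(1) c by (simp add: prod_g field_simps)
    qed
    then show "AE \<omega> in R. p \<omega> = (\<Prod>i\<in>insert 0 (T \<inter> {0<..<1}). g i (end_or_point i \<omega>))"
      by (simp add: I_def A_def)
  qed (rule g)
qed

section \<open>Exponential form\<close>

definition ln_ereal0 :: "real \<Rightarrow> ereal" where
  "ln_ereal0 a = (if 0 < a then ereal (ln a) else -\<infinity>)"

lemma ln_ereal0_less_top: "ln_ereal0 a < \<infinity>"
  by (simp add: ln_ereal0_def)

lemma borel_measurable_ln_ereal0 [measurable]: "ln_ereal0 \<in> borel_measurable borel"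
  unfolding ln_ereal0_def[abs_def] by measurable

lemma exp_ereal_ln_ereal0: "0 \<le> a \<Longrightarrow> exp_ereal (ln_ereal0 a) = ennreal a"
  by (auto simp: exp_ereal_def ln_ereal0_def)

lemma exp_ereal_0: "exp_ereal 0 = 1"
  by (simp add: exp_ereal_def)

lemma exp_ereal_add:
  assumes "a < \<infinity>" "b < \<infinity>"
  shows "exp_ereal (a + b) = exp_ereal a * exp_ereal b"
  using assms by (cases a; cases b) (auto simp: exp_ereal_def exp_add ennreal_mult)

lemma exp_ereal_sum:
  assumes "finite A" "\<And>i. i \<in> A \<Longrightarrow> f i < \<infinity>"
  shows "exp_ereal (\<Sum>i\<in>A. f i) = (\<Prod>i\<in>A. exp_ereal (f i)) \<and> (\<Sum>i\<in>A. f i) < \<infinity>"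
  using assms
proof (induction A)
  case (insert i A)
  then show ?case
    by (auto simp: exp_ereal_add)
qed (simp add: exp_ereal_0)

text \<open>The times may be listed with repetitions and may include the endpoints. Only the first occurrence of
an interior time carries a function; the others contribute 0.\<close>

lemma exp_ereal_product_form:
  fixes g :: "real \<Rightarrow> 'a::polish_space \<times> 'a \<Rightarrow> real" and t :: "nat \<Rightarrow> real"
  assumes g: "\<And>i. g i \<in> borel_measurable borel" and g0: "\<And>i y. 0 \<le> g i y"
  obtains \<eta> :: "'a \<times> 'a \<Rightarrow> ereal" and f :: "nat \<Rightarrow> 'a \<Rightarrow> ereal"
  where "\<eta> \<in> borel_measurable borel" "\<And>y. \<eta> y < \<infinity>" "\<And>k. f k \<in> borel_measurable borel" "\<And>k x. f k x < \<infinity>"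
    "\<And>\<omega>. ennreal (\<Prod>i\<in>insert 0 (t ` {1..K} \<inter> {0<..<1}). g i (end_or_point i \<omega>)) =
      exp_ereal (\<eta> (\<omega> 0, \<omega> 1) + (\<Sum>k = 1..K. f k (\<omega> (t k))))"
proof -
  define N where "N = {k \<in> {1..K}. t k \<in> {0<..<1} \<and> (\<forall>j\<in>{1..<k}. t j \<noteq> t k)}"
  have bij: "bij_betw t N (t ` {1..K} \<inter> {0<..<1})"
    unfolding bij_betw_def
  proof
    show "inj_on t N"
    proof (rule inj_onI)
      fix j k assume jk: "j \<in> N" "k \<in> N" "t j = t k"
      show "j = k"
      proof (rule linorder_cases[of j k])
        assume "j < k"
        with jk show ?thesis
          by (force simp: N_def)
      next
        assume "k < j"
        with jk show ?thesis
          by (force simp: N_def)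
      qed
    qed
    show "t ` N = t ` {1..K} \<inter> {0<..<1}"
    proof
      show "t ` {1..K} \<inter> {0<..<1} \<subseteq> t ` N"
      proof
        fix r assume "r \<in> t ` {1..K} \<inter> {0<..<1}"
        then obtain k where k: "k \<in> {1..K}" "t k = r" "r \<in> {0<..<1}"
          by auto
        define l where "l = (LEAST l. 1 \<le> l \<and> t l = r)"
        have l: "1 \<le> l \<and> t l = r"
          unfolding l_def by (rule LeastI[of _ k]) (use k in auto)
        have "l \<le> k"
          unfolding l_def by (rule Least_le) (use k in auto)
        moreover have "t j \<noteq> r" if "j \<in> {1..<l}" for j
          using not_less_Least[of j "\<lambda>l. 1 \<le> l \<and> t l = r"] that by (auto simp: l_def)
        ultimately have "l \<in> N"
          using l k by (auto simp: N_def)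
        then show "r \<in> t ` N"
          using l by auto
      qed
    qed (auto simp: N_def)
  qed
  define \<eta> where "\<eta> y = ln_ereal0 (g 0 y)" for y
  define f where "f k x = (if k \<in> N then ln_ereal0 (g (t k) (x, x)) else 0)" for k x
  have f_fin: "f k x < \<infinity>" for k x
    using ln_ereal0_less_top[of "g (t k) (x, x)"] by (simp add: f_def)
  show ?thesis
  proof (rule that[of \<eta> f])
    show "\<eta> \<in> borel_measurable borel"
      unfolding \<eta>_def[abs_def] using g by measurable
    show "f k \<in> borel_measurable borel" for k
    proof -
      have "(\<lambda>x::'a. (x, x)) \<in> measurable borel (borel \<Otimes>\<^sub>M borel)"
        by measurable
      then have "(\<lambda>x::'a. (x, x)) \<in> measurable borel borel"
        by (simp add: borel_prod)
      from measurable_compose[OF measurable_compose[OF this g] borel_measurable_ln_ereal0]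
      show ?thesis
        by (cases "k \<in> N") (simp_all add: f_def[abs_def])
    qed
    fix \<omega> :: "real \<Rightarrow> 'a"
    have "exp_ereal (\<eta> (\<omega> 0, \<omega> 1) + (\<Sum>k = 1..K. f k (\<omega> (t k)))) =
        exp_ereal (\<eta> (\<omega> 0, \<omega> 1)) * (\<Prod>k = 1..K. exp_ereal (f k (\<omega> (t k))))"
    proof -
      have "\<eta> (\<omega> 0, \<omega> 1) < \<infinity>"
        unfolding \<eta>_def by (rule ln_ereal0_less_top)
      with exp_ereal_sum[of "{1..K}" "\<lambda>k. f k (\<omega> (t k))"] f_fin show ?thesis
        by (simp only: exp_ereal_add finite_atLeastAtMost)
    qed
    also have "exp_ereal (\<eta> (\<omega> 0, \<omega> 1)) = ennreal (g 0 (end_or_point 0 \<omega>))"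
      using g0 by (simp add: \<eta>_def exp_ereal_ln_ereal0 end_or_point_def)
    also have "(\<Prod>k = 1..K. exp_ereal (f k (\<omega> (t k)))) = (\<Prod>k\<in>N. exp_ereal (f k (\<omega> (t k))))"
      by (rule prod.mono_neutral_right) (auto simp: N_def f_def exp_ereal_0)
    also have "\<dots> = (\<Prod>k\<in>N. ennreal (g (t k) (end_or_point (t k) \<omega>)))"
      using g0 by (intro prod.cong) (auto simp: f_def exp_ereal_ln_ereal0 end_or_point_def N_def)
    also have "\<dots> = (\<Prod>i\<in>t ` {1..K} \<inter> {0<..<1}. ennreal (g i (end_or_point i \<omega>)))"
      by (rule prod.reindex_bij_betw[OF bij])
    also have "ennreal (g 0 (end_or_point 0 \<omega>)) * \<dots> = (\<Prod>i\<in>insert 0 (t ` {1..K} \<inter> {0<..<1}). ennreal (g i (end_or_point i \<omega>)))"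
      by (subst prod.insert) auto
    also have "\<dots> = ennreal (\<Prod>i\<in>insert 0 (t ` {1..K} \<inter> {0<..<1}). g i (end_or_point i \<omega>))"
      using g0 by (intro prod_ennreal)
    finally show "ennreal (\<Prod>i\<in>insert 0 (t ` {1..K} \<inter> {0<..<1}). g i (end_or_point i \<omega>)) =
        exp_ereal (\<eta> (\<omega> 0, \<omega> 1) + (\<Sum>k = 1..K. f k (\<omega> (t k))))" ..
  qed (unfold \<eta>_def, rule ln_ereal0_less_top, rule f_fin)
qed

theorem theorem5p4:
  fixes R P :: "(real \<Rightarrow> 'a::polish_space) measure"
    and T :: "real set"
    and \<mu> :: "real \<Rightarrow> 'a measure"
    and \<pi> :: "('a \<times> 'a) measure"
  assumes "reciprocal R"
    and "T \<subseteq> {0..1}"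
    and "\<And>t. t \<in> T \<Longrightarrow> sets (\<mu> t) = sets borel \<and> prob_space (\<mu> t)"
    and "sets \<pi> = sets borel \<and> prob_space \<pi>"
    and "is_solution R T \<mu> \<pi> P"
  shows "reciprocal P \<and>
    (irreducible_path R \<longrightarrow>
      (\<forall>K (t :: nat \<Rightarrow> real). T = t ` {1..K} \<longrightarrow>
        (\<exists>(\<eta> :: 'a \<times> 'a \<Rightarrow> ereal) (f :: nat \<Rightarrow> 'a \<Rightarrow> ereal).
           \<eta> \<in> borel_measurable borel \<and> (\<forall>x. \<eta> x < \<infinity>) \<and>
           (\<forall>i\<in>{1..K}. f i \<in> borel_measurable borel \<and> (\<forall>x. f i x < \<infinity>)) \<and>
           (AE \<omega> in R. RN_deriv R P \<omega> =
              exp_ereal (\<eta> (\<omega> 0, \<omega> 1) + (\<Sum>i = 1..K. f i (\<omega> (t i))))))))"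
proof -
  have cR: "conditionable R"
    using assms(1) by (simp add: reciprocal_def)
  then have RM: "R \<in> path_measures"
    by (simp add: conditionable_def)
  interpret R: sigma_finite_measure R
    by (rule sigma_finite_subalgebra_is_sigma_finite[OF sigma_finite_path_sigma[OF cR, where T = "{0}" and t = 0]]) auto
  have PP: "P \<in> path_probs"
    using assms(5) by (simp add: is_solution_def admissible_def)
  then interpret P: prob_space P
    by (simp add: path_probs_def)
  have sets_eq: "sets P = sets R"
    using RM PP by (simp add: path_measures_def path_probs_def)
  obtain W where W: "entropy_weight P R W"
    using assms(5) unfolding is_solution_def rel_entropy_defined_def by blast
  have ac: "absolutely_continuous R P"
    by (rule rel_entropy_finite_imp_ac[OF P.prob_space_axioms sets_eq W])
       (use assms(5) in \<open>simp add: is_solution_def\<close>)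
  define p where "p \<omega> = enn2real (RN_deriv R P \<omega>)" for \<omega>
  have p[measurable]: "p \<in> borel_measurable R" and p0: "\<And>\<omega>. 0 \<le> p \<omega>"
    unfolding p_def[abs_def] by auto
  have "AE \<omega> in R. RN_deriv R P \<omega> \<noteq> \<infinity>"
    by (rule R.RN_deriv_finite[OF P.sigma_finite_measure_axioms ac sets_eq])
  then have p_eq: "AE \<omega> in R. RN_deriv R P \<omega> = ennreal (p \<omega>)"
    by (auto simp: p_def less_top elim!: eventually_mono)
  have "density R p = density R (RN_deriv R P)"
    using p_eq by (intro density_cong) auto
  then have P_eq: "P = density R p"
    using R.density_RN_deriv[OF ac sets_eq] by simp
  note sol = assms(5)[unfolded P_eq]
  have "reciprocal P"
    unfolding P_eq by (rule reciprocal_entropy_minimizer[OF assms(1,2) sol p p0])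
  moreover have "\<exists>(\<eta> :: 'a \<times> 'a \<Rightarrow> ereal) (f :: nat \<Rightarrow> 'a \<Rightarrow> ereal).
      \<eta> \<in> borel_measurable borel \<and> (\<forall>x. \<eta> x < \<infinity>) \<and>
      (\<forall>i\<in>{1..K}. f i \<in> borel_measurable borel \<and> (\<forall>x. f i x < \<infinity>)) \<and>
      (AE \<omega> in R. RN_deriv R P \<omega> = exp_ereal (\<eta> (\<omega> 0, \<omega> 1) + (\<Sum>i = 1..K. f i (\<omega> (t i)))))"
    if irr: "irreducible_path R" and T: "T = t ` {1..K}" for K and t :: "nat \<Rightarrow> real"
  proof -
    have "finite T"
      by (simp add: T)
    obtain g :: "real \<Rightarrow> 'a \<times> 'a \<Rightarrow> real" where g: "\<And>i. g i \<in> borel_measurable borel" "\<And>i y. 0 \<le> g i y"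
      and pg: "AE \<omega> in R. p \<omega> = (\<Prod>i\<in>insert 0 (T \<inter> {0<..<1}). g i (end_or_point i \<omega>))"
      using entropy_minimizer_product_form[OF assms(1) irr \<open>finite T\<close> assms(2) sol p p0] by blast
    obtain \<eta> :: "'a \<times> 'a \<Rightarrow> ereal" and f :: "nat \<Rightarrow> 'a \<Rightarrow> ereal"
      where \<eta>f: "\<eta> \<in> borel_measurable borel" "\<And>y. \<eta> y < \<infinity>" "\<And>k. f k \<in> borel_measurable borel" "\<And>k x. f k x < \<infinity>"
      and eq: "\<And>\<omega>. ennreal (\<Prod>i\<in>insert 0 (t ` {1..K} \<inter> {0<..<1}). g i (end_or_point i \<omega>)) =
        exp_ereal (\<eta> (\<omega> 0, \<omega> 1) + (\<Sum>k = 1..K. f k (\<omega> (t k))))"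
      by (rule exp_ereal_product_form[of g t K, OF g]) blast
    have "AE \<omega> in R. RN_deriv R P \<omega> = exp_ereal (\<eta> (\<omega> 0, \<omega> 1) + (\<Sum>k = 1..K. f k (\<omega> (t k))))"
      using p_eq pg[unfolded T] by eventually_elim (simp only: eq)
    with \<eta>f show ?thesis
      by blast
  qed
  ultimately show ?thesis
    by blast
qed

end
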